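(* Let $T>0$ and let $\mu$ be a stochastic measure on the Borel $\sigma$-algebra of $[0,T]$ such that the process $\mu_t=\mu((0,t])$, $0\le t\le T$, has continuous paths. Assume that: 1) $\sigma\in C^2(\mathbb{R})$ and the derivatives $\sigma',\sigma''$ are bounded; 2) $b\in C(\mathbb{R}\times[0,T])$; 3) for each $C>0$ there exists $L(C)$ such that $|b(x,t)-b(y,t)|\le L(C)|x-y|$ for all $|x|,|y|\le C$, $t\in[0,T]$; 4) there is a constant $K$ such that $|b(x,t)|\le K(1+|x|)$ for all $x\in\mathbb{R}$, $t\in[0,T]$. Let $X_0$ be an arbitrary random variable. Let $F:\mathbb{R}^2\to\mathbb{R}$ be the solution of $$\frac{\partial F}{\partial r}(r,x)=\sigma(F(r,x)),\qquad F(0,x)=x,$$ and let $H(r,\cdot)=F(r,\cdot)^{-1}$ be the inverse of $F$ with respect to $x$. Then the equation $$\circ\,dX_t=\sigma(X_t)\circ d\mu_t+b(X_t,t)\,dt,\qquad 0\le t\le T,$$ with initial value $X_0$ has a unique solution, namely $X_t=F(\mu_t,Y_t)$, where $Y_t$ is the solution of the random equation $$Y_t=H(0,X_0)+\int_0^t\frac{\partial H}{\partial x}(\mu_s,F(\mu_s,Y_s))\,b(F(\mu_s,Y_s),s)\,ds,\qquad 0\le t\le T.$$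
   Context: Let $(\Omega,\mathcal{F},\mathsf{P})$ be a complete probability space and $L_0=L_0(\Omega,\mathcal{F},\mathsf{P})$ the space of (classes of) real-valued random variables with convergence in probability. A stochastic measure on a measurable space $(X,\mathcal{B})$ is a $\sigma$-additive mapping $\mu:\mathcal{B}\to L_0$, i.e. for pairwise disjoint $A_n\in\mathcal{B}$ one has $\mu(\bigcup_n A_n)=\sum_n\mu(A_n)$ with convergence in probability; no positivity, moment, martingale or adaptedness assumption is made. Symmetric (Stratonovich-type) integral: for random processes $\xi_s,\eta_s$ and $t\in(0,T]$, $$\int_{(0,t]}\xi_s\circ d\eta_s:=\operatorname*{p\,lim}_{n\to\infty}\sum_{k=1}^{j_n}\frac{\xi_{t_{k-1}^n}+\xi_{t_k^n}}{2}\,\bigl(\eta_{t_k^n}-\eta_{t_{k-1}^n}\bigr),$$ where $0=t_0^n<t_1^n<\dots<t_{j_n}^n=t$ is a sequence of partitions with $\max_k|t_k^n-t_{k-1}^n|\to0$, provided this limit in probability exists (for every such sequence of partitions, independently of the sequence). $C^{k,l}(\mathbb{R}^2)$ denotes functions that have continuous partial derivatives up to order $k$ in the first variable and up to order $l$ in the second variable. Definition of solution: a process $X_t$, $0\le t\le T$, is a solution of $\circ\,dX_t=\sigma(X_t)\circ d\mu_t+b(X_t,t)\,dt$ if (i) $X_t=f(\mu_t,Y_t)$ for some $f\in C^{2,1}(\mathbb{R}^2)$ and some continuous process $Y$ of bounded variation on $[0,T]$ (i.e. with continuous paths of bounded variation); (ii) for any process $Z_s=\psi(\mu_s,X_s)$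 with $\psi\in C^{1,1}(\mathbb{R}^2)$, $$\int_{(0,t]}Z_s\circ dX_s=\int_{(0,t]}Z_s\sigma(X_s)\circ d\mu_s+\int_{(0,t]}Z_s b(X_s,s)\,ds,\qquad t\in[0,T].$$ Under the assumptions on $\sigma$, $F$ exists globally, the inverse $H$ exists, and $F,H\in C^{2,2}(\mathbb{R}^2)$. The random equation for $Y$ is understood pathwise. Uniqueness is understood up to almost sure equality of the processes. *)

theory Defs
  imports "HOL-Probability.Probability"
begin

(* Elements of L_0 are represented by measurable functions. Measurability is part of the definition
   because measure P assigns 0 to non-measurable sets. *)
definition tendsto_in_prob :: "'w measure \<Rightarrow> (nat \<Rightarrow> 'w \<Rightarrow> real) \<Rightarrow> ('w \<Rightarrow> real) \<Rightarrow> bool" where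
  "tendsto_in_prob P X L \<longleftrightarrow>
     (\<forall>n. X n \<in> borel_measurable P) \<and> L \<in> borel_measurable P \<and>
     (\<forall>\<epsilon>>0. (\<lambda>n. measure P {\<omega> \<in> space P. \<bar>X n \<omega> - L \<omega>\<bar> > \<epsilon>}) \<longlonglongrightarrow> 0)"

definition stochastic_measure ::
  "'w measure \<Rightarrow> 'x measure \<Rightarrow> ('x set \<Rightarrow> 'w \<Rightarrow> real) \<Rightarrow> bool" where
  "stochastic_measure P B \<mu> \<longleftrightarrow>
     (\<forall>A\<in>sets B. \<mu> A \<in> borel_measurable P) \<and>
     (\<forall>A::nat \<Rightarrow> 'x set. range A \<subseteq> sets B \<longrightarrow> disjoint_family A \<longrightarrow>
        tendsto_in_prob P (\<lambda>n \<omega>. \<Sum>i<n. \<mu> (A i) \<omega>) (\<mu> (\<Union>i. A i)))"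

definition random_process :: "'w measure \<Rightarrow> real \<Rightarrow> (real \<Rightarrow> 'w \<Rightarrow> real) \<Rightarrow> bool" where
  "random_process P T X \<longleftrightarrow> (\<forall>t\<in>{0..T}. X t \<in> borel_measurable P)"

(* p k is the k-th of the points 0 = p 0 < p 1 < ... < p m = t *)
definition partition_of :: "real \<Rightarrow> nat \<Rightarrow> (nat \<Rightarrow> real) \<Rightarrow> bool" where
  "partition_of t m p \<longleftrightarrow> p 0 = 0 \<and> p m = t \<and> (\<forall>k\<in>{1..m}. p (k - 1) < p k)"

(* The last condition says that the mesh tends to 0; unlike a maximum over k it is meaningful for
   the empty partition as well, so that an integral over (0,0] is 0. *)
definition partition_sequence :: "real \<Rightarrow> (nat \<Rightarrow> nat) \<Rightarrow> (nat \<Rightarrow> nat \<Rightarrow> real) \<Rightarrow> bool" where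
  "partition_sequence t j p \<longleftrightarrow>
     (\<forall>n. partition_of t (j n) (p n)) \<and>
     (\<forall>\<delta>>0. \<forall>\<^sub>F n in sequentially. \<forall>k\<in>{1..j n}. \<bar>p n k - p n (k - 1)\<bar> < \<delta>)"

(* I is (a representative of) the symmetric integral of \<xi> with respect to \<eta> over (0,t] *)
definition has_symmetric_integral ::
  "'w measure \<Rightarrow> (real \<Rightarrow> 'w \<Rightarrow> real) \<Rightarrow> (real \<Rightarrow> 'w \<Rightarrow> real) \<Rightarrow> real \<Rightarrow> ('w \<Rightarrow> real) \<Rightarrow> bool" where
  "has_symmetric_integral P \<xi> \<eta> t I \<longleftrightarrow>
     (\<forall>j p. partition_sequence t j p \<longrightarrow>
        tendsto_in_prob P
          (\<lambda>n \<omega>. \<Sum>k=1..j n. (\<xi> (p n (k - 1)) \<omega> + \<xi> (p n k) \<omega>) / 2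
                             * (\<eta> (p n k) \<omega> - \<eta> (p n (k - 1)) \<omega>)) I)"

definition C_k :: "nat \<Rightarrow> (real \<Rightarrow> real) \<Rightarrow> bool" where
  "C_k k g \<longleftrightarrow>
     (\<forall>i<k. \<forall>x. (deriv ^^ i) g field_differentiable at x) \<and>
     (\<forall>i\<le>k. continuous_on UNIV ((deriv ^^ i) g))"

(* Only the pure partial derivatives are involved, and each is continuous jointly in both variables. *)
definition C_kl :: "nat \<Rightarrow> nat \<Rightarrow> (real \<Rightarrow> real \<Rightarrow> real) \<Rightarrow> bool" where
  "C_kl k l f \<longleftrightarrow>
     (\<forall>i<k. \<forall>x y. (deriv ^^ i) (\<lambda>u. f u y) field_differentiable at x) \<and>
     (\<forall>i\<le>k. continuous_on UNIV (\<lambda>(x, y). (deriv ^^ i) (\<lambda>u. f u y) x)) \<and>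
     (\<forall>i<l. \<forall>x y. (deriv ^^ i) (f x) field_differentiable at y) \<and>
     (\<forall>i\<le>l. continuous_on UNIV (\<lambda>(x, y). (deriv ^^ i) (f x) y))"

definition bounded_variation_on_interval :: "real \<Rightarrow> (real \<Rightarrow> real) \<Rightarrow> bool" where
  "bounded_variation_on_interval T g \<longleftrightarrow>
     (\<exists>V. \<forall>m p. partition_of T m p \<longrightarrow> (\<Sum>k=1..m. \<bar>g (p k) - g (p (k - 1))\<bar>) \<le> V)"

definition mu_process :: "(real set \<Rightarrow> 'w \<Rightarrow> real) \<Rightarrow> real \<Rightarrow> 'w \<Rightarrow> real" where
  "mu_process \<mu> t = \<mu> {0<..t}"

(* Identities between random variables or processes hold almost surely, simultaneously in time. *)
definition is_solution ::
  "'w measure \<Rightarrow> real \<Rightarrow> (real set \<Rightarrow> 'w \<Rightarrow> real) \<Rightarrow> (real \<Rightarrow> real) \<Rightarrow> (real \<Rightarrow> real \<Rightarrow> real) \<Rightarrow>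
     (real \<Rightarrow> 'w \<Rightarrow> real) \<Rightarrow> bool" where
  "is_solution P T \<mu> \<sigma> b X \<longleftrightarrow>
     random_process P T X \<and>
     (\<exists>f Y. C_kl 2 1 f \<and> random_process P T Y \<and>
        (\<forall>\<omega>\<in>space P. continuous_on {0..T} (\<lambda>t. Y t \<omega>) \<and>
                    bounded_variation_on_interval T (\<lambda>t. Y t \<omega>)) \<and>
        (AE \<omega> in P. \<forall>t\<in>{0..T}. X t \<omega> = f (mu_process \<mu> t \<omega>) (Y t \<omega>))) \<and>
     (\<forall>\<psi>. C_kl 1 1 \<psi> \<longrightarrow>
        (let Z = (\<lambda>s \<omega>. \<psi> (mu_process \<mu> s \<omega>) (X s \<omega>)) in
         \<forall>t\<in>{0..T}. \<exists>I J.
           has_symmetric_integral P Z X t I \<and>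
           has_symmetric_integral P (\<lambda>s \<omega>. Z s \<omega> * \<sigma> (X s \<omega>)) (mu_process \<mu>) t J \<and>
           (AE \<omega> in P. I \<omega> = J \<omega> + (LBINT s:{0<..t}. Z s \<omega> * b (X s \<omega>) s))))"

(* The random equation for Y holds on every path. Continuity guarantees that the integrand
   is integrable. *)
definition solves_random_equation ::
  "'w measure \<Rightarrow> real \<Rightarrow> (real set \<Rightarrow> 'w \<Rightarrow> real) \<Rightarrow> (real \<Rightarrow> real \<Rightarrow> real) \<Rightarrow>
     (real \<Rightarrow> real \<Rightarrow> real) \<Rightarrow> (real \<Rightarrow> real \<Rightarrow> real) \<Rightarrow> ('w \<Rightarrow> real) \<Rightarrow> (real \<Rightarrow> 'w \<Rightarrow> real) \<Rightarrow> bool" where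
  "solves_random_equation P T \<mu> b F H X0 Y \<longleftrightarrow>
     (\<forall>\<omega>\<in>space P.
        continuous_on {0..T} (\<lambda>t. Y t \<omega>) \<and>
        (\<forall>t\<in>{0..T}. Y t \<omega> = H 0 (X0 \<omega>) +
           (LBINT s:{0..t}. deriv (H (mu_process \<mu> s \<omega>)) (F (mu_process \<mu> s \<omega>) (Y s \<omega>))
                            * b (F (mu_process \<mu> s \<omega>) (Y s \<omega>)) s)))"

end

theory Submission
  imports Defs
begin

text \<open>
  The symmetric integral exists because quadratic sums of \<open>\<mu>\<close> over partitions are bounded in
  probability. This needs neither moments nor a control measure: were they unbounded, then, since
  every single increment is small on fine partitions, a sparse random union of partition
  intervals would have a large measure with a fixed positive probability while leaving the quadratic
  sums over the rest unbounded; iterating gives disjoint sets whose measures do not tend to 0.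

  Given this, every error that is \<open>o\<close> of the squared increments of \<open>\<mu>\<close> vanishes in probability, so
  that the trapezoidal rule along paths is the chain rule of ordinary calculus. For existence it is
  applied to \<open>F(\<mu>, Y)\<close>, where \<open>Y\<close> is continuously differentiable in time. For uniqueness it is applied
  to \<open>H(\<mu>, X)\<close> with the test function \<open>\<psi> = \<partial>H/\<partial>x\<close>: because \<open>\<partial>H/\<partial>r = - \<sigma> \<partial>H/\<partial>x\<close>, the integrals
  with respect to \<open>\<mu>\<close> cancel and \<open>H(\<mu>, X)\<close> solves the random equation. All regularity of \<open>H\<close> comes
  from \<open>H(r, x) = F(- r, x)\<close>.
\<close>

section \<open>Random subsets\<close>

text \<open>The quadratic sums are bounded only in probability, which gives no pathwise convergence
  of the symmetric sums. In its place each error is bounded, on almost every path and for late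
  \<open>n\<close>, by \<open>\<eta> * (1 + Q n)\<close> with arbitrary \<open>\<eta>\<close>, and
  \<open>Q n\<close> is bounded off an event of small probability. So errors must be of smaller
  order than the squared increments, uniformly in time; for the trapezoidal rule the oscillation of
  second derivatives provides this.

  Two demands on the random union compete: it must be large with a probability bounded away from 0,
  yet so sparse that removing it costs little. The bound for the first is uniform in the density
  \<open>p\<close> once \<open>p * (1 - p)\<close> times the quadratic sum reaches 2. Unboundedness
  provides this for every fixed \<open>p\<close>, so \<open>p\<close> can be chosen for the second
  demand alone.

  In the uniqueness part the representation f(\<mu>, V) of a solution comes without a mixed second
  derivative of f. It serves only to make the solution continuous and to control its squared
  increments; the chain rule is applied to the smooth inverse flow.\<close>

definition subset_mean :: "real \<Rightarrow> 'i set \<Rightarrow> ('i set \<Rightarrow> real) \<Rightarrow> real" where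
  "subset_mean p I f = (\<Sum>S\<in>Pow I. p ^ card S * (1 - p) ^ card (I - S) * f S)"

lemma subset_mean_empty [simp]: "subset_mean p {} f = f {}"
  by (simp add: subset_mean_def)

text \<open>\<open>subset_mean p I f\<close> is the expectation of \<open>f\<close> at a random
  subset of \<open>I\<close> that contains each index independently with probability
  \<open>p\<close>; here one conditions on whether \<open>a\<close> is chosen. The moment
  computations are inductions along this recursion.\<close>

lemma subset_mean_insert:
  assumes "finite I" "a \<notin> I"
  shows "subset_mean p (insert a I) f = subset_mean p I (\<lambda>S. p * f (insert a S) + (1 - p) * f S)"
proof -
  have fin: "finite S" and notin: "a \<notin> S" if "S \<in> Pow I" for S
    using assms that finite_subset by auto
  have inj: "inj_on (insert a) (Pow I)"
    using assms(2) by (auto simp: inj_on_def)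
  have disj: "Pow I \<inter> insert a ` Pow I = {}"
    using assms(2) by auto
  have "subset_mean p (insert a I) f =
      (\<Sum>S\<in>Pow I. p ^ card S * (1 - p) ^ card (insert a I - S) * f S) +
      (\<Sum>S\<in>insert a ` Pow I. p ^ card S * (1 - p) ^ card (insert a I - S) * f S)"
    unfolding subset_mean_def Pow_insert
    by (rule sum.union_disjoint) (use assms disj in auto)
  also have "(\<Sum>S\<in>insert a ` Pow I. p ^ card S * (1 - p) ^ card (insert a I - S) * f S) =
      (\<Sum>S\<in>Pow I. p ^ card S * (1 - p) ^ card (I - S) * (p * f (insert a S)))"
  proof (subst sum.reindex[OF inj], rule sum.cong)
    fix S assume S: "S \<in> Pow I"
    have "insert a I - insert a S = I - S" using notin[OF S] assms(2) by auto
    then show "((\<lambda>S. p ^ card S * (1 - p) ^ card (insert a I - S) * f S) \<circ> insert a) S =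
        p ^ card S * (1 - p) ^ card (I - S) * (p * f (insert a S))"
      using fin[OF S] notin[OF S] by simp
  qed simp
  also have "(\<Sum>S\<in>Pow I. p ^ card S * (1 - p) ^ card (insert a I - S) * f S) =
      (\<Sum>S\<in>Pow I. p ^ card S * (1 - p) ^ card (I - S) * ((1 - p) * f S))"
  proof (rule sum.cong)
    fix S assume S: "S \<in> Pow I"
    have "insert a I - S = insert a (I - S)" "a \<notin> I - S"
      using notin[OF S] assms(2) by auto
    then show "p ^ card S * (1 - p) ^ card (insert a I - S) * f S =
        p ^ card S * (1 - p) ^ card (I - S) * ((1 - p) * f S)"
      using assms(1) by simp
  qed simp
  finally show ?thesis
    by (simp add: subset_mean_def sum.distrib[symmetric] algebra_simps)
qed

lemma subset_mean_add: "subset_mean p I (\<lambda>S. f S + g S) = subset_mean p I f + subset_mean p I g"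
  by (simp add: subset_mean_def sum.distrib algebra_simps)

lemma subset_mean_cmult: "subset_mean p I (\<lambda>S. c * f S) = c * subset_mean p I f"
  by (simp add: subset_mean_def sum_distrib_left algebra_simps)

lemma subset_mean_const [simp]: "finite I \<Longrightarrow> subset_mean p I (\<lambda>S. c) = c"
proof (induction I rule: finite_induct)
  case (insert a I)
  have "(\<lambda>S::'a set. p * c + (1 - p) * c) = (\<lambda>S. c)" by (simp add: algebra_simps)
  with insert show ?case by (simp add: subset_mean_insert)
qed simp

lemma subset_mean_mono:
  assumes "0 \<le> p" "p \<le> 1" "\<And>S. S \<subseteq> I \<Longrightarrow> f S \<le> g S"
  shows "subset_mean p I f \<le> subset_mean p I g"
  unfolding subset_mean_def by (intro sum_mono mult_left_mono) (use assms in auto)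

lemma subset_mean_sum:
  assumes "finite I"
  shows "subset_mean p I (\<lambda>S. \<Sum>i\<in>S. x i) = p * (\<Sum>i\<in>I. x i)"
  using assms
proof (induction I rule: finite_induct)
  case (insert a I)
  have "subset_mean p (insert a I) (\<lambda>S. \<Sum>i\<in>S. x i) =
      subset_mean p I (\<lambda>S. p * (\<Sum>i\<in>insert a S. x i) + (1 - p) * (\<Sum>i\<in>S. x i))"
    using insert by (simp add: subset_mean_insert)
  also have "\<dots> = subset_mean p I (\<lambda>S. p * x a + (\<Sum>i\<in>S. x i))"
    unfolding subset_mean_def
  proof (intro sum.cong refl arg_cong2[where f="(*)"])
    fix S assume "S \<in> Pow I"
    then have "finite S" "a \<notin> S" using insert finite_subset by auto
    then show "p * (\<Sum>i\<in>insert a S. x i) + (1 - p) * (\<Sum>i\<in>S. x i) = p * x a + (\<Sum>i\<in>S. x i)"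
      by (simp add: algebra_simps)
  qed
  also have "\<dots> = p * (\<Sum>i\<in>insert a I. x i)"
    using insert by (simp add: subset_mean_add algebra_simps)
  finally show ?case .
qed simp

text \<open>\<open>Z I S\<close> is a sum of independent centered variables, the one of index
  \<open>i\<close> being \<open>(1 - p) * x i\<close> with probability \<open>p\<close> and
  \<open>- p * x i\<close> otherwise. Adding one of them changes the moments by explicit
  polynomials, in which the terms linear in \<open>Z\<close> average to 0.\<close>

lemma subset_mean_centered_moments:
  fixes x :: "'i \<Rightarrow> real"
  assumes "finite I" "0 \<le> p" "p \<le> 1"
  defines "Z \<equiv> \<lambda>I S. (\<Sum>i\<in>S. x i) - p * (\<Sum>i\<in>I. x i)"
  shows "subset_mean p I (Z I) = 0"
    and "subset_mean p I (\<lambda>S. (Z I S)\<^sup>2) = p * (1 - p) * (\<Sum>i\<in>I. (x i)\<^sup>2)"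
    and "subset_mean p I (\<lambda>S. (Z I S) ^ 4) \<le>
      3 * (p * (1 - p) * (\<Sum>i\<in>I. (x i)\<^sup>2))\<^sup>2 + p * (1 - p) * (\<Sum>i\<in>I. (x i) ^ 4)"
proof -
  have "subset_mean p I (Z I) = 0 \<and>
    subset_mean p I (\<lambda>S. (Z I S)\<^sup>2) = p * (1 - p) * (\<Sum>i\<in>I. (x i)\<^sup>2) \<and>
    subset_mean p I (\<lambda>S. (Z I S) ^ 4) \<le>
      3 * (p * (1 - p) * (\<Sum>i\<in>I. (x i)\<^sup>2))\<^sup>2 + p * (1 - p) * (\<Sum>i\<in>I. (x i) ^ 4)"
    using assms(1)
  proof (induction I rule: finite_induct)
    case empty
    then show ?case by (simp add: Z_def)
  next
    case (insert a I)
    let ?q = "1 - p" and ?v = "p * (1 - p) * (\<Sum>i\<in>I. (x i)\<^sup>2)"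
    have fin: "finite S" "a \<notin> S" if "S \<subseteq> I" for S using that insert finite_subset by auto
    have Z1: "Z (insert a I) (insert a S) = Z I S + ?q * x a"
      and Z0: "Z (insert a I) S = Z I S - p * x a" if "S \<subseteq> I" for S
      using fin[OF that] insert by (simp_all add: Z_def algebra_simps)
    have step: "subset_mean p (insert a I) (\<lambda>S. g (Z (insert a I) S)) =
        subset_mean p I (\<lambda>S. p * g (Z I S + ?q * x a) + ?q * g (Z I S - p * x a))" for g :: "real \<Rightarrow> real"
      unfolding subset_mean_insert[OF insert(1,2)] by (simp add: subset_mean_def Z1 Z0)
    have 1: "subset_mean p (insert a I) (Z (insert a I)) = 0"
    proof -
      have "subset_mean p (insert a I) (\<lambda>S. Z (insert a I) S) = subset_mean p I (Z I)"
        unfolding step[of "\<lambda>z. z"] by (simp add: algebra_simps)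
      then show ?thesis using insert by simp
    qed
    have 2: "subset_mean p (insert a I) (\<lambda>S. (Z (insert a I) S)\<^sup>2) =
        p * ?q * (\<Sum>i\<in>insert a I. (x i)\<^sup>2)"
    proof -
      have e: "p * (z + ?q * x a)\<^sup>2 + ?q * (z - p * x a)\<^sup>2 = z\<^sup>2 + p * ?q * (x a)\<^sup>2" for z
        by (simp add: power2_eq_square algebra_simps)
      show ?thesis
        unfolding step[of "\<lambda>z. z\<^sup>2"] e subset_mean_add using insert by (simp add: algebra_simps)
    qed
    \<comment> \<open>The cubic terms in \<open>z\<close> cancel, \<open>?c3 * z\<close> has mean 0,
      and \<open>(1 - p) ^ 3 + p ^ 3 \<le> 1\<close> bounds \<open>?c4\<close>. The estimate after
      this one adds three times the square of \<open>p * (1 - p) * (x a)\<^sup>2\<close> to complete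
      the square.\<close>
    have "subset_mean p (insert a I) (\<lambda>S. (Z (insert a I) S) ^ 4) \<le>
        3 * ?v\<^sup>2 + p * ?q * (\<Sum>i\<in>I. (x i) ^ 4) + 6 * p * ?q * (x a)\<^sup>2 * ?v + p * ?q * (x a) ^ 4"
    proof -
      let ?c3 = "4 * p * ?q * (?q\<^sup>2 - p\<^sup>2) * (x a) ^ 3" and ?c4 = "p * ?q * (?q ^ 3 + p ^ 3) * (x a) ^ 4"
      have e: "p * (z + ?q * x a) ^ 4 + ?q * (z - p * x a) ^ 4 =
          z ^ 4 + 6 * p * ?q * (x a)\<^sup>2 * z\<^sup>2 + ?c3 * z + ?c4" for z
        by (simp add: power4_eq_xxxx power3_eq_cube power2_eq_square) (simp add: algebra_simps)
      have "?q ^ 3 + p ^ 3 \<le> ?q + p"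
        by (intro add_mono) (use assms(2,3) in \<open>auto intro: power_le_one_iff simp: power_decreasing[of 1 3, simplified]\<close>)
      then have c4: "?c4 \<le> p * ?q * (x a) ^ 4"
        using assms(2,3) by (intro mult_right_mono) (auto intro: mult_left_le)
      have "subset_mean p (insert a I) (\<lambda>S. (Z (insert a I) S) ^ 4) =
          subset_mean p I (\<lambda>S. Z I S ^ 4) + 6 * p * ?q * (x a)\<^sup>2 * ?v + ?c4"
        unfolding step[of "\<lambda>z. z ^ 4"] e subset_mean_add subset_mean_cmult using insert by simp
      then show ?thesis using insert c4 by linarith
    qed
    also have "\<dots> \<le> 3 * (p * ?q * (\<Sum>i\<in>insert a I. (x i)\<^sup>2))\<^sup>2 + p * ?q * (\<Sum>i\<in>insert a I. (x i) ^ 4)"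
    proof -
      have "0 \<le> (p * ?q * (x a)\<^sup>2)\<^sup>2" by simp
      then show ?thesis
        using insert by (simp add: power2_eq_square algebra_simps)
    qed
    finally show ?case using 1 2 by blast
  qed
  then show "subset_mean p I (Z I) = 0"
    and "subset_mean p I (\<lambda>S. (Z I S)\<^sup>2) = p * (1 - p) * (\<Sum>i\<in>I. (x i)\<^sup>2)"
    and "subset_mean p I (\<lambda>S. (Z I S) ^ 4) \<le>
      3 * (p * (1 - p) * (\<Sum>i\<in>I. (x i)\<^sup>2))\<^sup>2 + p * (1 - p) * (\<Sum>i\<in>I. (x i) ^ 4)"
    by blast+
qed

text \<open>A Paley--Zygmund bound whose constant does not depend on the density \<open>p\<close> of the random
  subset; this is what makes it possible to use up only a small part of the index set.\<close>

lemma subset_mean_large_sum: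
  fixes x :: "'i \<Rightarrow> real"
  assumes I: "finite I" and p: "0 \<le> p" "p \<le> 1"
    and small: "\<And>i. i \<in> I \<Longrightarrow> \<bar>x i\<bar> \<le> 1"
    and large: "2 \<le> p * (1 - p) * (\<Sum>i\<in>I. (x i)\<^sup>2)"
  shows "1 / 128 \<le> subset_mean p I (\<lambda>S. of_bool (\<bar>\<Sum>i\<in>S. x i\<bar> > 1))"
proof -
  define m where "m = p * (\<Sum>i\<in>I. x i)"
  define v where "v = p * (1 - p) * (\<Sum>i\<in>I. (x i)\<^sup>2)"
  define Z where "Z S = (\<Sum>i\<in>S. x i) - m" for S
  define w where "w = subset_mean p I (\<lambda>S. of_bool (\<bar>\<Sum>i\<in>S. x i\<bar> > 1))"
  define e where "e = v + m\<^sup>2"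
  have Z: "subset_mean p I Z = 0" "subset_mean p I (\<lambda>S. (Z S)\<^sup>2) = v"
    "subset_mean p I (\<lambda>S. Z S ^ 4) \<le> 3 * v\<^sup>2 + p * (1 - p) * (\<Sum>i\<in>I. (x i) ^ 4)"
    using subset_mean_centered_moments[OF I p, of x] unfolding Z_def m_def v_def by simp_all
  have v: "2 \<le> v" using large by (simp add: v_def)
  \<comment> \<open>Entries of size at most 1 and \<open>2 \<le> v\<close> let
    \<open>v\<^sup>2\<close> dominate the sum of fourth powers, so the fourth moment is comparable
    with the square of the second.\<close>
  have x4: "x i ^ 4 \<le> (x i)\<^sup>2" if "i \<in> I" for i
    using power_decreasing[of 2 4 "\<bar>x i\<bar>"] small[OF that] by simp
  have "p * (1 - p) * (\<Sum>i\<in>I. (x i) ^ 4) \<le> v"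
    unfolding v_def using p x4 by (intro mult_left_mono sum_mono) auto
  moreover have "v \<le> v\<^sup>2" using v by (simp add: power2_eq_square)
  ultimately have Z4: "subset_mean p I (\<lambda>S. Z S ^ 4) \<le> 4 * v\<^sup>2" using Z(3) by linarith
  have mean2: "subset_mean p I (\<lambda>S. (\<Sum>i\<in>S. x i)\<^sup>2) = e"
  proof -
    have "(\<Sum>i\<in>S. x i)\<^sup>2 = (Z S)\<^sup>2 + (2 * m) * Z S + m\<^sup>2" for S
      by (simp add: Z_def power2_eq_square algebra_simps)
    then show ?thesis
      by (simp only: subset_mean_add subset_mean_cmult Z subset_mean_const[OF I] e_def)
  qed
  \<comment> \<open>The mean \<open>m\<close> can be arbitrarily large, so the moments are compared
    for the uncentered sum, whose second moment is \<open>e\<close>. The factor 8 of the convexity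
    bound turns the 4 of \<open>Z4\<close> into 32.\<close>
  have mean4: "subset_mean p I (\<lambda>S. (\<Sum>i\<in>S. x i) ^ 4) \<le> 32 * e\<^sup>2"
  proof -
    have q2: "(a + b)\<^sup>2 \<le> 2 * a\<^sup>2 + 2 * b\<^sup>2" for a b :: real
      using zero_le_power2[of "a - b"] by (simp add: power2_eq_square algebra_simps)
    have q: "(a + b) ^ 4 \<le> 8 * a ^ 4 + 8 * b ^ 4" for a b :: real
    proof -
      have "((a + b)\<^sup>2)\<^sup>2 \<le> (2 * a\<^sup>2 + 2 * b\<^sup>2)\<^sup>2" by (intro power_mono q2) auto
      also have "\<dots> \<le> 2 * (2 * a\<^sup>2)\<^sup>2 + 2 * (2 * b\<^sup>2)\<^sup>2" by (rule q2)
      finally show ?thesis by (simp add: power_mult_distrib flip: power_mult)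
    qed
    have "subset_mean p I (\<lambda>S. (\<Sum>i\<in>S. x i) ^ 4) \<le> subset_mean p I (\<lambda>S. 8 * Z S ^ 4 + 8 * m ^ 4)"
      using q[of "Z _" m] by (intro subset_mean_mono p) (simp add: Z_def)
    also have "\<dots> \<le> 32 * v\<^sup>2 + 8 * m ^ 4"
      using Z4 by (simp add: subset_mean_add subset_mean_cmult I)
    also have "\<dots> \<le> 32 * e\<^sup>2"
    proof -
      have "32 * e\<^sup>2 = 32 * v\<^sup>2 + 8 * m ^ 4 + (64 * (v * m\<^sup>2) + 24 * m ^ 4)"
        by (simp add: e_def power2_eq_square power4_eq_xxxx algebra_simps)
      moreover have "0 \<le> v * m\<^sup>2" using v by simp
      ultimately show ?thesis by simp
    qed
    finally show ?thesis .
  qed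
  have e: "2 \<le> e" using v by (simp add: e_def add_increasing2)
  have "e = subset_mean p I (\<lambda>S. (\<Sum>i\<in>S. x i)\<^sup>2)" using mean2 by simp
  \<comment> \<open>Where the sum is large, the square of \<open>?y - 64 * e\<close> gives
    \<open>?y \<le> ?y\<^sup>2 / (128 * e) + 32 * e\<close>; elsewhere \<open>?y \<le> 1\<close>.
    Averaging yields \<open>e \<le> 1 + e / 4 + 32 * e * w\<close>, and \<open>1 \<le> e / 2\<close>
    leaves \<open>1 / 128 \<le> w\<close>.\<close>
  also have "\<dots> \<le> subset_mean p I (\<lambda>S. 1 + (1 / (128 * e)) * (\<Sum>i\<in>S. x i) ^ 4 +
      32 * e * of_bool (\<bar>\<Sum>i\<in>S. x i\<bar> > 1))"
  proof (intro subset_mean_mono p)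
    fix S
    let ?y = "(\<Sum>i\<in>S. x i)\<^sup>2"
    have y4: "(\<Sum>i\<in>S. x i) ^ 4 = ?y\<^sup>2" by (simp flip: power_mult)
    show "?y \<le> 1 + (1 / (128 * e)) * (\<Sum>i\<in>S. x i) ^ 4 + 32 * e * of_bool (\<bar>\<Sum>i\<in>S. x i\<bar> > 1)"
    proof (cases "\<bar>\<Sum>i\<in>S. x i\<bar> > 1")
      case True
      have "0 \<le> (?y - 64 * e)\<^sup>2 / (128 * e)" using e by simp
      also have "\<dots> = ?y\<^sup>2 / (128 * e) + 32 * e - ?y"
        using e by (simp add: power2_eq_square field_simps)
      finally show ?thesis unfolding y4 using True by simp
    next
      case False
      then have "?y \<le> 1" by (simp add: abs_square_le_1)
      then show ?thesis using e by (simp add: add_increasing2)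
    qed
  qed
  also have "\<dots> = 1 + (1 / (128 * e)) * subset_mean p I (\<lambda>S. (\<Sum>i\<in>S. x i) ^ 4) + 32 * e * w"
    by (simp only: subset_mean_add subset_mean_cmult subset_mean_const[OF I] w_def)
  also have "\<dots> \<le> 1 + (1 / (128 * e)) * (32 * e\<^sup>2) + 32 * e * w"
    using e by (intro add_mono mult_left_mono mean4) auto
  also have "\<dots> = 1 + e / 4 + 32 * e * w"
    using e by (simp add: power2_eq_square)
  finally have "e / 4 \<le> 32 * e * w" using e by linarith
  then have "1 / 128 \<le> w" using e by (simp add: field_simps)
  then show ?thesis by (simp add: w_def)
qed

text \<open>If the complement of \<open>S\<close> carries at most \<open>K\<close> of a total above
  \<open>2 * K\<close>, then \<open>S\<close> carries more than half of the total. Its expected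
  share is \<open>p\<close>, so this is Markov's inequality: removing a sparse random set rarely
  halves a sum.\<close>

lemma subset_mean_half_sum:
  fixes x :: "'i \<Rightarrow> real"
  assumes I: "finite I" and p: "0 \<le> p" "p \<le> 1" and x: "\<And>i. i \<in> I \<Longrightarrow> 0 \<le> x i" and K: "0 \<le> K"
  shows "subset_mean p I (\<lambda>S. of_bool ((\<Sum>i\<in>I - S. x i) \<le> K \<and> 2 * K < (\<Sum>i\<in>I. x i))) \<le> 2 * p"
proof (cases "2 * K < (\<Sum>i\<in>I. x i)")
  case True
  let ?s = "\<Sum>i\<in>I. x i"
  have s: "0 < ?s" using True K by linarith
  have "subset_mean p I (\<lambda>S. of_bool ((\<Sum>i\<in>I - S. x i) \<le> K \<and> 2 * K < ?s))
      \<le> subset_mean p I (\<lambda>S. (2 / ?s) * (\<Sum>i\<in>S. x i))"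
  proof (intro subset_mean_mono p)
    fix S assume S: "S \<subseteq> I"
    have "?s = (\<Sum>i\<in>S. x i) + (\<Sum>i\<in>I - S. x i)"
      using sum.subset_diff[OF S I, of x] by (simp add: add.commute)
    moreover have "0 \<le> (\<Sum>i\<in>S. x i)" using S x by (intro sum_nonneg) auto
    ultimately show "of_bool ((\<Sum>i\<in>I - S. x i) \<le> K \<and> 2 * K < ?s) \<le> (2 / ?s) * (\<Sum>i\<in>S. x i)"
      using s by (auto simp: field_simps)
  qed
  also have "\<dots> = 2 * p"
    unfolding subset_mean_cmult subset_mean_sum[OF I] using s by simp
  finally show ?thesis .
next
  case False
  then show ?thesis using I p by simp
qed

section \<open>Convergence in probability\<close>

context prob_space
begin

lemma tendsto_in_prob_diff:
  assumes "tendsto_in_prob M X L" "tendsto_in_prob M Y K"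
  shows "tendsto_in_prob M (\<lambda>n \<omega>. X n \<omega> - Y n \<omega>) (\<lambda>\<omega>. L \<omega> - K \<omega>)"
proof -
  have [measurable]: "\<And>n. X n \<in> borel_measurable M" "L \<in> borel_measurable M"
    "\<And>n. Y n \<in> borel_measurable M" "K \<in> borel_measurable M"
    using assms by (auto simp: tendsto_in_prob_def)
  have "(\<lambda>n. prob {\<omega> \<in> space M. \<bar>X n \<omega> - Y n \<omega> - (L \<omega> - K \<omega>)\<bar> > \<epsilon>}) \<longlonglongrightarrow> 0" if "\<epsilon> > 0" for \<epsilon>
  proof (rule tendsto_sandwich[OF always_eventually always_eventually tendsto_const])
    show "(\<lambda>n. prob {\<omega> \<in> space M. \<bar>X n \<omega> - L \<omega>\<bar> > \<epsilon> / 2} + prob {\<omega> \<in> space M. \<bar>Y n \<omega> - K \<omega>\<bar> > \<epsilon> / 2}) \<longlonglongrightarrow> 0"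
      using assms half_gt_zero[OF that] unfolding tendsto_in_prob_def by (intro tendsto_add_zero) blast+
    show "\<forall>n. prob {\<omega> \<in> space M. \<bar>X n \<omega> - Y n \<omega> - (L \<omega> - K \<omega>)\<bar> > \<epsilon>} \<le>
        prob {\<omega> \<in> space M. \<bar>X n \<omega> - L \<omega>\<bar> > \<epsilon> / 2} + prob {\<omega> \<in> space M. \<bar>Y n \<omega> - K \<omega>\<bar> > \<epsilon> / 2}"
    proof
      fix n
      have "prob {\<omega> \<in> space M. \<bar>X n \<omega> - Y n \<omega> - (L \<omega> - K \<omega>)\<bar> > \<epsilon>} \<le>
        prob ({\<omega> \<in> space M. \<bar>X n \<omega> - L \<omega>\<bar> > \<epsilon> / 2} \<union> {\<omega> \<in> space M. \<bar>Y n \<omega> - K \<omega>\<bar> > \<epsilon> / 2})"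
        by (intro finite_measure_mono) (auto simp: abs_if split: if_splits)
      also have "\<dots> \<le> prob {\<omega> \<in> space M. \<bar>X n \<omega> - L \<omega>\<bar> > \<epsilon> / 2} + prob {\<omega> \<in> space M. \<bar>Y n \<omega> - K \<omega>\<bar> > \<epsilon> / 2}"
        by (intro measure_Un_le) auto
      finally show "prob {\<omega> \<in> space M. \<bar>X n \<omega> - Y n \<omega> - (L \<omega> - K \<omega>)\<bar> > \<epsilon>} \<le> \<dots>" .
    qed
  qed simp
  then show ?thesis by (simp add: tendsto_in_prob_def)
qed

lemma tendsto_in_prob_const: "L \<in> borel_measurable M \<Longrightarrow> tendsto_in_prob M (\<lambda>n. L) L"
  by (simp add: tendsto_in_prob_def)

lemma tendsto_in_prob_add:
  assumes "tendsto_in_prob M X L" "tendsto_in_prob M Y K"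
  shows "tendsto_in_prob M (\<lambda>n \<omega>. X n \<omega> + Y n \<omega>) (\<lambda>\<omega>. L \<omega> + K \<omega>)"
  using tendsto_in_prob_diff[OF assms(1) tendsto_in_prob_diff[OF tendsto_in_prob_const assms(2), of "\<lambda>_. 0"]]
  by simp

lemma tendsto_in_prob_unique:
  assumes "tendsto_in_prob M X L" "tendsto_in_prob M X K"
  shows "AE \<omega> in M. L \<omega> = K \<omega>"
proof -
  have [measurable]: "L \<in> borel_measurable M" "K \<in> borel_measurable M"
    using assms by (auto simp: tendsto_in_prob_def)
  have "prob {\<omega> \<in> space M. \<bar>0 - (L \<omega> - K \<omega>)\<bar> > \<epsilon>} = 0" if "\<epsilon> > 0" for \<epsilon>
    using tendsto_in_prob_diff[OF assms] that by (auto simp: tendsto_in_prob_def dest: LIMSEQ_unique[OF tendsto_const])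
  then have "AE \<omega> in M. \<not> \<bar>L \<omega> - K \<omega>\<bar> > \<epsilon>" if "\<epsilon> > 0" for \<epsilon>
    using that by (intro AE_I'[of "{\<omega> \<in> space M. \<bar>L \<omega> - K \<omega>\<bar> > \<epsilon>}"])
      (auto simp: null_sets_def emeasure_eq_measure abs_minus_commute)
  then have "AE \<omega> in M. \<forall>n. \<not> \<bar>L \<omega> - K \<omega>\<bar> > 1 / Suc n"
    by (subst AE_all_countable) (auto simp del: of_nat_Suc)
  then show ?thesis
  proof eventually_elim
    case (elim \<omega>)
    show "L \<omega> = K \<omega>"
    proof (rule ccontr)
      assume "L \<omega> \<noteq> K \<omega>"
      then obtain n where "1 / Suc n < \<bar>L \<omega> - K \<omega>\<bar>"
        using nat_approx_posE[of "\<bar>L \<omega> - K \<omega>\<bar>"] by auto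
      with elim show False by blast
    qed
  qed
qed

lemma tendsto_in_prob_subseq:
  assumes "tendsto_in_prob M X L" "strict_mono r"
  shows "tendsto_in_prob M (\<lambda>n. X (r n)) L"
  unfolding tendsto_in_prob_def
proof (intro conjI allI impI)
  fix \<epsilon> :: real assume "\<epsilon> > 0"
  then have "(\<lambda>n. prob {\<omega> \<in> space M. \<bar>X n \<omega> - L \<omega>\<bar> > \<epsilon>}) \<longlonglongrightarrow> 0"
    using assms(1) by (simp add: tendsto_in_prob_def)
  from LIMSEQ_subseq_LIMSEQ[OF this assms(2)]
  show "(\<lambda>n. prob {\<omega> \<in> space M. \<bar>X (r n) \<omega> - L \<omega>\<bar> > \<epsilon>}) \<longlonglongrightarrow> 0"
    by (simp add: comp_def)
qed (use assms(1) in \<open>auto simp: tendsto_in_prob_def\<close>)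

lemma tendsto_in_prob_cong:
  assumes "tendsto_in_prob M X L" "\<And>n. Y n \<in> borel_measurable M" "\<And>n. n \<ge> N \<Longrightarrow> AE \<omega> in M. X n \<omega> = Y n \<omega>"
  shows "tendsto_in_prob M Y L"
proof -
  have [measurable]: "\<And>n. X n \<in> borel_measurable M" "L \<in> borel_measurable M"
    using assms by (auto simp: tendsto_in_prob_def)
  have "(\<lambda>n. prob {\<omega> \<in> space M. \<bar>Y n \<omega> - L \<omega>\<bar> > \<epsilon>}) \<longlonglongrightarrow> 0" if "\<epsilon> > 0" for \<epsilon>
  proof (rule Lim_transform_eventually)
    show "(\<lambda>n. prob {\<omega> \<in> space M. \<bar>X n \<omega> - L \<omega>\<bar> > \<epsilon>}) \<longlonglongrightarrow> 0"
      using assms(1) that by (simp add: tendsto_in_prob_def)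
    have "prob {\<omega> \<in> space M. \<bar>X n \<omega> - L \<omega>\<bar> > \<epsilon>} = prob {\<omega> \<in> space M. \<bar>Y n \<omega> - L \<omega>\<bar> > \<epsilon>}" if "n \<ge> N" for n
      using assms(3)[OF that] assms(2)[measurable]
      by (intro finite_measure_eq_AE) (auto elim!: eventually_mono)
    then show "\<forall>\<^sub>F n in sequentially. prob {\<omega> \<in> space M. \<bar>X n \<omega> - L \<omega>\<bar> > \<epsilon>} = prob {\<omega> \<in> space M. \<bar>Y n \<omega> - L \<omega>\<bar> > \<epsilon>}"
      using eventually_sequentially by auto
  qed
  then show ?thesis using assms(2) by (simp add: tendsto_in_prob_def)
qed

lemma prob_tendsto_0_if_AE_eventually_notin:
  assumes [measurable]: "\<And>n::nat. A n \<in> events" and "AE \<omega> in M. \<forall>\<^sub>F n in sequentially. \<omega> \<notin> A n"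
  shows "(\<lambda>n. prob (A n)) \<longlonglongrightarrow> 0"
proof -
  have "(\<lambda>n. \<integral>\<omega>. indicator (A n) \<omega> \<partial>M) \<longlonglongrightarrow> (\<integral>\<omega>. (0::real) \<partial>M)"
  proof (rule integral_dominated_convergence[where w="\<lambda>_. 1"])
    show "AE \<omega> in M. (\<lambda>n. indicator (A n) \<omega> :: real) \<longlonglongrightarrow> 0"
      using assms(2)
    proof eventually_elim
      case (elim \<omega>)
      show ?case
        by (rule tendsto_eventually, rule eventually_mono[OF elim]) simp
    qed
  qed (auto simp: indicator_def)
  then show ?thesis by simp
qed

text \<open>The threshold \<open>K\<close> for \<open>Q\<close> depends only on the tolerated
  probability, so \<open>\<eta>\<close> may be chosen after it. No bound on \<open>Q\<close> along a
  single path enters.\<close>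

lemma tendsto_in_prob_0I:
  assumes [measurable]: "\<And>n. E n \<in> borel_measurable M" "\<And>n. Q n \<in> borel_measurable M"
    and bdd: "\<And>\<delta>. \<delta> > 0 \<Longrightarrow> \<exists>K N. \<forall>n\<ge>N. prob {\<omega> \<in> space M. Q n \<omega> > K} \<le> \<delta>"
    and small: "AE \<omega> in M. \<forall>\<eta>>0. \<forall>\<^sub>F n in sequentially. \<bar>E n \<omega>\<bar> \<le> \<eta> * (1 + Q n \<omega>)"
  shows "tendsto_in_prob M E (\<lambda>_. 0)"
proof -
  have "(\<lambda>n. prob {\<omega> \<in> space M. \<bar>E n \<omega>\<bar> > \<epsilon>}) \<longlonglongrightarrow> 0" if "\<epsilon> > 0" for \<epsilon>
  proof (rule order_tendstoI)
    fix r :: real assume "0 < r"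
    then obtain K N where K: "\<And>n. n \<ge> N \<Longrightarrow> prob {\<omega> \<in> space M. Q n \<omega> > K} \<le> r / 2"
      using bdd[of "r / 2"] by auto
    \<comment> \<open>Makes the error at most \<open>\<epsilon>\<close> wherever \<open>Q n\<close>
      is at most \<open>K\<close>. The maximum guards against a negative \<open>K\<close>.\<close>
    define \<eta> where "\<eta> = \<epsilon> / (1 + max K 0)"
    have \<eta>: "\<eta> > 0" using that by (auto simp: \<eta>_def intro!: divide_pos_pos)
    let ?A = "\<lambda>n. {\<omega> \<in> space M. \<bar>E n \<omega>\<bar> > \<eta> * (1 + Q n \<omega>)}"
    have "(\<lambda>n. prob (?A n)) \<longlonglongrightarrow> 0"
    proof (rule prob_tendsto_0_if_AE_eventually_notin)
      show "AE \<omega> in M. \<forall>\<^sub>F n in sequentially. \<omega> \<notin> ?A n"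
        using small
      proof eventually_elim
        case (elim \<omega>)
        then have "\<forall>\<^sub>F n in sequentially. \<bar>E n \<omega>\<bar> \<le> \<eta> * (1 + Q n \<omega>)" using \<eta> by blast
        then show ?case by eventually_elim auto
      qed
    qed measurable
    then have "\<forall>\<^sub>F n in sequentially. prob (?A n) < r / 2"
      using \<open>0 < r\<close> by (intro order_tendstoD) auto
    then show "\<forall>\<^sub>F n in sequentially. prob {\<omega> \<in> space M. \<bar>E n \<omega>\<bar> > \<epsilon>} < r"
      using eventually_ge_at_top[of N]
    proof eventually_elim
      case (elim n)
      have "\<eta> * (1 + Q n \<omega>) \<le> \<epsilon>" if "Q n \<omega> \<le> K" for \<omega>
      proof -
        have "\<eta> * (1 + Q n \<omega>) \<le> \<eta> * (1 + max K 0)"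
          using \<eta> that by (intro mult_left_mono) auto
        also have "\<dots> = \<epsilon>" by (simp add: \<eta>_def)
        finally show ?thesis .
      qed
      then have "prob {\<omega> \<in> space M. \<bar>E n \<omega>\<bar> > \<epsilon>} \<le> prob (?A n \<union> {\<omega> \<in> space M. Q n \<omega> > K})"
        by (intro finite_measure_mono) (force simp: not_less)+
      also have "\<dots> \<le> prob (?A n) + prob {\<omega> \<in> space M. Q n \<omega> > K}"
        by (intro measure_Un_le) auto
      finally show ?case using elim K[of n] by linarith
    qed
  qed (auto intro!: always_eventually elim: less_le_trans)
  then show ?thesis by (simp add: tendsto_in_prob_def)
qed

end

section \<open>Quadratic sums of a stochastic measure\<close>

locale stochastic_measure_on = prob_space +
  fixes B :: "'x measure" and \<mu> :: "'x set \<Rightarrow> 'a \<Rightarrow> real"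
  assumes stochastic_measure: "stochastic_measure M B \<mu>"
begin

section \<open>Finite additivity from convergent series\<close>

lemma measurable_measure: "A \<in> sets B \<Longrightarrow> \<mu> A \<in> borel_measurable M"
  using stochastic_measure by (simp add: stochastic_measure_def)

lemma sums_measure:
  "range A \<subseteq> sets B \<Longrightarrow> disjoint_family A \<Longrightarrow>
    tendsto_in_prob M (\<lambda>n \<omega>. \<Sum>i<n. \<mu> (A i) \<omega>) (\<mu> (\<Union>i. A i))"
  using stochastic_measure by (simp add: stochastic_measure_def)

text \<open>The terms of a convergent series are differences of consecutive partial sums. This is
  the property that an infinite extraction of disjoint large sets violates.\<close>

lemma measure_disjoint_tendsto_0:
  assumes "range A \<subseteq> sets B" "disjoint_family A"
  shows "tendsto_in_prob M (\<lambda>n. \<mu> (A n)) (\<lambda>_. 0)"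
  using tendsto_in_prob_diff[OF tendsto_in_prob_subseq[OF sums_measure[OF assms], of Suc] sums_measure[OF assms]]
  by (simp add: strict_mono_def)

text \<open>The empty set is disjoint from itself, so a constant sequence of empty sets is
  admissible and its terms tend to 0. As \<open>\<mu> {}\<close> is only a representative, the
  identity holds almost surely.\<close>

lemma measure_empty: "AE \<omega> in M. \<mu> {} \<omega> = 0"
proof (rule tendsto_in_prob_unique)
  show "tendsto_in_prob M (\<lambda>n. \<mu> {}) (\<mu> {})"
    by (intro tendsto_in_prob_const measurable_measure) auto
  show "tendsto_in_prob M (\<lambda>n. \<mu> {}) (\<lambda>_. 0)"
    by (rule measure_disjoint_tendsto_0) (auto simp: disjoint_family_on_def)
qed

lemma measure_Un:
  assumes "A \<in> sets B" "C \<in> sets B" "A \<inter> C = {}"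
  shows "AE \<omega> in M. \<mu> (A \<union> C) \<omega> = \<mu> A \<omega> + \<mu> C \<omega>"
proof -
  define G where "G i = (if i = 0 then A else if i = 1 then C else {})" for i :: nat
  have G: "range G \<subseteq> sets B" "disjoint_family G" "(\<Union>i. G i) = A \<union> C"
    using assms by (auto simp: G_def disjoint_family_on_def split: if_splits)
  have [measurable]: "\<mu> A \<in> borel_measurable M" "\<mu> C \<in> borel_measurable M"
    using assms measurable_measure by auto
  have "tendsto_in_prob M (\<lambda>n \<omega>. \<mu> A \<omega> + \<mu> C \<omega>) (\<mu> (A \<union> C))"
  proof (rule tendsto_in_prob_cong)
    show "tendsto_in_prob M (\<lambda>n \<omega>. \<Sum>i<n. \<mu> (G i) \<omega>) (\<mu> (A \<union> C))"
      using sums_measure[OF G(1,2)] G(3) by simp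
    show "AE \<omega> in M. (\<Sum>i<n. \<mu> (G i) \<omega>) = \<mu> A \<omega> + \<mu> C \<omega>" if "n \<ge> 2" for n
      using measure_empty
    proof eventually_elim
      case (elim \<omega>)
      have "(\<Sum>i<n. \<mu> (G i) \<omega>) = (\<Sum>i<2. \<mu> (G i) \<omega>)"
        using that elim by (intro sum.mono_neutral_right) (auto simp: G_def)
      then show ?case by (simp add: numeral_2_eq_2 G_def)
    qed
  qed measurable
  from tendsto_in_prob_unique[OF this tendsto_in_prob_const] show ?thesis by auto
qed

lemma measure_finite_UN:
  assumes "finite I" "\<And>i. i \<in> I \<Longrightarrow> G i \<in> sets B" "disjoint_family_on G I"
  shows "AE \<omega> in M. \<mu> (\<Union>i\<in>I. G i) \<omega> = (\<Sum>i\<in>I. \<mu> (G i) \<omega>)"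
  using assms
proof (induction I rule: finite_induct)
  case empty
  then show ?case using measure_empty by simp
next
  case (insert a I)
  have "AE \<omega> in M. \<mu> (G a \<union> (\<Union>i\<in>I. G i)) \<omega> = \<mu> (G a) \<omega> + \<mu> (\<Union>i\<in>I. G i) \<omega>"
    using insert by (intro measure_Un) (auto simp: disjoint_family_on_def intro!: sets.finite_UN)
  moreover have "AE \<omega> in M. \<mu> (\<Union>i\<in>I. G i) \<omega> = (\<Sum>i\<in>I. \<mu> (G i) \<omega>)"
    using insert by (auto simp: disjoint_family_on_def)
  ultimately show ?case
    by eventually_elim (use insert in simp)
qed

end

lemma integral_subset_mean:
  assumes "\<And>S. S \<subseteq> I \<Longrightarrow> integrable M (g S)"
  shows "(\<integral>\<omega>. subset_mean p I (\<lambda>S. g S \<omega>) \<partial>M) = subset_mean p I (\<lambda>S. \<integral>\<omega>. g S \<omega> \<partial>M)"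
    and "integrable M (\<lambda>\<omega>. subset_mean p I (\<lambda>S. g S \<omega>))"
  unfolding subset_mean_def using assms by (auto intro!: Bochner_Integration.integral_sum)

text \<open>Abstracts from intervals what the extraction of disjoint sets uses.
  \<open>vanishing\<close> concerns the traces \<open>A \<inter> C\<close> on a fixed cell, not only
  the members of \<open>D n\<close>: after a random union has been removed, a family of cells
  remains on which later partitions must again be fine.\<close>

locale vanishing_partitions = stochastic_measure_on +
  fixes \<I> :: "'b set set" and D :: "nat \<Rightarrow> 'b set set" and W :: "'b set"
  assumes cells: "\<I> \<subseteq> sets B" and Int_cells: "A \<in> \<I> \<Longrightarrow> C \<in> \<I> \<Longrightarrow> A \<inter> C \<in> \<I>"
    and finite_D: "finite (D n)" and D_cells: "D n \<subseteq> \<I>" and disjoint_D: "disjoint (D n)"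
    and Union_D: "\<Union>(D n) = W" and W_cell: "W \<in> \<I>"
    and vanishing: "C \<in> \<I> \<Longrightarrow> (\<lambda>n. prob {\<omega> \<in> space M. \<exists>A\<in>D n. \<bar>\<mu> (A \<inter> C) \<omega>\<bar> > 1}) \<longlonglongrightarrow> 0"
begin

definition quad_sum :: "nat \<Rightarrow> 'b set \<Rightarrow> 'a \<Rightarrow> real" where
  "quad_sum l C \<omega> = (\<Sum>A\<in>D l. (\<mu> (A \<inter> C) \<omega>)\<^sup>2)"

definition cell_family :: "'b set set \<Rightarrow> bool" where
  "cell_family \<R> \<longleftrightarrow> finite \<R> \<and> \<R> \<subseteq> \<I> \<and> disjoint \<R> \<and> \<Union>\<R> \<subseteq> W"

text \<open>Boundedness in probability fails at level \<open>d\<close>, along arbitrarily late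
  partitions. The level is explicit because every removal lowers it a little, and the freedom in
  \<open>N\<close> allows finitely many candidates to be compared at one common late index.\<close>

definition unbounded_on :: "'b set set \<Rightarrow> real \<Rightarrow> bool" where
  "unbounded_on \<R> d \<longleftrightarrow> (\<forall>K N. \<exists>l\<ge>N. d \<le> prob {\<omega> \<in> space M. (\<Sum>C\<in>\<R>. quad_sum l C \<omega>) > K})"

definition refine :: "nat \<Rightarrow> 'b set set \<Rightarrow> 'b set set" where
  "refine n \<R> = (\<lambda>(A, C). A \<inter> C) ` (D n \<times> \<R>)"

section \<open>Cell families and their refinements\<close>

lemma cell_measurable [measurable (raw)]: "A \<in> \<I> \<Longrightarrow> \<mu> A \<in> borel_measurable M"
  using measurable_measure cells by blast

lemma D_measurable: "A \<in> D n \<Longrightarrow> C \<in> \<I> \<Longrightarrow> \<mu> (A \<inter> C) \<in> borel_measurable M"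
  using D_cells Int_cells by (intro cell_measurable) blast

lemma quad_sum_measurable: "C \<in> \<I> \<Longrightarrow> quad_sum l C \<in> borel_measurable M"
  unfolding quad_sum_def using D_measurable by (intro borel_measurable_sum borel_measurable_power)

lemma quad_sum_nonneg: "0 \<le> quad_sum l C \<omega>"
  by (simp add: quad_sum_def sum_nonneg)

lemma sum_quad_sum_measurable: "\<R> \<subseteq> \<I> \<Longrightarrow> (\<lambda>\<omega>. \<Sum>C\<in>\<R>. quad_sum l C \<omega>) \<in> borel_measurable M"
  using quad_sum_measurable by (intro borel_measurable_sum) auto

lemma cell_family_refine:
  assumes "cell_family \<R>"
  shows "cell_family (refine n \<R>)" and "\<Union>(refine n \<R>) = \<Union>\<R>"
proof -
  have R: "finite \<R>" "\<R> \<subseteq> \<I>" "disjoint \<R>" "\<Union>\<R> \<subseteq> W" using assms by (auto simp: cell_family_def)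
  show U: "\<Union>(refine n \<R>) = \<Union>\<R>"
    using R(4) Union_D[of n] by (fastforce simp: refine_def)
  have "disjoint (refine n \<R>)"
    unfolding disjoint_def refine_def
  proof clarsimp
    fix A C A' C'
    assume *: "A \<in> D n" "C \<in> \<R>" "A' \<in> D n" "C' \<in> \<R>" "A \<inter> C \<noteq> A' \<inter> C'"
    then have "A \<noteq> A' \<or> C \<noteq> C'" by auto
    then have "A \<inter> A' = {} \<or> C \<inter> C' = {}"
      using disjoint_D[of n] R(3) * unfolding disjoint_def by blast
    then show "A \<inter> C \<inter> (A' \<inter> C') = {}" by auto
  qed
  then show "cell_family (refine n \<R>)"
    unfolding cell_family_def U using R finite_D[of n] D_cells[of n] Int_cells
    by (auto simp: refine_def subset_iff)
qed

text \<open>Two distinct pairs can have the same intersection only if it is empty; hence the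
  hypothesis \<open>g {} = 0\<close>.\<close>

lemma sum_refine:
  assumes "cell_family \<R>" "g {} = 0"
  shows "(\<Sum>C\<in>refine n \<R>. g C) = (\<Sum>C\<in>\<R>. \<Sum>A\<in>D n. g (A \<inter> C))"
proof -
  have R: "finite \<R>" "disjoint \<R>" using assms by (auto simp: cell_family_def)
  have "(\<Sum>C\<in>refine n \<R>. g C) = (\<Sum>z\<in>D n \<times> \<R>. (g \<circ> (\<lambda>(A, C). A \<inter> C)) z)"
    unfolding refine_def
  proof (rule sum.reindex_nontrivial)
    fix x y assume *: "x \<in> D n \<times> \<R>" "y \<in> D n \<times> \<R>" "x \<noteq> y" "(case x of (A, C) \<Rightarrow> A \<inter> C) = (case y of (A, C) \<Rightarrow> A \<inter> C)"
    obtain A C A' C' where xy: "x = (A, C)" "y = (A', C')" by (cases x, cases y)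
    have "A \<noteq> A' \<or> C \<noteq> C'" using * xy by auto
    then have "A \<inter> A' = {} \<or> C \<inter> C' = {}"
      using disjoint_D[of n] R(2) * unfolding disjoint_def xy by blast
    then have "A \<inter> C = {}" using * xy by auto
    then show "g (case x of (A, C) \<Rightarrow> A \<inter> C) = 0" using assms(2) xy by simp
  qed (use R finite_D in auto)
  also have "\<dots> = (\<Sum>A\<in>D n. \<Sum>C\<in>\<R>. g (A \<inter> C))"
    by (simp add: sum.cartesian_product case_prod_unfold)
  also have "\<dots> = (\<Sum>C\<in>\<R>. \<Sum>A\<in>D n. g (A \<inter> C))" by (rule sum.swap)
  finally show ?thesis .
qed

lemma sum_squares_refine:
  assumes "cell_family \<R>"
  shows "AE \<omega> in M. (\<Sum>C\<in>refine n \<R>. (\<mu> C \<omega>)\<^sup>2) = (\<Sum>C\<in>\<R>. quad_sum n C \<omega>)"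
  using measure_empty
proof eventually_elim
  case (elim \<omega>)
  then show ?case
    using sum_refine[OF assms, of "\<lambda>C. (\<mu> C \<omega>)\<^sup>2" n] by (simp add: quad_sum_def)
qed

text \<open>Each trace is the sum of its pieces in \<open>D n\<close>, so the Cauchy-Schwarz
  inequality costs the factor \<open>card (D n)\<close>. For fixed \<open>n\<close> this is a
  constant as \<open>l\<close> grows, and unboundedness therefore passes to the refinement.\<close>

lemma quad_sum_refine:
  assumes "cell_family \<R>"
  shows "AE \<omega> in M. (\<Sum>C\<in>\<R>. quad_sum l C \<omega>) \<le> card (D n) * (\<Sum>C\<in>refine n \<R>. quad_sum l C \<omega>)"
proof -
  have R: "finite \<R>" "\<R> \<subseteq> \<I>" "disjoint \<R>" "\<Union>\<R> \<subseteq> W" using assms by (auto simp: cell_family_def)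
  have "AE \<omega> in M. \<mu> (A \<inter> C) \<omega> = (\<Sum>A'\<in>D n. \<mu> (A \<inter> (A' \<inter> C)) \<omega>)" if "A \<in> D l" "C \<in> \<R>" for A C
  proof -
    have "AE \<omega> in M. \<mu> (\<Union>A'\<in>D n. A \<inter> (A' \<inter> C)) \<omega> = (\<Sum>A'\<in>D n. \<mu> (A \<inter> (A' \<inter> C)) \<omega>)"
    proof (rule measure_finite_UN[OF finite_D])
      show "A \<inter> (A' \<inter> C) \<in> sets B" if "A' \<in> D n" for A'
        using cells D_cells Int_cells R \<open>A \<in> D l\<close> \<open>C \<in> \<R>\<close> that by blast
      show "disjoint_family_on (\<lambda>A'. A \<inter> (A' \<inter> C)) (D n)"
        using disjoint_D[of n] by (fastforce simp: disjoint_family_on_def disjoint_def)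
    qed
    moreover have "(\<Union>A'\<in>D n. A \<inter> (A' \<inter> C)) = A \<inter> C"
      using Union_D[of n] R(4) that by blast
    ultimately show ?thesis by simp
  qed
  then have "AE \<omega> in M. \<forall>C\<in>\<R>. \<forall>A\<in>D l. \<mu> (A \<inter> C) \<omega> = (\<Sum>A'\<in>D n. \<mu> (A \<inter> (A' \<inter> C)) \<omega>)"
    by (intro AE_finite_allI R finite_D)
  then show ?thesis using measure_empty
  proof eventually_elim
    case (elim \<omega>)
    have "quad_sum l C \<omega> \<le> card (D n) * (\<Sum>A'\<in>D n. quad_sum l (A' \<inter> C) \<omega>)" if "C \<in> \<R>" for C
    proof -
      have "quad_sum l C \<omega> = (\<Sum>A\<in>D l. (\<Sum>A'\<in>D n. \<mu> (A \<inter> (A' \<inter> C)) \<omega>)\<^sup>2)"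
        unfolding quad_sum_def using elim(1) that by (intro sum.cong) auto
      also have "\<dots> \<le> (\<Sum>A\<in>D l. (\<Sum>A'\<in>D n. (\<mu> (A \<inter> (A' \<inter> C)) \<omega>)\<^sup>2) * card (D n))"
        by (intro sum_mono sum_squared_le_sum_of_squares)
      also have "\<dots> = card (D n) * (\<Sum>A'\<in>D n. quad_sum l (A' \<inter> C) \<omega>)"
        unfolding quad_sum_def
        by (subst sum.swap) (simp add: sum_distrib_left sum_distrib_right mult.commute)
      finally show ?thesis .
    qed
    then have "(\<Sum>C\<in>\<R>. quad_sum l C \<omega>) \<le> (\<Sum>C\<in>\<R>. card (D n) * (\<Sum>A'\<in>D n. quad_sum l (A' \<inter> C) \<omega>))"
      by (intro sum_mono)
    also have "\<dots> = card (D n) * (\<Sum>C\<in>refine n \<R>. quad_sum l C \<omega>)"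
      using sum_refine[OF assms, of "\<lambda>C. quad_sum l C \<omega>" n] elim(2)
      by (simp add: sum_distrib_left quad_sum_def)
    finally show ?case .
  qed
qed

text \<open>Two averages over a random subset \<open>S\<close> of the refined cells are compared. A
  fixed proportion of the \<open>S\<close> has a union of large measure with fixed probability,
  whereas on average \<open>S\<close> rarely carries half of a quadratic sum. So some
  \<open>S\<close> with a large union can be removed while the rest stays unbounded at a slightly
  lower level.\<close>

lemma unbounded_step:
  assumes cell_family: "cell_family \<R>" and \<delta>: "0 < \<delta>" "\<delta> < d" and unb: "unbounded_on \<R> d"
  shows "\<exists>A \<R>' d'. cell_family \<R>' \<and> \<delta> < d' \<and> unbounded_on \<R>' d' \<and> A \<in> sets B \<and> A \<subseteq> \<Union>\<R> \<and>
    \<Union>\<R>' \<subseteq> \<Union>\<R> - A \<and> \<delta> / 512 \<le> prob {\<omega> \<in> space M. \<bar>\<mu> A \<omega>\<bar> > 1}"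
proof -
  have R: "finite \<R>" "\<R> \<subseteq> \<I>" using cell_family by (auto simp: cell_family_def)
  \<comment> \<open>Only half of the slack above \<open>\<delta>\<close> is spent, so the new level
    \<open>d - \<epsilon>\<close> is still above \<open>\<delta>\<close> and the step can be
    repeated.\<close>
  define \<epsilon> where "\<epsilon> = (d - \<delta>) / 2"
  \<comment> \<open>Sparse enough for \<open>2 * p < \<epsilon> * (\<delta> / 512)\<close>, the
    inequality that the final average contradicts.\<close>
  define p where "p = min (1 / 2) (\<epsilon> * \<delta> / 2048)"
  have \<epsilon>: "\<epsilon> > 0" "\<delta> < d - \<epsilon>" using \<delta> by (auto simp: \<epsilon>_def field_simps)
  then have "0 < \<epsilon> * \<delta>" using \<delta> by simp
  then have p: "0 < p" "p < 1" "2 * p < \<epsilon> * (\<delta> / 512)" by (auto simp: p_def min_def mult.commute)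
  \<comment> \<open>The size of the quadratic sum at which \<open>subset_mean_large_sum\<close>
    applies with density \<open>p\<close>.\<close>
  define K0 where "K0 = 2 / (p * (1 - p))"
  have K0: "K0 > 0" using p by (simp add: K0_def)
  let ?big = "\<lambda>n C. {\<omega> \<in> space M. \<exists>A\<in>D n. \<bar>\<mu> (A \<inter> C) \<omega>\<bar> > 1}"
  have big: "?big n C \<in> events" if "C \<in> \<I>" for n C
  proof (rule sets.sets_Collect_finite_Ex[OF _ finite_D])
    fix A assume "A \<in> D n"
    note D_measurable[OF this that, measurable]
    show "{\<omega> \<in> space M. \<bar>\<mu> (A \<inter> C) \<omega>\<bar> > 1} \<in> events" by measurable
  qed
  have "(\<lambda>n. \<Sum>C\<in>\<R>. prob (?big n C)) \<longlonglongrightarrow> (\<Sum>C\<in>\<R>. 0)"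
    using R vanishing by (intro tendsto_sum) auto
  then have "\<forall>\<^sub>F n in sequentially. (\<Sum>C\<in>\<R>. prob (?big n C)) < \<delta> / 2"
    using \<delta> by (intro order_tendstoD) auto
  then obtain N0 where N0: "\<And>n. n \<ge> N0 \<Longrightarrow> (\<Sum>C\<in>\<R>. prob (?big n C)) < \<delta> / 2"
    unfolding eventually_sequentially by blast
  obtain n where n: "n \<ge> N0" "d \<le> prob {\<omega> \<in> space M. (\<Sum>C\<in>\<R>. quad_sum n C \<omega>) > K0}"
    using unb unfolding unbounded_on_def by blast
  define I where "I = refine n \<R>"
  have gI: "cell_family I" and UI: "\<Union>I = \<Union>\<R>" using cell_family_refine[OF cell_family] by (auto simp: I_def)
  then have I: "finite I" "I \<subseteq> \<I>" "disjoint I" by (auto simp: cell_family_def)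
  have IB: "\<Union>S \<in> sets B" if "S \<subseteq> I" for S
    using that I cells by (intro sets.finite_Union) (auto intro: finite_subset)
  have meas [measurable]: "\<mu> (\<Union>S) \<in> borel_measurable M" if "S \<subseteq> I" for S
    using IB[OF that] by (rule measurable_measure)
  define f where "f S = prob {\<omega> \<in> space M. \<bar>\<mu> (\<Union>S) \<omega>\<bar> > 1}" for S
  \<comment> \<open>On \<open>G\<close> the squares over the refined cells add up to more than
    \<open>K0\<close> while each cell has a value of size at most 1, as
    \<open>subset_mean_large_sum\<close> requires. The excluded cells cost less than
    \<open>\<delta> / 2\<close> of a probability of at least \<open>d\<close>.\<close>
  define G where "G = {\<omega> \<in> space M. (\<Sum>C\<in>\<R>. quad_sum n C \<omega>) > K0} - (\<Union>C\<in>\<R>. ?big n C)"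
  have G1: "{\<omega> \<in> space M. (\<Sum>C\<in>\<R>. quad_sum n C \<omega>) > K0} \<in> events"
    using sum_quad_sum_measurable[OF R(2)] by measurable
  have G2: "(\<Union>C\<in>\<R>. ?big n C) \<in> events" using R big by (intro sets.finite_UN) auto
  have G: "G \<in> events" unfolding G_def using G1 G2 by auto
  have probG: "\<delta> / 2 \<le> prob G"
  proof -
    have "prob (\<Union>C\<in>\<R>. ?big n C) \<le> (\<Sum>C\<in>\<R>. prob (?big n C))"
      using R big by (intro measure_UNION_le) auto
    moreover have "prob {\<omega> \<in> space M. (\<Sum>C\<in>\<R>. quad_sum n C \<omega>) > K0} \<le> prob (G \<union> (\<Union>C\<in>\<R>. ?big n C))"
      using G1 G G2 by (intro finite_measure_mono) (auto simp: G_def)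
    moreover have "prob (G \<union> (\<Union>C\<in>\<R>. ?big n C)) \<le> prob G + prob (\<Union>C\<in>\<R>. ?big n C)"
      using G G2 by (rule measure_Un_le)
    ultimately show ?thesis using N0[OF n(1)] n(2) \<delta> by linarith
  qed
  have "AE \<omega> in M. \<mu> (\<Union>S) \<omega> = (\<Sum>C\<in>S. \<mu> C \<omega>)" if "S \<in> Pow I" for S
    using measure_finite_UN[of S "\<lambda>C. C"] finite_subset[OF _ I(1), of S] that I cells
    by (auto simp: disjoint_family_on_def disjoint_def subset_iff)
  then have sums: "AE \<omega> in M. \<forall>S\<in>Pow I. \<mu> (\<Union>S) \<omega> = (\<Sum>C\<in>S. \<mu> C \<omega>)"
    by (intro AE_finite_allI) (use I in auto)
  have f_int: "f S = (\<integral>\<omega>. of_bool (\<bar>\<mu> (\<Union>S) \<omega>\<bar> > 1) \<partial>M)"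
    and f_integrable: "integrable M (\<lambda>\<omega>. of_bool (\<bar>\<mu> (\<Union>S) \<omega>\<bar> > 1) :: real)" if S: "S \<subseteq> I" for S
  proof -
    note meas[OF S, measurable]
    have e: "(of_bool (\<bar>\<mu> (\<Union>S) \<omega>\<bar> > 1) :: real) = indicator {\<omega> \<in> space M. \<bar>\<mu> (\<Union>S) \<omega>\<bar> > 1} \<omega>"
      if "\<omega> \<in> space M" for \<omega> using that by (simp add: indicator_def)
    show "f S = (\<integral>\<omega>. of_bool (\<bar>\<mu> (\<Union>S) \<omega>\<bar> > 1) \<partial>M)"
      unfolding f_def by (subst Bochner_Integration.integral_cong[OF refl e]) auto
    show "integrable M (\<lambda>\<omega>. of_bool (\<bar>\<mu> (\<Union>S) \<omega>\<bar> > 1) :: real)"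
      by (subst Bochner_Integration.integrable_cong[OF refl e]) (auto simp: emeasure_eq_measure)
  qed
  \<comment> \<open>Interchange of the two expectations: for almost every outcome in
    \<open>G\<close>, a random \<open>S\<close> has a large sum with probability at least
    \<open>1 / 128\<close>, and \<open>G\<close> has probability at least
    \<open>\<delta> / 2\<close>.\<close>
  have mean_f: "\<delta> / 256 \<le> subset_mean p I f"
  proof -
    have "\<delta> / 256 \<le> (1 / 128) * prob G" using probG by simp
    also have "\<dots> = (\<integral>\<omega>. (1 / 128) * indicator G \<omega> \<partial>M)" using G by simp
    also have "\<dots> \<le> (\<integral>\<omega>. subset_mean p I (\<lambda>S. of_bool (\<bar>\<mu> (\<Union>S) \<omega>\<bar> > 1)) \<partial>M)"
    proof (rule integral_mono_AE)
      show "AE \<omega> in M. (1 / 128) * indicator G \<omega> \<le> subset_mean p I (\<lambda>S. of_bool (\<bar>\<mu> (\<Union>S) \<omega>\<bar> > 1))"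
        using sums sum_squares_refine[OF cell_family, of n]
      proof eventually_elim
        case (elim \<omega>)
        show ?case
        proof (cases "\<omega> \<in> G")
          case True
          have "1 / 128 \<le> subset_mean p I (\<lambda>S. of_bool (\<bar>\<Sum>C\<in>S. \<mu> C \<omega>\<bar> > 1))"
          proof (rule subset_mean_large_sum[OF I(1)])
            show "\<bar>\<mu> C \<omega>\<bar> \<le> 1" if "C \<in> I" for C
              using that True by (auto simp: I_def refine_def G_def not_less)
            have "K0 < (\<Sum>C\<in>I. (\<mu> C \<omega>)\<^sup>2)"
              using True elim(2) by (simp add: G_def I_def)
            then show "2 \<le> p * (1 - p) * (\<Sum>C\<in>I. (\<mu> C \<omega>)\<^sup>2)"
              using p by (simp add: K0_def field_simps)
          qed (use p in auto)
          also have "\<dots> = subset_mean p I (\<lambda>S. of_bool (\<bar>\<mu> (\<Union>S) \<omega>\<bar> > 1))"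
            using elim(1) by (simp add: subset_mean_def)
          finally show ?thesis using True by simp
        next
          case False
          have "subset_mean p I (\<lambda>S. 0) \<le> subset_mean p I (\<lambda>S. of_bool (\<bar>\<mu> (\<Union>S) \<omega>\<bar> > 1))"
            using p by (intro subset_mean_mono) auto
          then show ?thesis using False I by simp
        qed
      qed
      show "integrable M (\<lambda>\<omega>. subset_mean p I (\<lambda>S. of_bool (\<bar>\<mu> (\<Union>S) \<omega>\<bar> > 1)))"
        by (intro integral_subset_mean f_integrable)
    qed (use G in \<open>auto simp: emeasure_eq_measure\<close>)
    also have "\<dots> = subset_mean p I f"
      by (subst integral_subset_mean(1)[OF f_integrable]) (auto simp: subset_mean_def f_int)
    finally show ?thesis .
  qed
  \<comment> \<open>Half of the average is given away: since \<open>f\<close> is at most 1, sets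
    with \<open>f S \<ge> \<delta> / 512\<close> must make up at least the proportion
    \<open>\<delta> / 512\<close>.\<close>
  define Gd where "Gd S \<longleftrightarrow> \<delta> / 512 \<le> f S" for S
  have "subset_mean p I f \<le> subset_mean p I (\<lambda>S. of_bool (Gd S) + \<delta> / 512)"
    using p \<delta> by (intro subset_mean_mono) (auto simp: Gd_def f_def intro: add_increasing2)
  then have mean_Gd: "\<delta> / 512 \<le> subset_mean p I (\<lambda>S. of_bool (Gd S))"
    using mean_f I by (simp add: subset_mean_add)
  have "\<exists>S\<subseteq>I. Gd S \<and> unbounded_on (I - S) (d - \<epsilon>)"
  proof (rule ccontr)
    assume neg: "\<not> ?thesis"
    \<comment> \<open>The implications make \<open>R\<close> trivial for sets that do not matter, so
      that a choice function can be taken over all \<open>S\<close>.\<close>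
    define R where "R S z \<longleftrightarrow> (S \<subseteq> I \<longrightarrow> Gd S \<longrightarrow>
        (\<forall>l\<ge>snd z. prob {\<omega> \<in> space M. (\<Sum>C\<in>I - S. quad_sum l C \<omega>) > fst z} < d - \<epsilon>))"
      for S and z :: "real \<times> nat"
    have "\<forall>S. \<exists>z. R S z"
    proof
      fix S
      show "\<exists>z. R S z"
      proof (cases "S \<subseteq> I \<and> Gd S")
        case True
        then have "\<not> unbounded_on (I - S) (d - \<epsilon>)" using neg by blast
        then obtain K N where "\<And>l. l \<ge> N \<Longrightarrow> \<not> d - \<epsilon> \<le> prob {\<omega> \<in> space M. (\<Sum>C\<in>I - S. quad_sum l C \<omega>) > K}"
          unfolding unbounded_on_def by blast
        then show ?thesis by (intro exI[of _ "(K, N)"]) (simp add: R_def not_le)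
      qed (simp add: R_def)
    qed
    from choice[OF this] obtain z where z: "\<forall>S. R S (z S)" by (rule exE)
    define K N where "K S = fst (z S)" and "N S = snd (z S)" for S
    have KN: "prob {\<omega> \<in> space M. (\<Sum>C\<in>I - S. quad_sum l C \<omega>) > K S} < d - \<epsilon>"
      if "S \<subseteq> I" "Gd S" "l \<ge> N S" for S l
      using z[rule_format, of S] that by (simp add: R_def K_def N_def)
    \<comment> \<open>\<open>I\<close> has finitely many subsets, so common thresholds exist.
      Inserting 0 provides the sign that \<open>subset_mean_half_sum\<close> asks for.\<close>
    define Kmax where "Kmax = Max (insert 0 (K ` Pow I))"
    define Nmax where "Nmax = Max (N ` Pow I)"
    have max: "0 \<le> Kmax" "\<And>S. S \<subseteq> I \<Longrightarrow> K S \<le> Kmax" "\<And>S. S \<subseteq> I \<Longrightarrow> N S \<le> Nmax"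
      using I(1) by (auto simp: Kmax_def Nmax_def)
    let ?c = "real (card (D n))"
    \<comment> \<open>The factor \<open>?c\<close> pays in advance for the passage from
      \<open>\<R>\<close> to its refinement \<open>I\<close>.\<close>
    obtain l where l: "l \<ge> Nmax" "d \<le> prob {\<omega> \<in> space M. (\<Sum>C\<in>\<R>. quad_sum l C \<omega>) > ?c * (2 * Kmax)}"
      using unb unfolding unbounded_on_def by blast
    let ?Q = "\<lambda>J \<omega>. \<Sum>C\<in>J. quad_sum l C \<omega>"
    have Q [measurable]: "?Q J \<in> borel_measurable M" if "J \<subseteq> I" for J
      using that I by (intro sum_quad_sum_measurable) auto
    note Q[OF order.refl, measurable]
    have "prob {\<omega> \<in> space M. ?Q \<R> \<omega> > ?c * (2 * Kmax)} \<le> prob {\<omega> \<in> space M. ?Q I \<omega> > 2 * Kmax}"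
    proof (rule finite_measure_mono_AE)
      show "AE \<omega> in M. \<omega> \<in> {\<omega> \<in> space M. ?Q \<R> \<omega> > ?c * (2 * Kmax)} \<longrightarrow> \<omega> \<in> {\<omega> \<in> space M. ?Q I \<omega> > 2 * Kmax}"
        using quad_sum_refine[OF cell_family, of l n]
      proof eventually_elim
        case (elim \<omega>)
        show ?case
        proof
          assume *: "\<omega> \<in> {\<omega> \<in> space M. ?Q \<R> \<omega> > ?c * (2 * Kmax)}"
          then have "?c * (2 * Kmax) < ?c * ?Q I \<omega>"
            using elim by (simp add: I_def)
          then have "2 * Kmax < ?Q I \<omega>" by (rule mult_left_less_imp_less) simp
          then show "\<omega> \<in> {\<omega> \<in> space M. ?Q I \<omega> > 2 * Kmax}" using * by simp
        qed
      qed
    qed measurable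
    then have QI: "d \<le> prob {\<omega> \<in> space M. ?Q I \<omega> > 2 * Kmax}" using l by linarith
    define g where "g S = prob {\<omega> \<in> space M. ?Q (I - S) \<omega> \<le> Kmax \<and> 2 * Kmax < ?Q I \<omega>}" for S
    \<comment> \<open>The sum over \<open>I\<close> exceeds \<open>2 * Kmax\<close> with probability
      at least \<open>d\<close>, the sum over \<open>I - S\<close> exceeds \<open>Kmax\<close> with
      probability below \<open>d - \<epsilon>\<close>. So each such \<open>S\<close> halves the sum
      with probability at least \<open>\<epsilon>\<close>, too often for a sparse random
      set.\<close>
    have "\<epsilon> \<le> g S" if S: "S \<subseteq> I" "Gd S" for S
    proof -
      note Q[of "I - S", measurable]
      have "prob {\<omega> \<in> space M. ?Q (I - S) \<omega> > Kmax} \<le> prob {\<omega> \<in> space M. ?Q (I - S) \<omega> > K S}"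
        using max(2)[OF S(1)] by (intro finite_measure_mono) (auto, measurable)
      also have "\<dots> < d - \<epsilon>" using KN[OF S] max(3)[OF S(1)] l(1) by simp
      finally have "prob {\<omega> \<in> space M. ?Q (I - S) \<omega> > Kmax} < d - \<epsilon>" .
      moreover have "prob {\<omega> \<in> space M. ?Q I \<omega> > 2 * Kmax} \<le>
          prob ({\<omega> \<in> space M. ?Q (I - S) \<omega> \<le> Kmax \<and> 2 * Kmax < ?Q I \<omega>} \<union> {\<omega> \<in> space M. ?Q (I - S) \<omega> > Kmax})"
        by (intro finite_measure_mono) (auto, measurable)
      moreover have "\<dots> \<le> g S + prob {\<omega> \<in> space M. ?Q (I - S) \<omega> > Kmax}"
        unfolding g_def by (intro measure_Un_le) measurable
      ultimately show ?thesis using QI by linarith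
    qed
    then have "subset_mean p I (\<lambda>S. \<epsilon> * of_bool (Gd S)) \<le> subset_mean p I g"
      using p by (intro subset_mean_mono) (auto simp: g_def)
    then have "\<epsilon> * (\<delta> / 512) \<le> subset_mean p I g"
      using \<epsilon> mult_left_mono[OF mean_Gd, of \<epsilon>] unfolding subset_mean_cmult by linarith
    also have "\<dots> = subset_mean p I (\<lambda>S. \<integral>\<omega>. of_bool (?Q (I - S) \<omega> \<le> Kmax \<and> 2 * Kmax < ?Q I \<omega>) \<partial>M)"
      unfolding subset_mean_def g_def
    proof (intro sum.cong refl arg_cong2[where f="(*)"])
      fix S
      have e: "(of_bool (?Q (I - S) \<omega> \<le> Kmax \<and> 2 * Kmax < ?Q I \<omega>) :: real) =
          indicator {\<omega> \<in> space M. ?Q (I - S) \<omega> \<le> Kmax \<and> 2 * Kmax < ?Q I \<omega>} \<omega>" if "\<omega> \<in> space M" for \<omega>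
        using that by (simp add: indicator_def)
      show "prob {\<omega> \<in> space M. ?Q (I - S) \<omega> \<le> Kmax \<and> 2 * Kmax < ?Q I \<omega>} =
          (\<integral>\<omega>. of_bool (?Q (I - S) \<omega> \<le> Kmax \<and> 2 * Kmax < ?Q I \<omega>) \<partial>M)"
        by (subst Bochner_Integration.integral_cong[OF refl e]) auto
    qed
    also have "\<dots> = (\<integral>\<omega>. subset_mean p I (\<lambda>S. of_bool (?Q (I - S) \<omega> \<le> Kmax \<and> 2 * Kmax < ?Q I \<omega>)) \<partial>M)"
    proof (rule integral_subset_mean(1)[symmetric])
      fix S
      note Q[of "I - S", measurable]
      show "integrable M (\<lambda>\<omega>. of_bool (?Q (I - S) \<omega> \<le> Kmax \<and> 2 * Kmax < ?Q I \<omega>) :: real)"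
        by (rule integrable_const_bound[where B=1]) auto
    qed
    also have "\<dots> \<le> (\<integral>\<omega>. 2 * p \<partial>M)"
    proof (rule integral_mono)
      show "integrable M (\<lambda>\<omega>. subset_mean p I (\<lambda>S. of_bool (?Q (I - S) \<omega> \<le> Kmax \<and> 2 * Kmax < ?Q I \<omega>)))"
      proof (rule integral_subset_mean(2))
        fix S
        note Q[of "I - S", measurable]
        show "integrable M (\<lambda>\<omega>. of_bool (?Q (I - S) \<omega> \<le> Kmax \<and> 2 * Kmax < ?Q I \<omega>) :: real)"
          by (rule integrable_const_bound[where B=1]) auto
      qed
      show "subset_mean p I (\<lambda>S. of_bool (?Q (I - S) \<omega> \<le> Kmax \<and> 2 * Kmax < ?Q I \<omega>)) \<le> 2 * p" for \<omega>
        using p max(1) I(1) by (intro subset_mean_half_sum) (auto simp: quad_sum_nonneg)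
    qed simp
    finally show False using p by (simp add: prob_space)
  qed
  then obtain S where S: "S \<subseteq> I" "Gd S" "unbounded_on (I - S) (d - \<epsilon>)" by blast
  show ?thesis
  proof (intro exI conjI)
    show "cell_family (I - S)" using gI by (auto simp: cell_family_def disjoint_def)
    show "\<delta> < d - \<epsilon>" by (rule \<epsilon>)
    show "unbounded_on (I - S) (d - \<epsilon>)" by (rule S)
    show "\<Union>S \<in> sets B" by (rule IB[OF S(1)])
    show "\<Union>S \<subseteq> \<Union>\<R>" using S(1) UI by blast
    show "\<Union>(I - S) \<subseteq> \<Union>\<R> - \<Union>S"
    proof
      fix x assume "x \<in> \<Union>(I - S)"
      then obtain C where C: "C \<in> I" "C \<notin> S" "x \<in> C" by blast
      have "x \<notin> C'" if "C' \<in> S" for C'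
        using C S(1) that disjointD[OF I(3), of C C'] by blast
      then show "x \<in> \<Union>\<R> - \<Union>S" using C(1,3) UI by blast
    qed
    show "\<delta> / 512 \<le> prob {\<omega> \<in> space M. \<bar>\<mu> (\<Union>S) \<omega>\<bar> > 1}" using S(2) by (simp add: Gd_def f_def)
  qed
qed

theorem quadratic_sums_bounded:
  assumes "0 < \<delta>"
  shows "\<exists>K N. \<forall>n\<ge>N. prob {\<omega> \<in> space M. (\<Sum>A\<in>D n. (\<mu> A \<omega>)\<^sup>2) > K} \<le> \<delta>"
proof (rule ccontr)
  assume neg: "\<not> ?thesis"
  \<comment> \<open>The levels decrease along the iteration but stay above this fixed
    \<open>c\<close>, so all extracted sets share the lower bound \<open>c / 512\<close>.\<close>
  define c where "c = \<delta> / 2"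
  have c: "0 < c" "c < \<delta>" using assms by (auto simp: c_def)
  have quad_W: "quad_sum n W \<omega> = (\<Sum>A\<in>D n. (\<mu> A \<omega>)\<^sup>2)" for n \<omega>
    unfolding quad_sum_def using Union_D[of n] by (intro sum.cong) (auto simp: Int_absorb2 Union_upper)
  then have start: "unbounded_on {W} \<delta>"
    unfolding unbounded_on_def
  proof (intro allI)
    fix K :: real and N :: nat
    from neg have "\<not> (\<forall>n\<ge>N. prob {\<omega> \<in> space M. (\<Sum>A\<in>D n. (\<mu> A \<omega>)\<^sup>2) > K} \<le> \<delta>)" by blast
    then obtain n where "n \<ge> N" "\<delta> < prob {\<omega> \<in> space M. (\<Sum>A\<in>D n. (\<mu> A \<omega>)\<^sup>2) > K}"
      by (auto simp: not_le)
    then show "\<exists>l\<ge>N. \<delta> \<le> prob {\<omega> \<in> space M. (\<Sum>C\<in>{W}. quad_sum l C \<omega>) > K}"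
      by (intro exI[of _ n]) (simp add: quad_W)
  qed
  \<comment> \<open>The state of the iteration is a pair: the set extracted last and the family of
    cells that remains.\<close>
  define P where "P z \<longleftrightarrow> cell_family (snd z) \<and> (\<exists>d>c. unbounded_on (snd z) d)" for z :: "'b set \<times> 'b set set"
  define R where "R z z' \<longleftrightarrow> fst z' \<in> sets B \<and> fst z' \<subseteq> \<Union>(snd z) \<and>
    \<Union>(snd z') \<subseteq> \<Union>(snd z) - fst z' \<and> c / 512 \<le> prob {\<omega> \<in> space M. \<bar>\<mu> (fst z') \<omega>\<bar> > 1}"
    for z z' :: "'b set \<times> 'b set set"
  have "\<exists>f. \<forall>n. P (f n) \<and> R (f n) (f (Suc n))"
  proof (rule dependent_nat_choice)
    have "P ({}, {W})"
      unfolding P_def using start c W_cell by (auto simp: cell_family_def disjoint_def)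
    then show "\<exists>z. P z" by blast
    fix z assume "P z"
    then obtain d where d: "cell_family (snd z)" "c < d" "unbounded_on (snd z) d" by (auto simp: P_def)
    from unbounded_step[OF d(1) c(1) d(2,3)] obtain A \<R> d' where
      "cell_family \<R>" "c < d'" "unbounded_on \<R> d'" "A \<in> sets B" "A \<subseteq> \<Union>(snd z)" "\<Union>\<R> \<subseteq> \<Union>(snd z) - A"
      "c / 512 \<le> prob {\<omega> \<in> space M. \<bar>\<mu> A \<omega>\<bar> > 1}"
      by (elim exE conjE)
    then show "\<exists>z'. P z' \<and> R z z'"
      unfolding P_def R_def by (intro exI[of _ "(A, \<R>)"]) auto
  qed
  then obtain f where f: "\<And>n. P (f n)" "\<And>n. R (f n) (f (Suc n))" by blast
  define A where "A n = fst (f (Suc n))" for n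
  have A: "A n \<in> sets B" "A n \<subseteq> \<Union>(snd (f n))" "\<Union>(snd (f (Suc n))) \<subseteq> \<Union>(snd (f n)) - A n"
    "c / 512 \<le> prob {\<omega> \<in> space M. \<bar>\<mu> (A n) \<omega>\<bar> > 1}" for n
    using f(2)[of n] by (auto simp: R_def A_def)
  have dec: "\<Union>(snd (f n)) \<subseteq> \<Union>(snd (f m))" if "m \<le> n" for m n
    using that by (induction n rule: dec_induct) (use A(3) in blast)+
  have "A m \<inter> A n = {}" if "m < n" for m n
    using A(2)[of n] A(3)[of m] dec[of "Suc m" n] that by fastforce
  then have "disjoint_family A"
    unfolding disjoint_family_on_def by (metis Int_commute nat_neq_iff)
  then have "tendsto_in_prob M (\<lambda>n. \<mu> (A n)) (\<lambda>_. 0)"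
    using A(1) by (intro measure_disjoint_tendsto_0) auto
  then have "(\<lambda>n. prob {\<omega> \<in> space M. \<bar>\<mu> (A n) \<omega> - 0\<bar> > 1}) \<longlonglongrightarrow> 0"
    unfolding tendsto_in_prob_def by (meson zero_less_one)
  then have "c / 512 \<le> 0"
    using A(4) by (intro LIMSEQ_le_const) auto
  then show False using c by simp
qed

end

section \<open>Partial derivatives\<close>

lemma C_kl_1_1I:
  fixes f f1 f2 :: "real \<Rightarrow> real \<Rightarrow> real"
  assumes d1: "\<And>x y. ((\<lambda>u. f u y) has_real_derivative f1 x y) (at x)"
    and d2: "\<And>x y. (f x has_real_derivative f2 x y) (at y)"
    and c: "continuous_on UNIV (\<lambda>(x, y). f x y)" "continuous_on UNIV (\<lambda>(x, y). f1 x y)"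
      "continuous_on UNIV (\<lambda>(x, y). f2 x y)"
  shows "C_kl 1 1 f"
proof -
  have "deriv (\<lambda>u. f u y) = (\<lambda>x. f1 x y)" "deriv (f x) = f2 x" for x y
    using d1 d2 by (auto intro!: DERIV_imp_deriv ext)
  then show ?thesis
    using c unfolding C_kl_def by (auto simp: le_Suc_eq field_differentiable_def intro: d1 d2)
qed

lemma C_kl_2_1I:
  fixes f f1 f2 f11 :: "real \<Rightarrow> real \<Rightarrow> real"
  assumes d1: "\<And>x y. ((\<lambda>u. f u y) has_real_derivative f1 x y) (at x)"
    and d11: "\<And>x y. ((\<lambda>u. f1 u y) has_real_derivative f11 x y) (at x)"
    and d2: "\<And>x y. (f x has_real_derivative f2 x y) (at y)"
    and c: "continuous_on UNIV (\<lambda>(x, y). f x y)" "continuous_on UNIV (\<lambda>(x, y). f1 x y)"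
      "continuous_on UNIV (\<lambda>(x, y). f11 x y)" "continuous_on UNIV (\<lambda>(x, y). f2 x y)"
  shows "C_kl 2 1 f"
proof -
  have "deriv (\<lambda>u. f u y) = (\<lambda>x. f1 x y)" "deriv (\<lambda>u. f1 u y) = (\<lambda>x. f11 x y)" "deriv (f x) = f2 x" for x y
    using d1 d11 d2 by (auto intro!: DERIV_imp_deriv ext)
  then show ?thesis
    using c unfolding C_kl_def
    by (auto simp: le_Suc_eq less_Suc_eq field_differentiable_def numeral_2_eq_2 intro: d1 d11 d2)
qed

lemma C_kl_1_1E:
  assumes "C_kl k l f" "1 \<le> k" "1 \<le> l"
  obtains f1 f2 where
    "\<And>x y. ((\<lambda>u. f u y) has_real_derivative f1 x y) (at x)"
    "\<And>x y. (f x has_real_derivative f2 x y) (at y)"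
    "continuous_on UNIV (\<lambda>(x, y). f x y)" "continuous_on UNIV (\<lambda>(x, y). f1 x y)"
    "continuous_on UNIV (\<lambda>(x, y). f2 x y)"
proof
  have 1: "(deriv ^^ 0) (\<lambda>u. f u y) field_differentiable at x" "(deriv ^^ 0) (f x) field_differentiable at y" for x y
    using assms unfolding C_kl_def by (meson less_le_trans zero_less_one)+
  show "((\<lambda>u. f u y) has_real_derivative deriv (\<lambda>u. f u y) x) (at x)" for x y
    using 1(1)[of y x] by (simp add: DERIV_deriv_iff_field_differentiable)
  show "(f x has_real_derivative deriv (f x) y) (at y)" for x y
    using 1(2)[of x y] by (simp add: DERIV_deriv_iff_field_differentiable)
  have 2: "\<And>i. i \<le> k \<Longrightarrow> continuous_on UNIV (\<lambda>(x, y). (deriv ^^ i) (\<lambda>u. f u y) x)"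
    "\<And>i. i \<le> l \<Longrightarrow> continuous_on UNIV (\<lambda>(x, y). (deriv ^^ i) (f x) y)"
    using assms unfolding C_kl_def by blast+
  show "continuous_on UNIV (\<lambda>(x, y). f x y)" using 2(1)[of 0] by simp
  show "continuous_on UNIV (\<lambda>(x, y). deriv (\<lambda>u. f u y) x)" using 2(1)[of 1] assms by simp
  show "continuous_on UNIV (\<lambda>(x, y). deriv (f x) y)" using 2(2)[of 1] assms by simp
qed

lemma continuous_on_compose_curried:
  assumes "continuous_on UNIV (\<lambda>(x, y). f x y)" "continuous_on S g" "continuous_on S h"
  shows "continuous_on S (\<lambda>z. f (g z) (h z))"
  using continuous_on_compose2[OF assms(1) continuous_on_Pair[OF assms(2,3)]] by simp

lemma continuous_on_bounded_square:
  fixes f :: "real \<Rightarrow> real \<Rightarrow> real"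
  assumes "continuous_on UNIV (\<lambda>(x, y). f x y)"
  obtains C where "0 \<le> C" "\<And>x y. \<bar>x\<bar> \<le> R \<Longrightarrow> \<bar>y\<bar> \<le> R \<Longrightarrow> \<bar>f x y\<bar> \<le> C"
proof -
  have "compact ((\<lambda>(x, y). f x y) ` ({-R..R} \<times> {-R..R}))"
    by (intro compact_continuous_image compact_Times compact_Icc) (rule continuous_on_subset[OF assms], simp)
  then obtain C where C: "\<And>z. z \<in> (\<lambda>(x, y). f x y) ` ({-R..R} \<times> {-R..R}) \<Longrightarrow> norm z \<le> C"
    unfolding bounded_iff[symmetric] using compact_imp_bounded bounded_iff by metis
  have "\<bar>f x y\<bar> \<le> max C 0" if "\<bar>x\<bar> \<le> R" "\<bar>y\<bar> \<le> R" for x y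
    using C[of "f x y"] that by (force simp: abs_le_iff)
  then show ?thesis by (intro that[of "max C 0"]) auto
qed

lemma partials_imp_lipschitz:
  fixes f f1 f2 :: "real \<Rightarrow> real \<Rightarrow> real"
  assumes d1: "\<And>x y. ((\<lambda>u. f u y) has_real_derivative f1 x y) (at x)"
    and d2: "\<And>x y. (f x has_real_derivative f2 x y) (at y)"
    and c: "continuous_on UNIV (\<lambda>(x, y). f1 x y)" "continuous_on UNIV (\<lambda>(x, y). f2 x y)"
  obtains C where "0 \<le> C" "\<And>x y x' y'. \<bar>x\<bar> \<le> R \<Longrightarrow> \<bar>y\<bar> \<le> R \<Longrightarrow> \<bar>x'\<bar> \<le> R \<Longrightarrow> \<bar>y'\<bar> \<le> R \<Longrightarrow>
    \<bar>f x' y' - f x y\<bar> \<le> C * (\<bar>x' - x\<bar> + \<bar>y' - y\<bar>)"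
proof -
  obtain C1 where C1: "0 \<le> C1" "\<And>x y. \<bar>x\<bar> \<le> R \<Longrightarrow> \<bar>y\<bar> \<le> R \<Longrightarrow> \<bar>f1 x y\<bar> \<le> C1"
    using continuous_on_bounded_square[OF c(1)] by blast
  obtain C2 where C2: "0 \<le> C2" "\<And>x y. \<bar>x\<bar> \<le> R \<Longrightarrow> \<bar>y\<bar> \<le> R \<Longrightarrow> \<bar>f2 x y\<bar> \<le> C2"
    using continuous_on_bounded_square[OF c(2)] by blast
  have "\<bar>f x' y' - f x y\<bar> \<le> (C1 + C2) * (\<bar>x' - x\<bar> + \<bar>y' - y\<bar>)"
    if "\<bar>x\<bar> \<le> R" "\<bar>y\<bar> \<le> R" "\<bar>x'\<bar> \<le> R" "\<bar>y'\<bar> \<le> R" for x y x' y'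
  proof -
    have "\<bar>f x' y' - f x y'\<bar> \<le> C1 * \<bar>x' - x\<bar>"
      using field_differentiable_bound[of "{-R..R}" "\<lambda>u. f u y'" "\<lambda>u. f1 u y'" C1 x' x] d1 C1 that
      by (auto intro: has_field_derivative_at_within simp: abs_le_iff)
    moreover have "\<bar>f x y' - f x y\<bar> \<le> C2 * \<bar>y' - y\<bar>"
      using field_differentiable_bound[of "{-R..R}" "f x" "f2 x" C2 y' y] d2 C2 that
      by (auto intro: has_field_derivative_at_within simp: abs_le_iff)
    moreover have "0 \<le> C1 * \<bar>y' - y\<bar>" "0 \<le> C2 * \<bar>x' - x\<bar>" using C1 C2 by auto
    ultimately show ?thesis unfolding distrib_left distrib_right by linarith
  qed
  then show ?thesis using C1 C2 by (intro that[of "C1 + C2"]) auto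
qed

section \<open>Antiderivatives depending on a parameter\<close>

text \<open>Rescaled to a fixed interval so that positive and negative \<open>r\<close> need not be distinguished.\<close>

definition antideriv0 :: "(real \<Rightarrow> real) \<Rightarrow> real \<Rightarrow> real" where
  "antideriv0 g r = r * integral {0..1} (\<lambda>u. g (r * u))"

lemma antideriv0_0 [simp]: "antideriv0 g 0 = 0"
  by (simp add: antideriv0_def)

lemma antideriv0_has_derivative:
  assumes "continuous_on UNIV g"
  shows "(antideriv0 g has_real_derivative g r) (at r)"
proof -
  have "isCont g x" for x using assms continuous_on_eq_continuous_at by blast
  then obtain G where G: "\<And>x. (G has_vector_derivative g x) (at x)"
    using einterval_antiderivative[of "-\<infinity>" "\<infinity>" g] by auto
  then have G': "(G has_real_derivative g x) (at x)" for x
    by (simp add: has_real_derivative_iff_has_vector_derivative)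
  have "antideriv0 g r = G r - G 0" for r
  proof -
    have "((\<lambda>u. r * g (r * u)) has_integral (G (r * 1) - G (r * 0))) {0..1}"
    proof (rule fundamental_theorem_of_calculus)
      fix u :: real
      have "((\<lambda>u. G (r * u)) has_real_derivative g (r * u) * r) (at u)"
        by (rule DERIV_chain2[OF G']) (auto intro!: derivative_eq_intros)
      then show "((\<lambda>u. G (r * u)) has_vector_derivative r * g (r * u)) (at u within {0..1})"
        by (simp add: has_real_derivative_iff_has_vector_derivative[symmetric] mult.commute has_field_derivative_at_within)
    qed simp
    then have "integral {0..1} (\<lambda>u. r * g (r * u)) = G r - G 0" by (auto dest: integral_unique)
    then show ?thesis by (simp add: antideriv0_def)
  qed
  then have "antideriv0 g = (\<lambda>r. G r - G 0)" by auto
  then show ?thesis using DERIV_diff[OF G'[of r] DERIV_const, of "G 0"] by simp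
qed

lemma continuous_on_antideriv0:
  fixes g :: "real \<Rightarrow> real \<Rightarrow> real"
  assumes "continuous_on UNIV (\<lambda>(u, x). g u x)"
  shows "continuous_on UNIV (\<lambda>(r, x). antideriv0 (\<lambda>u. g u x) r)"
proof -
  have "continuous_on UNIV (\<lambda>z. integral (cbox 0 1) (\<lambda>u. g (fst z * u) (snd z)))"
    by (intro integral_continuous_on_param)
      (auto intro!: continuous_intros continuous_on_compose_curried[OF assms] simp: case_prod_unfold)
  then show ?thesis
    by (auto intro!: continuous_intros simp: antideriv0_def case_prod_unfold)
qed

lemma antideriv0_has_derivative_param:
  fixes g g' :: "real \<Rightarrow> real \<Rightarrow> real"
  assumes d: "\<And>u x. (g u has_real_derivative g' u x) (at x)"
    and c: "continuous_on UNIV (\<lambda>(u, x). g u x)" and c': "continuous_on UNIV (\<lambda>(u, x). g' u x)"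
  shows "((\<lambda>x. antideriv0 (\<lambda>u. g u x) r) has_real_derivative antideriv0 (\<lambda>u. g' u x) r) (at x)"
proof -
  have "((\<lambda>x. integral (cbox 0 1) (\<lambda>u. g (r * u) x)) has_field_derivative
      integral (cbox 0 1) (\<lambda>u. g' (r * u) x)) (at x within UNIV)"
  proof (rule leibniz_rule_field_derivative)
    show "(\<lambda>u. g (r * u) x) integrable_on cbox 0 1" for x
      by (intro integrable_continuous continuous_on_compose_curried[OF c] continuous_intros)
    show "continuous_on (UNIV \<times> cbox 0 1) (\<lambda>(x, u). g' (r * u) x)"
      unfolding case_prod_unfold by (intro continuous_on_compose_curried[OF c'] continuous_intros)
  qed (use d in auto)
  then show ?thesis unfolding antideriv0_def by (auto intro!: DERIV_cmult)
qed

lemma antideriv0_bound: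
  assumes "continuous_on UNIV g" "\<And>u. \<bar>g u\<bar> \<le> L"
  shows "\<bar>antideriv0 g r\<bar> \<le> L * \<bar>r\<bar>"
proof -
  have "\<bar>antideriv0 g r - antideriv0 g 0\<bar> \<le> L * \<bar>r - 0\<bar>"
    using field_differentiable_bound[of UNIV "antideriv0 g" g L r 0] antideriv0_has_derivative[OF assms(1)] assms(2)
    by simp
  then show ?thesis by simp
qed

section \<open>The flow\<close>

locale flow =
  fixes \<sigma> :: "real \<Rightarrow> real" and F :: "real \<Rightarrow> real \<Rightarrow> real" and L :: real
  assumes C2: "C_k 2 \<sigma>" and deriv_bound: "\<bar>deriv \<sigma> x\<bar> \<le> L"
    and flow_deriv: "((\<lambda>u. F u x) has_real_derivative \<sigma> (F r x)) (at r)"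
    and flow_0: "F 0 x = x"
begin

abbreviation "\<sigma>' \<equiv> deriv \<sigma>"
abbreviation "\<sigma>'' \<equiv> deriv (deriv \<sigma>)"

section \<open>The coefficient and its divided differences\<close>

lemma sigma_deriv: "(\<sigma> has_real_derivative \<sigma>' x) (at x)" "(\<sigma>' has_real_derivative \<sigma>'' x) (at x)"
proof -
  have "(deriv ^^ 0) \<sigma> field_differentiable at x" "(deriv ^^ 1) \<sigma> field_differentiable at x"
    using C2 unfolding C_k_def by (meson one_less_numeral_iff semiring_norm(76) zero_less_numeral)+
  then show "(\<sigma> has_real_derivative \<sigma>' x) (at x)" "(\<sigma>' has_real_derivative \<sigma>'' x) (at x)"
    by (simp_all add: DERIV_deriv_iff_field_differentiable)
qed

lemma sigma_cont: "continuous_on UNIV \<sigma>" "continuous_on UNIV \<sigma>'" "continuous_on UNIV \<sigma>''"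
proof -
  have "continuous_on UNIV ((deriv ^^ 2) \<sigma>)" using C2 unfolding C_k_def by blast
  then show "continuous_on UNIV \<sigma>''" by (simp add: numeral_2_eq_2)
qed (use sigma_deriv DERIV_isCont in \<open>blast intro: continuous_at_imp_continuous_on\<close>)+

lemma sigma_cont_comp [continuous_intros]:
  assumes "continuous_on S f"
  shows "continuous_on S (\<lambda>x. \<sigma> (f x))" "continuous_on S (\<lambda>x. \<sigma>' (f x))" "continuous_on S (\<lambda>x. \<sigma>'' (f x))"
  using sigma_cont assms by (auto intro: continuous_on_compose2)

lemma bound_nonneg: "0 \<le> L"
  using deriv_bound[of 0] by linarith

text \<open>The divided difference of \<open>\<sigma>\<close>. The integral form extends it to the
  diagonal by the derivative and keeps it jointly continuous there.\<close>

definition div_diff :: "real \<Rightarrow> real \<Rightarrow> real" where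
  "div_diff a b = integral (cbox 0 1) (\<lambda>s. \<sigma>' (b + s * (a - b)))"

lemma div_diff_same [simp]: "div_diff a a = \<sigma>' a"
  by (simp add: div_diff_def)

lemma div_diff_eq: "\<sigma> a - \<sigma> b = (a - b) * div_diff a b"
proof -
  have "((\<lambda>s. (a - b) * \<sigma>' (b + s * (a - b))) has_integral (\<sigma> (b + 1 * (a - b)) - \<sigma> (b + 0 * (a - b)))) {0..1}"
  proof (rule fundamental_theorem_of_calculus)
    fix s :: real
    have "((\<lambda>s. \<sigma> (b + s * (a - b))) has_real_derivative \<sigma>' (b + s * (a - b)) * (a - b)) (at s)"
      by (rule DERIV_chain2[OF sigma_deriv(1)]) (auto intro!: derivative_eq_intros)
    then show "((\<lambda>s. \<sigma> (b + s * (a - b))) has_vector_derivative (a - b) * \<sigma>' (b + s * (a - b))) (at s within {0..1})"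
      by (simp add: has_real_derivative_iff_has_vector_derivative[symmetric] mult.commute has_field_derivative_at_within)
  qed simp
  then have "integral {0..1} (\<lambda>s. (a - b) * \<sigma>' (b + s * (a - b))) = \<sigma> a - \<sigma> b" by (auto dest: integral_unique)
  then show ?thesis by (simp add: div_diff_def)
qed

lemma div_diff_cont [continuous_intros]:
  assumes "continuous_on S f" "continuous_on S g"
  shows "continuous_on S (\<lambda>x. div_diff (f x) (g x))"
proof -
  have "continuous_on UNIV (\<lambda>z. integral (cbox 0 1) (\<lambda>s. \<sigma>' (snd z + s * (fst z - snd z))))"
    by (intro integral_continuous_on_param) (auto intro!: continuous_intros simp: case_prod_unfold)
  then have "continuous_on UNIV (\<lambda>z. div_diff (fst z) (snd z))" by (simp add: div_diff_def)
  from continuous_on_compose2[OF this, of S "\<lambda>x. (f x, g x)"] show ?thesis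
    using assms by (auto intro!: continuous_intros)
qed

lemma div_diff_bound: "\<bar>div_diff a b\<bar> \<le> L"
proof -
  have "norm (integral (cbox 0 1) (\<lambda>s. \<sigma>' (b + s * (a - b)))) \<le> L * measure lborel (cbox 0 (1::real))"
    using bound_nonneg deriv_bound
    by (intro integrable_bound integrable_continuous) (auto intro!: continuous_intros)
  then show ?thesis by (simp add: div_diff_def)
qed

text \<open>The difference of two solutions satisfies a linear equation, which gives uniqueness, the
  Lipschitz dependence on the initial value and the derivative in it all at once.\<close>

lemma solutions_diff:
  assumes z: "\<And>r. (z has_real_derivative \<sigma> (z r)) (at r)" and w: "\<And>r. (w has_real_derivative \<sigma> (w r)) (at r)"
  shows "z r - w r = (z 0 - w 0) * exp (antideriv0 (\<lambda>u. div_diff (z u) (w u)) r)"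
proof -
  let ?A = "antideriv0 (\<lambda>u. div_diff (z u) (w u))"
  have "continuous_on UNIV z" "continuous_on UNIV w"
    using z w by (blast intro: continuous_at_imp_continuous_on DERIV_isCont)+
  then have "continuous_on UNIV (\<lambda>u. div_diff (z u) (w u))" by (intro continuous_intros)
  note A = antideriv0_has_derivative[OF this]
  have "((\<lambda>r. (z r - w r) * exp (- ?A r)) has_real_derivative 0) (at r)" for r
    by (rule derivative_eq_intros z w A refl)+
      (simp add: div_diff_eq[of "z r" "w r"] mult.assoc flip: left_diff_distrib)
  then have "(z r - w r) * exp (- ?A r) = (z 0 - w 0) * exp (- ?A 0)"
    by (intro DERIV_isconst_all) auto
  then show ?thesis by (simp add: exp_minus field_simps)
qed

text \<open>Both sides solve the equation in \<open>r\<close> and agree at \<open>r = 0\<close>; by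
  \<open>solutions_diff\<close> their difference is 0.\<close>

lemma flow_add: "F r (F s x) = F (r + s) x"
proof -
  have "((\<lambda>r. F (r + s) x) has_real_derivative \<sigma> (F (r + s) x)) (at r)" for r
    by (rule DERIV_shift[THEN iffD1, OF flow_deriv])
  from solutions_diff[OF flow_deriv[of "F s x"] this, of r] show ?thesis by (simp add: flow_0)
qed

lemma flow_inverse: "F (- r) (F r x) = x" "F r (F (- r) x) = x"
  by (simp_all add: flow_add flow_0)

lemma inv_flow: "inv (F r) = F (- r)"
  by (rule inv_equality) (simp_all add: flow_inverse)

section \<open>Continuity of the flow\<close>

lemma flow_diff:
  "F r y - F r x = (y - x) * exp (antideriv0 (\<lambda>u. div_diff (F u y) (F u x)) r)"
  using solutions_diff[OF flow_deriv[of y] flow_deriv[of x], of r] by (simp add: flow_0)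

lemma flow_cont1: "continuous_on UNIV (\<lambda>u. F u x)"
  using flow_deriv by (blast intro: continuous_at_imp_continuous_on DERIV_isCont)

lemma flow_lipschitz: "\<bar>F r y - F r x\<bar> \<le> exp (L * \<bar>r\<bar>) * \<bar>y - x\<bar>"
proof -
  have "\<bar>antideriv0 (\<lambda>u. div_diff (F u y) (F u x)) r\<bar> \<le> L * \<bar>r\<bar>"
    by (intro antideriv0_bound div_diff_bound continuous_intros flow_cont1)
  then have "exp (antideriv0 (\<lambda>u. div_diff (F u y) (F u x)) r) \<le> exp (L * \<bar>r\<bar>)" by simp
  then show ?thesis
    unfolding flow_diff abs_mult by (simp add: mult.commute[of "\<bar>y - x\<bar>"] mult_right_mono)
qed

text \<open>Continuity in time for a fixed starting point, combined with the Lipschitz dependence on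
  the starting point, which is locally uniform in time.\<close>

lemma flow_cont: "continuous_on UNIV (\<lambda>(r, x). F r x)"
proof -
  have "((\<lambda>z. F (fst z) (snd z)) \<longlongrightarrow> F r x) (at (r, x))" for r x
  proof -
    have "((\<lambda>z. F (fst z) (snd z) - F (fst z) x) \<longlongrightarrow> 0) (at (r, x))"
    proof (rule Lim_null_comparison)
      show "\<forall>\<^sub>F z in at (r, x). norm (F (fst z) (snd z) - F (fst z) x) \<le> exp (L * \<bar>fst z\<bar>) * \<bar>snd z - x\<bar>"
        using flow_lipschitz by (auto intro: always_eventually)
      have "((\<lambda>z. exp (L * \<bar>fst z\<bar>) * \<bar>snd z - x\<bar>) \<longlongrightarrow> exp (L * \<bar>fst (r, x)\<bar>) * \<bar>snd (r, x) - x\<bar>) (at (r, x))"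
        by (intro tendsto_intros)
      then show "((\<lambda>z. exp (L * \<bar>fst z\<bar>) * \<bar>snd z - x\<bar>) \<longlongrightarrow> 0) (at (r, x))" by simp
    qed
    moreover have "((\<lambda>z. F (fst z) x) \<longlongrightarrow> F r x) (at (r, x))"
      using flow_cont1[of x] tendsto_fst[OF tendsto_ident_at, of "(r, x)" UNIV]
      by (intro isCont_tendsto_compose[of r "\<lambda>u. F u x"]) (auto simp: continuous_on_eq_continuous_at)
    ultimately show ?thesis
      using tendsto_add[of "\<lambda>z. F (fst z) (snd z) - F (fst z) x" 0 "at (r, x)" "\<lambda>z. F (fst z) x" "F r x"] by simp
  qed
  then show ?thesis
    by (auto simp: continuous_on_def case_prod_unfold)
qed

lemma flow_cont_comp [continuous_intros]:
  assumes "continuous_on S f" "continuous_on S g"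
  shows "continuous_on S (\<lambda>x. F (f x) (g x))"
  by (rule continuous_on_compose_curried[OF flow_cont assms])

text \<open>The solution of the linearized equation along the flow line through \<open>x\<close>, in
  closed form; that it is the partial derivative of \<open>F\<close> in \<open>x\<close> is
  \<open>F_x_deriv\<close>.\<close>

definition F_x :: "real \<Rightarrow> real \<Rightarrow> real" where
  "F_x r x = exp (antideriv0 (\<lambda>u. \<sigma>' (F u x)) r)"

definition F_xx :: "real \<Rightarrow> real \<Rightarrow> real" where
  "F_xx r x = F_x r x * antideriv0 (\<lambda>u. \<sigma>'' (F u x) * F_x u x) r"

lemma F_x_cont: "continuous_on UNIV (\<lambda>(r, x). F_x r x)"
proof -
  have "continuous_on UNIV (\<lambda>(r, x). antideriv0 (\<lambda>u. \<sigma>' (F u x)) r)"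
    by (rule continuous_on_antideriv0) (auto intro!: continuous_intros simp: case_prod_unfold)
  then show ?thesis by (auto intro!: continuous_intros simp: F_x_def case_prod_unfold)
qed

lemma F_x_cont_comp [continuous_intros]:
  assumes "continuous_on S f" "continuous_on S g"
  shows "continuous_on S (\<lambda>x. F_x (f x) (g x))"
  by (rule continuous_on_compose_curried[OF F_x_cont assms])

lemma F_xx_cont: "continuous_on UNIV (\<lambda>(r, x). F_xx r x)"
proof -
  have "continuous_on UNIV (\<lambda>(r, x). antideriv0 (\<lambda>u. \<sigma>'' (F u x) * F_x u x) r)"
    by (rule continuous_on_antideriv0) (auto intro!: continuous_intros simp: case_prod_unfold)
  then show ?thesis by (auto intro!: continuous_intros simp: F_xx_def case_prod_unfold)
qed

text \<open>By \<open>flow_diff\<close> the difference quotient is the exponential of an integral of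
  divided differences. It is continuous in \<open>y\<close> and equals \<open>F_x r x\<close> at
  \<open>y = x\<close>, which is differentiability in the form of Caratheodory.\<close>

lemma F_x_deriv: "(F r has_real_derivative F_x r x) (at x)"
proof -
  have "continuous_on UNIV (\<lambda>(r, y). antideriv0 (\<lambda>u. div_diff (F u y) (F u x)) r)"
    by (rule continuous_on_antideriv0) (auto intro!: continuous_intros simp: case_prod_unfold)
  from continuous_on_compose_curried[OF this continuous_on_const[of _ r] continuous_on_id[of UNIV]]
  have "isCont (\<lambda>y. antideriv0 (\<lambda>u. div_diff (F u y) (F u x)) r) x"
    by (simp add: continuous_on_eq_continuous_at)
  then show ?thesis
    unfolding CARAT_DERIV
    by (intro exI[of _ "\<lambda>y. exp (antideriv0 (\<lambda>u. div_diff (F u y) (F u x)) r)"])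
      (simp add: flow_diff F_x_def mult.commute)
qed

lemma F_x_deriv_r: "((\<lambda>u. F_x u x) has_real_derivative \<sigma>' (F r x) * F_x r x) (at r)"
proof -
  have "continuous_on UNIV (\<lambda>u. \<sigma>' (F u x))" by (intro continuous_intros)
  note antideriv0_has_derivative[OF this, of r]
  from DERIV_chain2[OF DERIV_exp this] show ?thesis by (simp add: F_x_def mult.commute)
qed

lemma F_xx_deriv: "(F_x r has_real_derivative F_xx r x) (at x)"
proof -
  have "((\<lambda>x. antideriv0 (\<lambda>u. \<sigma>' (F u x)) r) has_real_derivative
      antideriv0 (\<lambda>u. \<sigma>'' (F u x) * F_x u x) r) (at x)"
    by (rule antideriv0_has_derivative_param)
      (auto intro!: continuous_intros DERIV_chain2[OF sigma_deriv(2) F_x_deriv] simp: case_prod_unfold)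
  from DERIV_chain2[OF DERIV_exp this] show ?thesis
    by (simp add: F_xx_def F_x_def[abs_def])
qed

lemma F_rr_deriv: "((\<lambda>u. \<sigma> (F u x)) has_real_derivative \<sigma>' (F r x) * \<sigma> (F r x)) (at r)"
  by (rule DERIV_chain2[OF sigma_deriv(1) flow_deriv])

lemma F_rx_deriv: "((\<lambda>x. \<sigma> (F r x)) has_real_derivative \<sigma>' (F r x) * F_x r x) (at x)"
  by (rule DERIV_chain2[OF sigma_deriv(1) F_x_deriv])

lemma F_x_pos: "0 < F_x r x"
  by (simp add: F_x_def)

lemma F_x_bound: "F_x r x \<le> exp (L * \<bar>r\<bar>)"
proof -
  have "\<bar>antideriv0 (\<lambda>u. \<sigma>' (F u x)) r\<bar> \<le> L * \<bar>r\<bar>"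
    by (intro antideriv0_bound deriv_bound continuous_intros)
  then show ?thesis by (simp add: F_x_def)
qed

text \<open>The chain rule for \<open>F (- r)\<close> after \<open>F r\<close>. It cancels the
  factor by which the random equation rescales the drift, so that \<open>F (m, Y)\<close> has drift
  \<open>b\<close>.\<close>

lemma F_x_inverse: "F_x (- r) (F r x) * F_x r x = 1"
proof -
  have "((\<lambda>x. F (- r) (F r x)) has_real_derivative F_x (- r) (F r x) * F_x r x) (at x)"
    by (rule DERIV_chain2[OF F_x_deriv F_x_deriv])
  moreover have "((\<lambda>x. F (- r) (F r x)) has_real_derivative 1) (at x)"
    by (simp add: flow_inverse)
  ultimately show ?thesis by (rule DERIV_unique)
qed

text \<open>A vector field is carried along by its own flow: differentiate the group property at
  \<open>u = 0\<close>. Read with \<open>- r\<close> in place of \<open>r\<close>, it is the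
  equation between the two partial derivatives of the inverse flow.\<close>

lemma sigma_flow: "\<sigma> (F r x) = \<sigma> x * F_x r x"
proof -
  have "((\<lambda>u. F (u + r) x) has_real_derivative \<sigma> (F (0 + r) x)) (at 0)"
    by (rule DERIV_shift[THEN iffD1, OF flow_deriv])
  moreover have "((\<lambda>u. F r (F u x)) has_real_derivative F_x r (F 0 x) * \<sigma> (F 0 x)) (at 0)"
    by (rule DERIV_chain2[OF F_x_deriv flow_deriv])
  moreover have "(\<lambda>u. F r (F u x)) = (\<lambda>u. F (u + r) x)" by (simp add: flow_add add.commute)
  ultimately have "\<sigma> (F (0 + r) x) = F_x r (F 0 x) * \<sigma> (F 0 x)" using DERIV_unique by metis
  then show ?thesis by (simp add: flow_0)
qed

lemma C_kl_flow: "C_kl 2 1 F"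
  by (rule C_kl_2_1I[OF flow_deriv F_rr_deriv F_x_deriv])
    (auto intro!: continuous_intros simp: case_prod_unfold)

lemma C_kl_deriv_inverse: "C_kl 1 1 (\<lambda>r. F_x (- r))"
proof (rule C_kl_1_1I)
  show "((\<lambda>u. F_x (- u) y) has_real_derivative - (\<sigma>' (F (- r) y) * F_x (- r) y)) (at r)" for r y
    by (rule DERIV_mirror[THEN iffD1, OF F_x_deriv_r])
  show "(F_x (- r) has_real_derivative F_xx (- r) y) (at y)" for r y by (rule F_xx_deriv)
  show "continuous_on UNIV (\<lambda>(r, y). F_xx (- r) y)"
    unfolding case_prod_unfold by (intro continuous_on_compose_curried[OF F_xx_cont] continuous_intros)
qed (auto intro!: continuous_intros simp: case_prod_unfold)

end

section \<open>Increments along partitions of vanishing mesh\<close>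

text \<open>The relation e = o(w) as \<open>t - s\<close> tends to 0, uniformly on [0,T]. Measuring
  the error against an interval weight lets the bound be summed over any fine partition.\<close>

definition mesh_small :: "real \<Rightarrow> (real \<Rightarrow> real \<Rightarrow> real) \<Rightarrow> (real \<Rightarrow> real \<Rightarrow> real) \<Rightarrow> bool" where
  "mesh_small T w e \<longleftrightarrow>
    (\<forall>\<eta>>0. \<exists>\<delta>>0. \<forall>s t. 0 \<le> s \<longrightarrow> s < t \<longrightarrow> t \<le> T \<longrightarrow> t - s < \<delta> \<longrightarrow> \<bar>e s t\<bar> \<le> \<eta> * w s t)"

lemma mesh_smallI:
  assumes "\<And>\<eta>. \<eta> > 0 \<Longrightarrow> \<exists>\<delta>>0. \<forall>s t. 0 \<le> s \<longrightarrow> s < t \<longrightarrow> t \<le> T \<longrightarrow> t - s < \<delta> \<longrightarrow> \<bar>e s t\<bar> \<le> \<eta> * w s t"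
  shows "mesh_small T w e"
  using assms by (auto simp: mesh_small_def)

lemma mesh_smallE:
  assumes "mesh_small T w e" "\<eta> > 0"
  obtains \<delta> where "\<delta> > 0" "\<And>s t. 0 \<le> s \<Longrightarrow> s < t \<Longrightarrow> t \<le> T \<Longrightarrow> t - s < \<delta> \<Longrightarrow> \<bar>e s t\<bar> \<le> \<eta> * w s t"
  using assms unfolding mesh_small_def by blast

lemma mesh_small_add:
  assumes "mesh_small T w e" "mesh_small T w f"
  shows "mesh_small T w (\<lambda>s t. e s t + f s t)"
proof (rule mesh_smallI)
  fix \<eta> :: real assume "\<eta> > 0"
  then have \<eta>: "\<eta> / 2 > 0" by simp
  obtain d1 where d1: "d1 > 0" "\<And>s t. 0 \<le> s \<Longrightarrow> s < t \<Longrightarrow> t \<le> T \<Longrightarrow> t - s < d1 \<Longrightarrow> \<bar>e s t\<bar> \<le> \<eta> / 2 * w s t"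
    using mesh_smallE[OF assms(1) \<eta>] by blast
  obtain d2 where d2: "d2 > 0" "\<And>s t. 0 \<le> s \<Longrightarrow> s < t \<Longrightarrow> t \<le> T \<Longrightarrow> t - s < d2 \<Longrightarrow> \<bar>f s t\<bar> \<le> \<eta> / 2 * w s t"
    using mesh_smallE[OF assms(2) \<eta>] by blast
  show "\<exists>\<delta>>0. \<forall>s t. 0 \<le> s \<longrightarrow> s < t \<longrightarrow> t \<le> T \<longrightarrow> t - s < \<delta> \<longrightarrow> \<bar>e s t + f s t\<bar> \<le> \<eta> * w s t"
  proof (intro exI[of _ "min d1 d2"] conjI allI impI)
    fix s t assume "0 \<le> s" "s < t" "t \<le> T" "t - s < min d1 d2"
    then have "\<bar>e s t\<bar> \<le> \<eta> / 2 * w s t" "\<bar>f s t\<bar> \<le> \<eta> / 2 * w s t" using d1 d2 by auto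
    then show "\<bar>e s t + f s t\<bar> \<le> \<eta> * w s t" by (simp add: field_simps)
  qed (use d1 d2 in auto)
qed

lemma mesh_small_mono:
  assumes "mesh_small T w e" "0 \<le> C"
    and "\<And>s t. 0 \<le> s \<Longrightarrow> s < t \<Longrightarrow> t \<le> T \<Longrightarrow> \<bar>f s t\<bar> \<le> C * \<bar>e s t\<bar>"
    and w: "\<And>s t. 0 \<le> s \<Longrightarrow> s < t \<Longrightarrow> t \<le> T \<Longrightarrow> w s t \<le> D * v s t" and "0 \<le> D"
    and v: "\<And>s t. 0 \<le> s \<Longrightarrow> s < t \<Longrightarrow> t \<le> T \<Longrightarrow> 0 \<le> v s t"
  shows "mesh_small T v f"
proof (rule mesh_smallI)
  fix \<eta> :: real assume \<eta>: "\<eta> > 0"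
  define \<theta> where "\<theta> = \<eta> / (C * D + 1)"
  have CD: "0 \<le> C * D" using assms by simp
  then have \<theta>: "\<theta> > 0" "C * D * \<theta> \<le> \<eta>" using \<eta> by (auto simp: \<theta>_def field_simps)
  obtain d where d: "d > 0" "\<And>s t. 0 \<le> s \<Longrightarrow> s < t \<Longrightarrow> t \<le> T \<Longrightarrow> t - s < d \<Longrightarrow> \<bar>e s t\<bar> \<le> \<theta> * w s t"
    using mesh_smallE[OF assms(1) \<theta>(1)] by blast
  show "\<exists>\<delta>>0. \<forall>s t. 0 \<le> s \<longrightarrow> s < t \<longrightarrow> t \<le> T \<longrightarrow> t - s < \<delta> \<longrightarrow> \<bar>f s t\<bar> \<le> \<eta> * v s t"
  proof (intro exI[of _ d] conjI allI impI)
    fix s t assume st: "0 \<le> s" "s < t" "t \<le> T" "t - s < d"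
    have "\<bar>f s t\<bar> \<le> C * \<bar>e s t\<bar>" using assms(3) st by blast
    also have "\<dots> \<le> C * (\<theta> * (D * v s t))"
      using d(2)[OF st] w[OF st(1-3)] \<theta>(1) assms(2)
      by (intro mult_left_mono) (auto intro: order_trans mult_left_mono)
    also have "\<dots> = C * D * \<theta> * v s t" by simp
    also have "\<dots> \<le> \<eta> * v s t" using \<theta>(2) v[OF st(1-3)] by (rule mult_right_mono)
    finally show "\<bar>f s t\<bar> \<le> \<eta> * v s t" .
  qed (rule d(1))
qed

lemma mesh_small_uminus: "mesh_small T w e \<Longrightarrow> mesh_small T w (\<lambda>s t. - e s t)"
  by (simp add: mesh_small_def)

lemma mesh_small_diff:
  "mesh_small T w e \<Longrightarrow> mesh_small T w f \<Longrightarrow> mesh_small T w (\<lambda>s t. e s t - f s t)"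
  using mesh_small_add[of T w e "\<lambda>s t. - f s t"] mesh_small_uminus by simp

text \<open>o(1) times O(w) is o(w). Terms of third order in the increments are discarded in this
  way.\<close>

lemma mesh_small_mult_vanishing:
  assumes "mesh_small T (\<lambda>s t. 1) c" "0 \<le> C"
    and "\<And>s t. 0 \<le> s \<Longrightarrow> s < t \<Longrightarrow> t \<le> T \<Longrightarrow> \<bar>f s t\<bar> \<le> C * w s t"
    and w: "\<And>s t. 0 \<le> s \<Longrightarrow> s < t \<Longrightarrow> t \<le> T \<Longrightarrow> 0 \<le> w s t"
  shows "mesh_small T w (\<lambda>s t. c s t * f s t)"
proof (rule mesh_smallI)
  fix \<eta> :: real assume \<eta>: "\<eta> > 0"
  define \<theta> where "\<theta> = \<eta> / (C + 1)"
  have \<theta>: "\<theta> > 0" "\<theta> * (C + 1) = \<eta>" using \<eta> assms(2) by (auto simp: \<theta>_def)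
  obtain d where d: "d > 0" "\<And>s t. 0 \<le> s \<Longrightarrow> s < t \<Longrightarrow> t \<le> T \<Longrightarrow> t - s < d \<Longrightarrow> \<bar>c s t\<bar> \<le> \<theta> * 1"
    using mesh_smallE[OF assms(1) \<theta>(1)] by blast
  show "\<exists>\<delta>>0. \<forall>s t. 0 \<le> s \<longrightarrow> s < t \<longrightarrow> t \<le> T \<longrightarrow> t - s < \<delta> \<longrightarrow> \<bar>c s t * f s t\<bar> \<le> \<eta> * w s t"
  proof (intro exI[of _ d] conjI allI impI)
    fix s t assume st: "0 \<le> s" "s < t" "t \<le> T" "t - s < d"
    have f: "\<bar>f s t\<bar> \<le> C * w s t" using assms(3) st by blast
    have "\<bar>c s t * f s t\<bar> \<le> \<theta> * (C * w s t)"
      unfolding abs_mult using d(2)[OF st] f \<theta>(1) by (intro mult_mono) auto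
    also have "\<dots> \<le> \<eta> * w s t"
    proof -
      have "0 \<le> \<theta> * w s t" using \<theta>(1) w[OF st(1-3)] by simp
      then show ?thesis unfolding \<theta>(2)[symmetric] by (simp add: algebra_simps)
    qed
    finally show "\<bar>c s t * f s t\<bar> \<le> \<eta> * w s t" .
  qed (rule d(1))
qed

section \<open>Continuous paths and sums over partitions\<close>

lemma vanishing_increments:
  assumes "continuous_on {0..T} x"
  shows "mesh_small T (\<lambda>s t. 1) (\<lambda>s t. x t - x s)"
proof (rule mesh_smallI)
  fix \<eta> :: real assume "\<eta> > 0"
  moreover have "uniformly_continuous_on {0..T} x"
    using assms by (intro compact_uniformly_continuous) auto
  ultimately obtain d where "d > 0" and d: "\<And>s t. s \<in> {0..T} \<Longrightarrow> t \<in> {0..T} \<Longrightarrow> dist t s < d \<Longrightarrow> dist (x t) (x s) < \<eta>"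
    unfolding uniformly_continuous_on_def by metis
  then show "\<exists>\<delta>>0. \<forall>s t. 0 \<le> s \<longrightarrow> s < t \<longrightarrow> t \<le> T \<longrightarrow> t - s < \<delta> \<longrightarrow> \<bar>x t - x s\<bar> \<le> \<eta> * 1"
    by (intro exI[of _ d]) (force simp: dist_real_def less_imp_le)
qed

lemma path_bounded:
  fixes x :: "real \<Rightarrow> real"
  assumes "continuous_on {0..T} x"
  obtains C where "0 \<le> C" "\<And>t. 0 \<le> t \<Longrightarrow> t \<le> T \<Longrightarrow> \<bar>x t\<bar> \<le> C"
proof -
  have "bounded (x ` {0..T})"
    by (intro compact_imp_bounded compact_continuous_image assms compact_Icc)
  then obtain C where "\<forall>t\<in>{0..T}. \<bar>x t\<bar> \<le> C" by (auto simp: bounded_iff)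
  then show ?thesis by (intro that[of "max C 0"]) (auto simp: le_max_iff_disj)
qed

lemma partition_mono:
  assumes "partition_of t m p" "i \<le> k" "k \<le> m"
  shows "p i \<le> p k"
  using assms(2,3)
proof (induction k rule: dec_induct)
  case (step n)
  have "p (Suc n - 1) < p (Suc n)"
    using assms(1) step unfolding partition_of_def by (metis Suc_eq_plus1 Suc_le_eq atLeastAtMost_iff le_add2)
  then show ?case using step by simp
qed simp

lemma partition_bounds:
  assumes "partition_of t m p" "k \<in> {1..m}"
  shows "0 \<le> p (k - 1)" "p (k - 1) < p k" "p k \<le> t"
  using assms partition_mono[OF assms(1), of 0 "k - 1"] partition_mono[OF assms(1), of k m]
  by (auto simp: partition_of_def)

lemma partition_points:
  assumes "partition_of t m p" "k \<le> m"
  shows "p k \<in> {0..t}"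
  using partition_mono[OF assms(1), of 0 k] partition_mono[OF assms(1), of k m] assms
  by (auto simp: partition_of_def)

lemma partition_telescope:
  fixes x :: "real \<Rightarrow> real"
  assumes "partition_of t m p"
  shows "(\<Sum>k=1..m. x (p k) - x (p (k - 1))) = x t - x 0"
proof -
  have "(\<Sum>k=1..n. x (p k) - x (p (k - 1))) = x (p n) - x (p 0)" for n
    by (induction n) auto
  then show ?thesis using assms by (simp add: partition_of_def)
qed

lemma partition_integral:
  fixes g :: "real \<Rightarrow> real"
  assumes p: "partition_of t m p" and g: "g integrable_on {0..t}"
  shows "(\<Sum>k=1..m. integral {p (k - 1)..p k} g) = integral {0..t} g"
proof -
  have "(\<Sum>k=1..n. integral {p (k - 1)..p k} g) = integral {0..p n} g" if "n \<le> m" for n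
    using that
  proof (induction n)
    case 0
    then show ?case using p by (simp add: partition_of_def)
  next
    case (Suc n)
    have "0 \<le> p n" "p n \<le> p (Suc n)" "p (Suc n) \<le> t"
      using partition_points[OF p, of n] partition_points[OF p, of "Suc n"] partition_mono[OF p, of n "Suc n"] Suc
      by auto
    then have "integral {0..p n} g + integral {p n..p (Suc n)} g = integral {0..p (Suc n)} g"
      by (intro Henstock_Kurzweil_Integration.integral_combine integrable_on_subinterval[OF g]) auto
    then show ?case using Suc by simp
  qed
  then show ?thesis using p by (simp add: partition_of_def)
qed

lemma mesh_small_partition_sum:
  assumes "mesh_small T w e" "partition_sequence t j p" "t \<le> T" "\<eta> > 0"
  shows "\<forall>\<^sub>F n in sequentially. \<bar>\<Sum>k=1..j n. e (p n (k - 1)) (p n k)\<bar> \<le> \<eta> * (\<Sum>k=1..j n. w (p n (k - 1)) (p n k))"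
proof -
  obtain d where d: "d > 0" "\<And>s t. 0 \<le> s \<Longrightarrow> s < t \<Longrightarrow> t \<le> T \<Longrightarrow> t - s < d \<Longrightarrow> \<bar>e s t\<bar> \<le> \<eta> * w s t"
    using mesh_smallE[OF assms(1,4)] by blast
  have "\<forall>\<^sub>F n in sequentially. \<forall>k\<in>{1..j n}. \<bar>p n k - p n (k - 1)\<bar> < d"
    using assms(2) d(1) unfolding partition_sequence_def by blast
  then show ?thesis
  proof eventually_elim
    case (elim n)
    have P: "partition_of t (j n) (p n)" using assms(2) by (simp add: partition_sequence_def)
    have "\<bar>\<Sum>k=1..j n. e (p n (k - 1)) (p n k)\<bar> \<le> (\<Sum>k=1..j n. \<bar>e (p n (k - 1)) (p n k)\<bar>)"
      by (rule sum_abs)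
    also have "\<dots> \<le> (\<Sum>k=1..j n. \<eta> * w (p n (k - 1)) (p n k))"
    proof (rule sum_mono)
      fix k assume k: "k \<in> {1..j n}"
      show "\<bar>e (p n (k - 1)) (p n k)\<bar> \<le> \<eta> * w (p n (k - 1)) (p n k)"
        using partition_bounds[OF P k] bspec[OF elim k] assms(3) by (intro d(2)) auto
    qed
    finally show ?case by (simp add: sum_distrib_left)
  qed
qed

section \<open>The trapezoidal rule along paths\<close>

lemma increment_bound:
  fixes \<phi> \<phi>' :: "real \<Rightarrow> real"
  assumes "\<And>x. (\<phi> has_real_derivative \<phi>' x) (at x)"
    and "\<And>x. x \<in> closed_segment a b \<Longrightarrow> \<bar>\<phi>' x - c\<bar> \<le> \<eta>"
  shows "\<bar>\<phi> b - \<phi> a - c * (b - a)\<bar> \<le> \<eta> * \<bar>b - a\<bar>"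
proof -
  have "norm ((\<phi> b - c * b) - (\<phi> a - c * a)) \<le> \<eta> * norm (b - a)"
  proof (rule field_differentiable_bound[where S="closed_segment a b" and f'="\<lambda>x. \<phi>' x - c"])
    show "((\<lambda>x. \<phi> x - c * x) has_field_derivative \<phi>' x - c) (at x within closed_segment a b)" for x
      by (rule has_field_derivative_at_within) (auto intro!: derivative_eq_intros assms(1))
  qed (use assms(2) in auto)
  then show ?thesis by (simp add: algebra_simps)
qed

text \<open>The derivative of the error at \<open>x\<close> is half of the first-order Taylor error
  of \<phi>', hence bounded by \<eta> times the length of the segment. Only the oscillation of the
  second derivative enters, so for C^2 functions the rule is exact up to o of the squared
  increment.\<close>

lemma trapezoid_bound:
  fixes \<phi> \<phi>' \<phi>'' :: "real \<Rightarrow> real"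
  assumes d: "\<And>x. (\<phi> has_real_derivative \<phi>' x) (at x)" "\<And>x. (\<phi>' has_real_derivative \<phi>'' x) (at x)"
    and osc: "\<And>x y. x \<in> closed_segment a b \<Longrightarrow> y \<in> closed_segment a b \<Longrightarrow> \<bar>\<phi>'' x - \<phi>'' y\<bar> \<le> \<eta>"
  shows "\<bar>\<phi> b - \<phi> a - (\<phi>' a + \<phi>' b) / 2 * (b - a)\<bar> \<le> \<eta> * (b - a)\<^sup>2"
proof -
  define G where "G x = \<phi> x - \<phi> a - (\<phi>' a + \<phi>' x) / 2 * (x - a)" for x
  define G' where "G' x = ((\<phi>' x - \<phi>' a) - \<phi>'' x * (x - a)) / 2" for x
  have \<eta>: "0 \<le> \<eta>" using osc[of a a] by simp
  have "norm (G b - G a) \<le> (\<eta> * \<bar>b - a\<bar>) * norm (b - a)"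
  proof (rule field_differentiable_bound[where S="closed_segment a b" and f'=G'])
    show "(G has_field_derivative G' x) (at x within closed_segment a b)" for x
      unfolding G_def by (rule has_field_derivative_at_within)
        (auto intro!: derivative_eq_intros d simp: G'_def field_simps)
    fix x assume x: "x \<in> closed_segment a b"
    have sub: "closed_segment a x \<subseteq> closed_segment a b" using x by (simp add: subset_closed_segment)
    have "\<bar>\<phi>' x - \<phi>' a - \<phi>'' x * (x - a)\<bar> \<le> \<eta> * \<bar>x - a\<bar>"
      using sub x osc by (intro increment_bound[OF d(2)]) auto
    also have "\<dots> \<le> \<eta> * \<bar>b - a\<bar>"
      using x \<eta> by (intro mult_left_mono) (auto simp: closed_segment_eq_real_ivl split: if_splits)
    finally show "norm (G' x) \<le> \<eta> * \<bar>b - a\<bar>" by (simp add: G'_def)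
  qed auto
  then show ?thesis by (simp add: G_def power2_eq_square abs_mult[symmetric] mult.assoc)
qed

text \<open>The two arguments range independently over the segments between the path values, because
  mixed points such as (m t, x s) and intermediate points of the mean value theorem need not lie on
  the path.\<close>

lemma path_oscillation:
  fixes f :: "real \<Rightarrow> real \<Rightarrow> real" and m x :: "real \<Rightarrow> real"
  assumes f: "continuous_on UNIV (\<lambda>(x, y). f x y)" and m: "continuous_on {0..T} m" and x: "continuous_on {0..T} x"
    and "\<eta> > 0"
  obtains \<delta> where "\<delta> > 0"
    "\<And>s t a c a' c'. 0 \<le> s \<Longrightarrow> s < t \<Longrightarrow> t \<le> T \<Longrightarrow> t - s < \<delta> \<Longrightarrow>
      a \<in> closed_segment (m s) (m t) \<Longrightarrow> a' \<in> closed_segment (m s) (m t) \<Longrightarrow>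
      c \<in> closed_segment (x s) (x t) \<Longrightarrow> c' \<in> closed_segment (x s) (x t) \<Longrightarrow> \<bar>f a c - f a' c'\<bar> \<le> \<eta>"
proof -
  obtain C1 where C1: "0 \<le> C1" "\<And>t. 0 \<le> t \<Longrightarrow> t \<le> T \<Longrightarrow> \<bar>m t\<bar> \<le> C1" using path_bounded[OF m] by blast
  obtain C2 where C2: "0 \<le> C2" "\<And>t. 0 \<le> t \<Longrightarrow> t \<le> T \<Longrightarrow> \<bar>x t\<bar> \<le> C2" using path_bounded[OF x] by blast
  let ?S = "{-C1..C1} \<times> {-C2..C2}"
  have "uniformly_continuous_on ?S (\<lambda>(x, y). f x y)"
    using f by (intro compact_uniformly_continuous compact_Times compact_Icc) (auto intro: continuous_on_subset)
  then obtain d where d: "d > 0" "\<And>z z'. z \<in> ?S \<Longrightarrow> z' \<in> ?S \<Longrightarrow> dist z' z < d \<Longrightarrow>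
      dist (case z' of (x, y) \<Rightarrow> f x y) (case z of (x, y) \<Rightarrow> f x y) < \<eta>"
    using \<open>\<eta> > 0\<close> unfolding uniformly_continuous_on_def by metis
  then have d3: "d / 3 > 0" by simp
  obtain d1 where d1: "d1 > 0" "\<And>s t. 0 \<le> s \<Longrightarrow> s < t \<Longrightarrow> t \<le> T \<Longrightarrow> t - s < d1 \<Longrightarrow> \<bar>m t - m s\<bar> \<le> d / 3 * 1"
    using mesh_smallE[OF vanishing_increments[OF m] d3] by blast
  obtain d2 where d2: "d2 > 0" "\<And>s t. 0 \<le> s \<Longrightarrow> s < t \<Longrightarrow> t \<le> T \<Longrightarrow> t - s < d2 \<Longrightarrow> \<bar>x t - x s\<bar> \<le> d / 3 * 1"
    using mesh_smallE[OF vanishing_increments[OF x] d3] by blast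
  have seg: "\<bar>u\<bar> \<le> C" "\<bar>u - v\<bar> \<le> \<bar>r' - r\<bar>" if "u \<in> closed_segment r r'" "v \<in> closed_segment r r'" "\<bar>r\<bar> \<le> C" "\<bar>r'\<bar> \<le> C"
    for u v r r' C :: real
    using that by (auto simp: closed_segment_eq_real_ivl split: if_splits)
  show ?thesis
  proof (rule that[of "min d1 d2"])
    fix s t a c a' c'
    assume st: "0 \<le> s" "s < t" "t \<le> T" "t - s < min d1 d2"
      and ac: "a \<in> closed_segment (m s) (m t)" "a' \<in> closed_segment (m s) (m t)"
        "c \<in> closed_segment (x s) (x t)" "c' \<in> closed_segment (x s) (x t)"
    have ms: "\<bar>m s\<bar> \<le> C1" "\<bar>m t\<bar> \<le> C1" "\<bar>x s\<bar> \<le> C2" "\<bar>x t\<bar> \<le> C2" using C1 C2 st by auto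
    have "dist (a, c) (a', c') \<le> dist a a' + dist c c'"
      unfolding dist_Pair_Pair by (rule sqrt_sum_squares_le_sum) auto
    also have "\<dots> \<le> \<bar>m t - m s\<bar> + \<bar>x t - x s\<bar>"
      using seg(2)[OF ac(1,2) ms(1,2)] seg(2)[OF ac(3,4) ms(3,4)] by (simp add: dist_real_def)
    also have "\<dots> \<le> d / 3 + d / 3"
      using d1(2)[of s t] d2(2)[of s t] st by (intro add_mono) auto
    also have "\<dots> < d" using d(1) by simp
    finally have "dist (f a c) (f a' c') < \<eta>"
      using d(2)[of "(a', c')" "(a, c)"] seg(1)[OF ac(1,2) ms(1,2)] seg(1)[OF ac(2,1) ms(1,2)]
        seg(1)[OF ac(3,4) ms(3,4)] seg(1)[OF ac(4,3) ms(3,4)] by (auto simp: abs_le_iff)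
    then show "\<bar>f a c - f a' c'\<bar> \<le> \<eta>" by (simp add: dist_real_def)
  qed (use d1 d2 in auto)
qed

text \<open>The first variable is moved at fixed \<open>x s\<close> by the trapezoidal rule, then
  the second one to first order only. This suits an \<open>x\<close> whose increments are of the
  order of the time step, and asks for no second derivative of \<open>G\<close> in the second
  variable.\<close>

lemma trapezoid_semi:
  fixes G A A1 A2 B :: "real \<Rightarrow> real \<Rightarrow> real" and m x :: "real \<Rightarrow> real"
  assumes G1: "\<And>r x. ((\<lambda>u. G u x) has_real_derivative A r x) (at r)"
    and G2: "\<And>r x. (G r has_real_derivative B r x) (at x)"
    and A1: "\<And>r x. ((\<lambda>u. A u x) has_real_derivative A1 r x) (at r)"
    and A2: "\<And>r x. (A r has_real_derivative A2 r x) (at x)"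
    and c: "continuous_on UNIV (\<lambda>(r, x). A1 r x)" "continuous_on UNIV (\<lambda>(r, x). A2 r x)"
      "continuous_on UNIV (\<lambda>(r, x). B r x)"
    and m: "continuous_on {0..T} m" and x: "continuous_on {0..T} x"
  shows "mesh_small T (\<lambda>s t. (m t - m s)\<^sup>2 + \<bar>x t - x s\<bar>)
    (\<lambda>s t. G (m t) (x t) - G (m s) (x s) - (A (m s) (x s) + A (m t) (x t)) / 2 * (m t - m s)
      - B (m s) (x s) * (x t - x s))"
proof -
  let ?w = "\<lambda>s t. (m t - m s)\<^sup>2 + \<bar>x t - x s\<bar>"
  have 1: "mesh_small T ?w (\<lambda>s t. G (m t) (x s) - G (m s) (x s) - (A (m s) (x s) + A (m t) (x s)) / 2 * (m t - m s))"
  proof (rule mesh_smallI)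
    fix \<eta> :: real assume \<eta>: "\<eta> > 0"
    obtain \<delta> where \<delta>: "\<delta> > 0" "\<And>s t a c a' c'. 0 \<le> s \<Longrightarrow> s < t \<Longrightarrow> t \<le> T \<Longrightarrow> t - s < \<delta> \<Longrightarrow>
      a \<in> closed_segment (m s) (m t) \<Longrightarrow> a' \<in> closed_segment (m s) (m t) \<Longrightarrow>
      c \<in> closed_segment (x s) (x t) \<Longrightarrow> c' \<in> closed_segment (x s) (x t) \<Longrightarrow> \<bar>A1 a c - A1 a' c'\<bar> \<le> \<eta>"
      using path_oscillation[OF c(1) m x \<eta>] by blast
    show "\<exists>\<delta>>0. \<forall>s t. 0 \<le> s \<longrightarrow> s < t \<longrightarrow> t \<le> T \<longrightarrow> t - s < \<delta> \<longrightarrow>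
      \<bar>G (m t) (x s) - G (m s) (x s) - (A (m s) (x s) + A (m t) (x s)) / 2 * (m t - m s)\<bar> \<le> \<eta> * ?w s t"
    proof (intro exI[of _ \<delta>] conjI allI impI)
      fix s t assume "0 \<le> s" "s < t" "t \<le> T" "t - s < \<delta>"
      then have "\<bar>G (m t) (x s) - G (m s) (x s) - (A (m s) (x s) + A (m t) (x s)) / 2 * (m t - m s)\<bar> \<le> \<eta> * (m t - m s)\<^sup>2"
        by (intro trapezoid_bound[OF G1 A1] \<delta>(2)) auto
      also have "\<dots> \<le> \<eta> * ?w s t" using \<eta> by (intro mult_left_mono) auto
      finally show "\<bar>G (m t) (x s) - G (m s) (x s) - (A (m s) (x s) + A (m t) (x s)) / 2 * (m t - m s)\<bar> \<le> \<eta> * ?w s t" .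
    qed (rule \<delta>(1))
  qed
  have 2: "mesh_small T ?w (\<lambda>s t. G (m t) (x t) - G (m t) (x s) - B (m s) (x s) * (x t - x s))"
  proof (rule mesh_smallI)
    fix \<eta> :: real assume \<eta>: "\<eta> > 0"
    obtain \<delta> where \<delta>: "\<delta> > 0" "\<And>s t a c a' c'. 0 \<le> s \<Longrightarrow> s < t \<Longrightarrow> t \<le> T \<Longrightarrow> t - s < \<delta> \<Longrightarrow>
      a \<in> closed_segment (m s) (m t) \<Longrightarrow> a' \<in> closed_segment (m s) (m t) \<Longrightarrow>
      c \<in> closed_segment (x s) (x t) \<Longrightarrow> c' \<in> closed_segment (x s) (x t) \<Longrightarrow> \<bar>B a c - B a' c'\<bar> \<le> \<eta>"
      using path_oscillation[OF c(3) m x \<eta>] by blast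
    show "\<exists>\<delta>>0. \<forall>s t. 0 \<le> s \<longrightarrow> s < t \<longrightarrow> t \<le> T \<longrightarrow> t - s < \<delta> \<longrightarrow>
      \<bar>G (m t) (x t) - G (m t) (x s) - B (m s) (x s) * (x t - x s)\<bar> \<le> \<eta> * ?w s t"
    proof (intro exI[of _ \<delta>] conjI allI impI)
      fix s t assume "0 \<le> s" "s < t" "t \<le> T" "t - s < \<delta>"
      then have "\<bar>G (m t) (x t) - G (m t) (x s) - B (m s) (x s) * (x t - x s)\<bar> \<le> \<eta> * \<bar>x t - x s\<bar>"
        by (intro increment_bound[OF G2] \<delta>(2)) auto
      also have "\<dots> \<le> \<eta> * ?w s t" using \<eta> by (intro mult_left_mono) auto
      finally show "\<bar>G (m t) (x t) - G (m t) (x s) - B (m s) (x s) * (x t - x s)\<bar> \<le> \<eta> * ?w s t" .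
    qed (rule \<delta>(1))
  qed
  obtain C1 where C1: "0 \<le> C1" "\<And>t. 0 \<le> t \<Longrightarrow> t \<le> T \<Longrightarrow> \<bar>m t\<bar> \<le> C1" using path_bounded[OF m] by blast
  obtain C2 where C2: "0 \<le> C2" "\<And>t. 0 \<le> t \<Longrightarrow> t \<le> T \<Longrightarrow> \<bar>x t\<bar> \<le> C2" using path_bounded[OF x] by blast
  obtain C where C: "0 \<le> C" "\<And>r x. \<bar>r\<bar> \<le> max C1 C2 \<Longrightarrow> \<bar>x\<bar> \<le> max C1 C2 \<Longrightarrow> \<bar>A2 r x\<bar> \<le> C"
    using continuous_on_bounded_square[OF c(2)] by blast
  \<comment> \<open>Replacing \<open>x s\<close> by \<open>x t\<close> in the second endpoint value
    of \<open>A\<close> costs an increment of \<open>m\<close> times one of \<open>x\<close>, the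
    former vanishing with the mesh.\<close>
  have 3: "mesh_small T ?w (\<lambda>s t. (m t - m s) * ((A (m t) (x t) - A (m t) (x s)) / 2))"
  proof (rule mesh_small_mult_vanishing[OF vanishing_increments[OF m] C(1)])
    fix s t :: real assume st: "0 \<le> s" "s < t" "t \<le> T"
    have "\<bar>A (m t) (x t) - A (m t) (x s) - 0 * (x t - x s)\<bar> \<le> C * \<bar>x t - x s\<bar>"
    proof (rule increment_bound[OF A2])
      fix y assume "y \<in> closed_segment (x s) (x t)"
      then have "\<bar>y\<bar> \<le> C2" using C2(2)[of s] C2(2)[of t] st
        by (auto simp: closed_segment_eq_real_ivl split: if_splits)
      then show "\<bar>A2 (m t) y - 0\<bar> \<le> C" using C(2)[of "m t" y] C1(2)[of t] st by auto
    qed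
    also have "\<dots> \<le> C * ?w s t" using C(1) by (intro mult_left_mono) auto
    finally show "\<bar>(A (m t) (x t) - A (m t) (x s)) / 2\<bar> \<le> C * ?w s t" by simp
  qed simp
  have e: "G (m t) (x t) - G (m s) (x s) - (A (m s) (x s) + A (m t) (x t)) / 2 * (m t - m s)
      - B (m s) (x s) * (x t - x s) =
    (G (m t) (x s) - G (m s) (x s) - (A (m s) (x s) + A (m t) (x s)) / 2 * (m t - m s)) +
    (G (m t) (x t) - G (m t) (x s) - B (m s) (x s) * (x t - x s)) -
    (m t - m s) * ((A (m t) (x t) - A (m t) (x s)) / 2)" for s t
    by (simp add: field_simps)
  show ?thesis unfolding e by (intro mesh_small_diff mesh_small_add 1 2 3)
qed

text \<open>The two error terms of the order of the product of the increments cancel because the mixed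
  derivatives of \<open>G\<close> agree; this is what makes the rule usable when \<open>x\<close> is not of bounded variation.\<close>

lemma trapezoid_symmetric:
  fixes G A A1 B B2 N :: "real \<Rightarrow> real \<Rightarrow> real" and m x :: "real \<Rightarrow> real"
  assumes G1: "\<And>r x. ((\<lambda>u. G u x) has_real_derivative A r x) (at r)"
    and G2: "\<And>r x. (G r has_real_derivative B r x) (at x)"
    and A1: "\<And>r x. ((\<lambda>u. A u x) has_real_derivative A1 r x) (at r)"
    and A2: "\<And>r x. (A r has_real_derivative N r x) (at x)"
    and B1: "\<And>r x. ((\<lambda>u. B u x) has_real_derivative N r x) (at r)"
    and B2: "\<And>r x. (B r has_real_derivative B2 r x) (at x)"
    and c: "continuous_on UNIV (\<lambda>(r, x). A1 r x)" "continuous_on UNIV (\<lambda>(r, x). N r x)"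
      "continuous_on UNIV (\<lambda>(r, x). B2 r x)"
    and m: "continuous_on {0..T} m" and x: "continuous_on {0..T} x"
  shows "mesh_small T (\<lambda>s t. (m t - m s)\<^sup>2 + (x t - x s)\<^sup>2)
    (\<lambda>s t. G (m t) (x t) - G (m s) (x s) - (A (m s) (x s) + A (m t) (x t)) / 2 * (m t - m s)
      - (B (m s) (x s) + B (m t) (x t)) / 2 * (x t - x s))"
proof (rule mesh_smallI)
  fix \<eta>' :: real assume "\<eta>' > 0"
  define \<eta> where "\<eta> = \<eta>' / 2"
  have \<eta>: "\<eta> > 0" using \<open>\<eta>' > 0\<close> by (simp add: \<eta>_def)
  let ?close = "\<lambda>f \<delta>. \<forall>s t a c a' c'. 0 \<le> s \<longrightarrow> s < t \<longrightarrow> t \<le> T \<longrightarrow> t - s < \<delta> \<longrightarrow>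
      a \<in> closed_segment (m s) (m t) \<longrightarrow> a' \<in> closed_segment (m s) (m t) \<longrightarrow>
      c \<in> closed_segment (x s) (x t) \<longrightarrow> c' \<in> closed_segment (x s) (x t) \<longrightarrow> \<bar>f a c - f a' c'\<bar> \<le> \<eta>"
  obtain d1 where d1: "d1 > 0" "?close A1 d1" using path_oscillation[OF c(1) m x \<eta>] by metis
  obtain d2 where d2: "d2 > 0" "?close N d2" using path_oscillation[OF c(2) m x \<eta>] by metis
  obtain d3 where d3: "d3 > 0" "?close B2 d3" using path_oscillation[OF c(3) m x \<eta>] by metis
  show "\<exists>\<delta>>0. \<forall>s t. 0 \<le> s \<longrightarrow> s < t \<longrightarrow> t \<le> T \<longrightarrow> t - s < \<delta> \<longrightarrow>
      \<bar>G (m t) (x t) - G (m s) (x s) - (A (m s) (x s) + A (m t) (x t)) / 2 * (m t - m s)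
        - (B (m s) (x s) + B (m t) (x t)) / 2 * (x t - x s)\<bar> \<le> \<eta>' * ((m t - m s)\<^sup>2 + (x t - x s)\<^sup>2)"
  proof (intro exI[of _ "min d1 (min d2 d3)"] conjI allI impI)
    fix s t assume st: "0 \<le> s" "s < t" "t \<le> T" "t - s < min d1 (min d2 d3)"
    let ?m = "m t - m s" and ?x = "x t - x s"
    define E1 where "E1 = G (m t) (x s) - G (m s) (x s) - (A (m s) (x s) + A (m t) (x s)) / 2 * ?m"
    define E2 where "E2 = G (m t) (x t) - G (m t) (x s) - (B (m t) (x s) + B (m t) (x t)) / 2 * ?x"
    define E3 where "E3 = A (m t) (x t) - A (m t) (x s) - N (m s) (x s) * ?x"
    define E4 where "E4 = B (m t) (x s) - B (m s) (x s) - N (m s) (x s) * ?m"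
    have E1: "\<bar>E1\<bar> \<le> \<eta> * ?m\<^sup>2"
      unfolding E1_def using st d1(2) by (intro trapezoid_bound[OF G1 A1]) auto
    have E2: "\<bar>E2\<bar> \<le> \<eta> * ?x\<^sup>2"
      unfolding E2_def using st d3(2) by (intro trapezoid_bound[OF G2 B2]) auto
    have E3: "\<bar>E3\<bar> \<le> \<eta> * \<bar>?x\<bar>"
      unfolding E3_def using st d2(2) by (intro increment_bound[OF A2]) auto
    have E4: "\<bar>E4\<bar> \<le> \<eta> * \<bar>?m\<bar>"
      unfolding E4_def using st d2(2) by (intro increment_bound[OF B1]) auto
    \<comment> \<open>The intermediate corner is (m t, x s). \<open>E3\<close> corrects the endpoint
      value of \<open>A\<close>, \<open>E4\<close> that of \<open>B\<close>; with the common value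
      \<open>N (m s) (x s)\<close> the two bilinear terms cancel.\<close>
    have "G (m t) (x t) - G (m s) (x s) - (A (m s) (x s) + A (m t) (x t)) / 2 * ?m
        - (B (m s) (x s) + B (m t) (x t)) / 2 * ?x = E1 + E2 - E3 * ?m / 2 + E4 * ?x / 2"
      by (simp add: E1_def E2_def E3_def E4_def field_simps)
    also have "\<bar>\<dots>\<bar> \<le> \<bar>E1\<bar> + \<bar>E2\<bar> + \<bar>E3 * ?m\<bar> / 2 + \<bar>E4 * ?x\<bar> / 2" by linarith
    also have "\<dots> \<le> \<eta> * ?m\<^sup>2 + \<eta> * ?x\<^sup>2 + (\<eta> * \<bar>?x\<bar>) * \<bar>?m\<bar> / 2 + (\<eta> * \<bar>?m\<bar>) * \<bar>?x\<bar> / 2"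
      unfolding abs_mult by (intro add_mono divide_right_mono mult_right_mono E1 E2 E3 E4) auto
    also have "\<dots> = \<eta> * (?m\<^sup>2 + ?x\<^sup>2 + \<bar>?x\<bar> * \<bar>?m\<bar>)" by (simp add: algebra_simps)
    also have "\<dots> \<le> \<eta> * (2 * (?m\<^sup>2 + ?x\<^sup>2))"
    proof (intro mult_left_mono)
      have "0 \<le> (\<bar>?x\<bar> - \<bar>?m\<bar>)\<^sup>2" by simp
      then have "2 * (\<bar>?x\<bar> * \<bar>?m\<bar>) \<le> ?m\<^sup>2 + ?x\<^sup>2"
        by (simp only: power2_diff power2_abs mult.assoc)
      moreover have "0 \<le> ?m\<^sup>2 + ?x\<^sup>2" by simp
      moreover have "b + a \<le> 2 * b" if "2 * a \<le> b" "0 \<le> b" for a b :: real using that by linarith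
      ultimately show "?m\<^sup>2 + ?x\<^sup>2 + \<bar>?x\<bar> * \<bar>?m\<bar> \<le> 2 * (?m\<^sup>2 + ?x\<^sup>2)" by blast
    qed (use \<eta> in auto)
    also have "\<dots> = \<eta>' * (?m\<^sup>2 + ?x\<^sup>2)" by (simp add: \<eta>_def)
    finally show "\<bar>G (m t) (x t) - G (m s) (x s) - (A (m s) (x s) + A (m t) (x t)) / 2 * ?m
        - (B (m s) (x s) + B (m t) (x t)) / 2 * ?x\<bar> \<le> \<eta>' * (?m\<^sup>2 + ?x\<^sup>2)" .
  qed (use d1 d2 d3 in auto)
qed

text \<open>Freezing the continuous factor \<open>c\<close> at the left endpoint changes the
  integral by at most its oscillation times a bound for \<open>v\<close> times the length.\<close>

lemma mesh_small_integral:
  fixes c v :: "real \<Rightarrow> real"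
  assumes c: "continuous_on {0..T} c" and v: "continuous_on {0..T} v"
  shows "mesh_small T (\<lambda>s t. t - s) (\<lambda>s t. c s * integral {s..t} v - integral {s..t} (\<lambda>u. c u * v u))"
proof (rule mesh_smallI)
  fix \<eta> :: real assume \<eta>: "\<eta> > 0"
  obtain C where C: "0 \<le> C" "\<And>t. 0 \<le> t \<Longrightarrow> t \<le> T \<Longrightarrow> \<bar>v t\<bar> \<le> C" using path_bounded[OF v] by blast
  define \<theta> where "\<theta> = \<eta> / (C + 1)"
  have \<theta>: "\<theta> > 0" "\<theta> * C \<le> \<eta>" using \<eta> C(1) by (auto simp: \<theta>_def field_simps)
  obtain d where d: "d > 0" "\<And>s t. 0 \<le> s \<Longrightarrow> s < t \<Longrightarrow> t \<le> T \<Longrightarrow> t - s < d \<Longrightarrow> \<bar>c t - c s\<bar> \<le> \<theta> * 1"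
    using mesh_smallE[OF vanishing_increments[OF c] \<theta>(1)] by blast
  show "\<exists>\<delta>>0. \<forall>s t. 0 \<le> s \<longrightarrow> s < t \<longrightarrow> t \<le> T \<longrightarrow> t - s < \<delta> \<longrightarrow>
      \<bar>c s * integral {s..t} v - integral {s..t} (\<lambda>u. c u * v u)\<bar> \<le> \<eta> * (t - s)"
  proof (intro exI[of _ d] conjI allI impI)
    fix s t assume st: "0 \<le> s" "s < t" "t \<le> T" "t - s < d"
    have cont: "continuous_on {s..t} c" "continuous_on {s..t} v"
      using st by (auto intro!: continuous_on_subset[OF c] continuous_on_subset[OF v])
    have int: "(\<lambda>u. c s * v u) integrable_on {s..t}" "(\<lambda>u. c u * v u) integrable_on {s..t}"
      "(\<lambda>u. (c s - c u) * v u) integrable_on {s..t}"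
      by (intro integrable_continuous_real continuous_intros cont)+
    have "c s * integral {s..t} v - integral {s..t} (\<lambda>u. c u * v u) = integral {s..t} (\<lambda>u. (c s - c u) * v u)"
      using Henstock_Kurzweil_Integration.integral_diff[OF int(1,2)] by (simp add: algebra_simps)
    also have "norm \<dots> \<le> (\<theta> * C) * measure lborel (cbox s t)"
      unfolding cbox_interval[symmetric]
    proof (rule integrable_bound)
      show "0 \<le> \<theta> * C" using \<theta> C by simp
      show "(\<lambda>u. (c s - c u) * v u) integrable_on cbox s t" using int(3) by simp
      fix u assume u: "u \<in> cbox s t"
      have "\<bar>c u - c s\<bar> \<le> \<theta>" using d(2)[of s u] u st \<theta>(1) by (cases "u = s") auto
      then show "norm ((c s - c u) * v u) \<le> \<theta> * C"
        using C(2)[of u] u st \<theta>(1) unfolding real_norm_def abs_mult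
        by (intro mult_mono) (auto simp: abs_minus_commute)
    qed
    also have "\<dots> \<le> \<eta> * (t - s)" using \<theta>(2) st by (simp add: mult_right_mono)
    finally show "\<bar>c s * integral {s..t} v - integral {s..t} (\<lambda>u. c u * v u)\<bar> \<le> \<eta> * (t - s)" by simp
  qed (rule d(1))
qed

lemma uniform_partition_sequence:
  assumes "0 \<le> t"
  obtains j p where "partition_sequence t j p"
proof (cases "t = 0")
  case True
  \<comment> \<open>Partition points increase strictly, so over [0,0] only the partition without
    subintervals is possible.\<close>
  then have "partition_sequence t (\<lambda>n. 0) (\<lambda>n k. 0)"
    by (auto simp: partition_sequence_def partition_of_def)
  then show ?thesis by (rule that)
next
  case False
  then have t: "0 < t" using assms by simp
  let ?p = "\<lambda>n k. real k * (t / real (Suc n))"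
  have step: "?p n k - ?p n (k - 1) = t / real (Suc n)" if "k \<in> {1..Suc n}" for n k
  proof -
    have "real k - real (k - 1) = 1" using that by (simp add: of_nat_diff)
    then show ?thesis by (simp only: left_diff_distrib[symmetric] mult_1)
  qed
  have "partition_of t (Suc n) (?p n)" for n
    unfolding partition_of_def
  proof (intro conjI ballI)
    fix k assume "k \<in> {1..Suc n}"
    then show "?p n (k - 1) < ?p n k" using step[of k n] t by (smt (verit) divide_pos_pos of_nat_0_less_iff zero_less_Suc)
  qed auto
  moreover have "\<forall>\<^sub>F n in sequentially. \<forall>k\<in>{1..Suc n}. \<bar>?p n k - ?p n (k - 1)\<bar> < \<delta>" if "\<delta> > 0" for \<delta>
  proof -
    have "(\<lambda>n. t / real (Suc n)) \<longlonglongrightarrow> 0" using tendsto_mult_right_zero[OF LIMSEQ_inverse_real_of_nat, of t] by (simp only: divide_inverse)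
    then have "\<forall>\<^sub>F n in sequentially. t / real (Suc n) < \<delta>" using that by (rule order_tendstoD)
    then show ?thesis
    proof eventually_elim
      case (elim n)
      show ?case
      proof
        fix k assume "k \<in> {1..Suc n}"
        then show "\<bar>?p n k - ?p n (k - 1)\<bar> < \<delta>"
          using elim t unfolding step[OF \<open>k \<in> {1..Suc n}\<close>] by simp
      qed
    qed
  qed
  ultimately have "partition_sequence t Suc ?p" unfolding partition_sequence_def by blast
  then show ?thesis by (rule that)
qed

text \<open>The integral is the pointwise limit of left Riemann sums along one sequence of
  partitions, and each sum involves finitely many of the measurable sections. Joint measurability in
  time and outcome is never invoked.\<close>

lemma borel_measurable_path_integral:
  fixes G :: "real \<Rightarrow> 'a \<Rightarrow> real"
  assumes t: "0 \<le> t" and meas: "\<And>s. s \<in> {0..t} \<Longrightarrow> G s \<in> borel_measurable M"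
    and cont: "\<And>\<omega>. \<omega> \<in> space M \<Longrightarrow> continuous_on {0..t} (\<lambda>s. G s \<omega>)"
  shows "(\<lambda>\<omega>. integral {0..t} (\<lambda>s. G s \<omega>)) \<in> borel_measurable M"
proof -
  obtain j p where p: "partition_sequence t j p" using uniform_partition_sequence[OF t] .
  have P: "partition_of t (j n) (p n)" for n using p by (simp add: partition_sequence_def)
  show ?thesis
  proof (rule borel_measurable_LIMSEQ_metric)
    show "(\<lambda>\<omega>. \<Sum>k=1..j n. G (p n (k - 1)) \<omega> * (p n k - p n (k - 1))) \<in> borel_measurable M" for n
      by (intro borel_measurable_sum borel_measurable_times meas partition_points[OF P] borel_measurable_const) auto
    fix \<omega> assume \<omega>: "\<omega> \<in> space M"
    let ?g = "\<lambda>s. G s \<omega>"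
    note g = cont[OF \<omega>]
    have neg: "mesh_small t (\<lambda>s t. t - s) (\<lambda>s t. ?g s * integral {s..t} (\<lambda>_. 1) - integral {s..t} (\<lambda>u. ?g u * 1))"
      using g by (intro mesh_small_integral) auto
    have tel: "(\<Sum>k=1..j n. p n k - p n (k - 1)) = t" for n
      using partition_telescope[OF P, of "\<lambda>x. x"] by simp
    have eq: "(\<Sum>k=1..j n. ?g (p n (k - 1)) * integral {p n (k - 1)..p n k} (\<lambda>_. 1) - integral {p n (k - 1)..p n k} (\<lambda>u. ?g u * 1)) =
        (\<Sum>k=1..j n. ?g (p n (k - 1)) * (p n k - p n (k - 1))) - integral {0..t} ?g" for n
    proof -
      have "(\<Sum>k=1..j n. integral {p n (k - 1)..p n k} ?g) = integral {0..t} ?g"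
        using g by (intro partition_integral[OF P] integrable_continuous_real)
      moreover have "integral {p n (k - 1)..p n k} (\<lambda>_. 1) = p n k - p n (k - 1)" if "k \<in> {1..j n}" for k
        using partition_bounds[OF P that] by simp
      ultimately show ?thesis by (simp add: sum_subtractf)
    qed
    show "(\<lambda>n. \<Sum>k=1..j n. ?g (p n (k - 1)) * (p n k - p n (k - 1))) \<longlonglongrightarrow> integral {0..t} ?g"
    proof (rule tendstoI)
      fix e :: real assume "e > 0"
      then have \<eta>: "e / (2 * (t + 1)) > 0" using t by simp
      have "e / (2 * (t + 1)) * t < e" using t \<open>e > 0\<close> by (simp add: field_simps add_nonneg_pos)
      with mesh_small_partition_sum[OF neg p order.refl \<eta>]
      show "\<forall>\<^sub>F n in sequentially. dist (\<Sum>k=1..j n. ?g (p n (k - 1)) * (p n k - p n (k - 1))) (integral {0..t} ?g) < e"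
        unfolding eq tel by (auto simp: dist_real_def elim!: eventually_mono)
    qed
  qed
qed

section \<open>Integral equations along a path\<close>

text \<open>\<open>(a + L * U s) * exp (- L * s)\<close> is nonincreasing, because the hypothesis
  makes its derivative nonpositive; \<open>\<phi>\<close> is its negative.\<close>

lemma gronwall:
  fixes u :: "real \<Rightarrow> real"
  assumes u: "continuous_on {0..T} u" and L: "0 \<le> L"
    and le: "\<And>t. t \<in> {0..T} \<Longrightarrow> u t \<le> a + L * integral {0..t} u" and t: "t \<in> {0..T}"
  shows "u t \<le> a * exp (L * t)"
proof -
  define U where "U s = integral {0..s} u" for s
  define \<phi> where "\<phi> s = - ((a + L * U s) * exp (- L * s))" for s
  have U: "(U has_real_derivative u s) (at s)" if "s \<in> {0<..<t}" for s
  proof -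
    have "(U has_real_derivative u s) (at s within {0..t})"
      unfolding U_def using t that
      by (intro integral_has_real_derivative continuous_on_subset[OF u]) auto
    then show ?thesis using that by (simp add: at_within_Icc_at)
  qed
  have Uc: "continuous_on {0..t} U"
    unfolding U_def using t
    by (intro indefinite_integral_continuous_1 integrable_continuous_real continuous_on_subset[OF u]) auto
  have "\<phi> 0 \<le> \<phi> t"
  proof (rule DERIV_nonneg_imp_increasing_open[of 0 t \<phi>])
    show "0 \<le> t" using t by simp
    fix s assume s: "0 < s" "s < t"
    have "(\<phi> has_real_derivative L * (a + L * U s - u s) * exp (- L * s)) (at s)"
      unfolding \<phi>_def using s by (auto intro!: derivative_eq_intros U simp: algebra_simps)
    moreover have "u s \<le> a + L * U s" unfolding U_def using s t by (intro le) auto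
    ultimately show "\<exists>y. (\<phi> has_real_derivative y) (at s) \<and> 0 \<le> y"
      using L by (intro exI[of _ "L * (a + L * U s - u s) * exp (- L * s)"]) auto
  qed (auto simp: \<phi>_def[abs_def] intro!: continuous_intros Uc)
  then have "(a + L * U t) * exp (- L * t) \<le> a" by (simp add: \<phi>_def U_def)
  then have "a + L * U t \<le> a * exp (L * t)"
    by (simp add: exp_minus divide_le_eq flip: divide_inverse)
  moreover have "u t \<le> a + L * U t" using le[OF t] by (simp add: U_def)
  ultimately show ?thesis by linarith
qed

section \<open>Picard iteration and truncation\<close>

primrec picard :: "(real \<Rightarrow> real \<Rightarrow> real) \<Rightarrow> real \<Rightarrow> nat \<Rightarrow> real \<Rightarrow> real" where
  "picard k y0 0 = (\<lambda>t. y0)"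
| "picard k y0 (Suc n) = (\<lambda>t. y0 + integral {0..t} (\<lambda>s. k s (picard k y0 n s)))"

lemma continuous_on_compose_strip:
  assumes "continuous_on (A \<times> UNIV) (\<lambda>(s, y). k s y)" "continuous_on S g" "continuous_on S y" "g ` S \<subseteq> A"
  shows "continuous_on S (\<lambda>s. k (g s) (y s))"
proof -
  have "(\<lambda>s. (g s, y s)) ` S \<subseteq> A \<times> UNIV" using assms(4) by auto
  from continuous_on_compose2[OF assms(1) continuous_on_Pair[OF assms(2,3)] this] show ?thesis by simp
qed

lemma continuous_on_compose_time:
  assumes "continuous_on ({0..T} \<times> UNIV) (\<lambda>(s, y). k s y)" "continuous_on S y" "S \<subseteq> {0..T}"
  shows "continuous_on S (\<lambda>s. k s (y s))"
  using assms(3) by (intro continuous_on_compose_strip[OF assms(1) continuous_on_id assms(2)]) simp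

lemma picard_continuous:
  assumes "continuous_on ({0..T} \<times> UNIV) (\<lambda>(s, y). k s y)"
  shows "continuous_on {0..T} (picard k y0 n)"
proof (induction n)
  case (Suc n)
  show ?case
    unfolding picard.simps
    by (intro continuous_intros indefinite_integral_continuous_1 integrable_continuous_real
        continuous_on_compose_time[OF assms Suc]) simp
qed simp

text \<open>Convergence of the iterates belongs to the conclusion because measurability in a
  parameter is inherited from them.\<close>

lemma picard_limit:
  assumes k: "continuous_on ({0..T} \<times> UNIV) (\<lambda>(s, y). k s y)" and "0 < T"
    and lip: "\<And>s y z. s \<in> {0..T} \<Longrightarrow> \<bar>k s y - k s z\<bar> \<le> L * \<bar>y - z\<bar>"
  shows "\<exists>y. continuous_on {0..T} y \<and> (\<forall>t\<in>{0..T}. y t = y0 + integral {0..t} (\<lambda>s. k s (y s))) \<and>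
    (\<forall>t\<in>{0..T}. (\<lambda>n. picard k y0 n t) \<longlonglongrightarrow> y t)"
proof -
  define L' where "L' = max L 1"
  have L': "L' > 0" "\<And>s y z. s \<in> {0..T} \<Longrightarrow> \<bar>k s y - k s z\<bar> \<le> L' * \<bar>y - z\<bar>"
  proof -
    fix s y z assume "s \<in> {0..T}"
    then have "\<bar>k s y - k s z\<bar> \<le> L * \<bar>y - z\<bar>" by (rule lip)
    also have "\<dots> \<le> L' * \<bar>y - z\<bar>" unfolding L'_def by (intro mult_right_mono) auto
    finally show "\<bar>k s y - k s z\<bar> \<le> L' * \<bar>y - z\<bar>" .
  qed (simp add: L'_def)
  let ?p = "picard k y0"
  have kc: "continuous_on {0..t} (\<lambda>s. k s (y s))" if "continuous_on {0..T} y" "t \<in> {0..T}" for y t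
    using that by (intro continuous_on_compose_time[OF k] continuous_on_subset[OF that(1)]) auto
  have kint: "(\<lambda>s. k s (y s)) integrable_on {0..t}" if "continuous_on {0..T} y" "t \<in> {0..T}" for y t
    by (intro integrable_continuous_real kc that)
  note pc = picard_continuous[OF k, of y0]
  have diff: "\<bar>integral {0..t} (\<lambda>s. k s (y s)) - integral {0..t} (\<lambda>s. k s (z s))\<bar> \<le> integral {0..t} b"
    if "continuous_on {0..T} y" "continuous_on {0..T} z" "t \<in> {0..T}" "b integrable_on {0..t}"
      "\<And>s. s \<in> {0..t} \<Longrightarrow> L' * \<bar>y s - z s\<bar> \<le> b s" for y z t b
  proof -
    have "integral {0..t} (\<lambda>s. k s (y s)) - integral {0..t} (\<lambda>s. k s (z s)) = integral {0..t} (\<lambda>s. k s (y s) - k s (z s))"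
      by (rule Henstock_Kurzweil_Integration.integral_diff[symmetric]) (intro kint that)+
    also have "norm \<dots> \<le> integral {0..t} b"
    proof (rule integral_norm_bound_integral)
      show "(\<lambda>s. k s (y s) - k s (z s)) integrable_on {0..t}" by (intro integrable_diff kint that)
      fix s assume s: "s \<in> {0..t}"
      then have "\<bar>k s (y s) - k s (z s)\<bar> \<le> L' * \<bar>y s - z s\<bar>" using that(3) by (intro L'(2)) auto
      then show "norm (k s (y s) - k s (z s)) \<le> b s" using that(5)[OF s] by simp
    qed (rule that(4))
    finally show ?thesis by simp
  qed
  obtain A where A: "0 \<le> A" "\<And>t. 0 \<le> t \<Longrightarrow> t \<le> T \<Longrightarrow> \<bar>?p 1 t - ?p 0 t\<bar> \<le> A"
    using path_bounded[of T "\<lambda>t. ?p 1 t - ?p 0 t"] continuous_on_diff[OF pc pc] by blast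
  \<comment> \<open>The exponential weight is chosen so that each integration halves the bound: the
    antiderivative of \<open>L' * exp (2 * L' * s)\<close> is half the exponential. This makes the
    iteration contract on all of [0,T] at once.\<close>
  have step: "\<bar>?p (Suc n) t - ?p n t\<bar> \<le> A * exp (2 * L' * t) / 2 ^ n" if "t \<in> {0..T}" for n t
    using that
  proof (induction n arbitrary: t)
    case 0
    have "A * 1 \<le> A * exp (2 * L' * t)" using A(1) L'(1) 0 by (intro mult_left_mono) auto
    then show ?case using A(2)[of t] 0 by simp
  next
    case (Suc n)
    let ?b = "\<lambda>s. L' * (A * exp (2 * L' * s) / 2 ^ n)"
    let ?B = "\<lambda>s. A * exp (2 * L' * s) / 2 ^ Suc n"
    have B: "(?b has_integral ?B t - ?B 0) {0..t}"
    proof (rule fundamental_theorem_of_calculus)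
      fix s
      have "(?B has_real_derivative ?b s) (at s)"
        by (auto intro!: derivative_eq_intros)
      then show "(?B has_vector_derivative ?b s) (at s within {0..t})"
        by (simp add: has_real_derivative_iff_has_vector_derivative[symmetric] has_field_derivative_at_within)
    qed (use Suc.prems in auto)
    have "\<bar>?p (Suc (Suc n)) t - ?p (Suc n) t\<bar> =
        \<bar>integral {0..t} (\<lambda>s. k s (?p (Suc n) s)) - integral {0..t} (\<lambda>s. k s (?p n s))\<bar>"
      by simp
    also have "\<dots> \<le> integral {0..t} ?b"
    proof (rule diff[OF pc pc Suc.prems])
      show "?b integrable_on {0..t}" using B by blast
      show "L' * \<bar>?p (Suc n) s - ?p n s\<bar> \<le> ?b s" if "s \<in> {0..t}" for s
        using that Suc.prems L'(1) by (intro mult_left_mono Suc.IH) auto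
    qed
    also have "\<dots> = ?B t - ?B 0" using B by (rule integral_unique)
    also have "\<dots> \<le> ?B t" using A(1) by simp
    finally show ?case .
  qed
  define M where "M n = A * exp (2 * L' * T) / 2 ^ n" for n
  have "summable (\<lambda>n. A * exp (2 * L' * T) * (1 / 2) ^ n)"
    by (intro summable_mult summable_geometric) simp
  then have M: "summable M" by (simp add: M_def[abs_def] power_divide)
  define D where "D n t = ?p (Suc n) t - ?p n t" for n t
  define y where "y t = y0 + (\<Sum>n. D n t)" for t
  have "uniform_limit {0..T} (\<lambda>n t. \<Sum>i<n. D i t) (\<lambda>t. \<Sum>i. D i t) sequentially"
  proof (rule Weierstrass_m_test[OF _ M])
    fix n t assume t: "t \<in> {0..T}"
    have "A * exp (2 * L' * t) / 2 ^ n \<le> M n"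
      unfolding M_def using A(1) L'(1) t by (intro divide_right_mono mult_left_mono) auto
    then show "norm (D n t) \<le> M n" using step[OF t, of n] by (simp add: D_def)
  qed
  then have "uniform_limit {0..T} (\<lambda>n t. y0 + (\<Sum>i<n. D i t)) y sequentially"
    unfolding y_def by (intro uniform_limit_intros)
  moreover have "y0 + (\<Sum>i<n. D i t) = ?p n t" for n t
    using sum_lessThan_telescope[of "\<lambda>i. ?p i t" n] by (simp add: D_def)
  ultimately have lim: "uniform_limit {0..T} ?p y sequentially" by simp
  have yc: "continuous_on {0..T} y"
    by (rule uniform_limit_theorem[OF _ lim]) (auto intro: always_eventually pc)
  have pw: "(\<lambda>n. ?p n t) \<longlonglongrightarrow> y t" if "t \<in> {0..T}" for t
    by (rule tendsto_uniform_limitI[OF lim that])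
  have eq: "y t = y0 + integral {0..t} (\<lambda>s. k s (y s))" if t: "t \<in> {0..T}" for t
  proof (rule LIMSEQ_unique)
    show "(\<lambda>n. ?p (Suc n) t) \<longlonglongrightarrow> y t" using pw[OF t] by (rule LIMSEQ_Suc)
    show "(\<lambda>n. ?p (Suc n) t) \<longlonglongrightarrow> y0 + integral {0..t} (\<lambda>s. k s (y s))"
    proof (rule tendstoI)
      fix e :: real assume e: "e > 0"
      define d where "d = e / (2 * L' * T)"
      have d: "d > 0" "L' * d * T < e" using e L'(1) \<open>0 < T\<close> by (auto simp: d_def)
      have "\<forall>\<^sub>F n in sequentially. \<forall>s\<in>{0..T}. dist (?p n s) (y s) < d"
        using lim d(1) unfolding uniform_limit_iff by blast
      then show "\<forall>\<^sub>F n in sequentially. dist (?p (Suc n) t) (y0 + integral {0..t} (\<lambda>s. k s (y s))) < e"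
      proof eventually_elim
        case (elim n)
        have "\<bar>integral {0..t} (\<lambda>s. k s (?p n s)) - integral {0..t} (\<lambda>s. k s (y s))\<bar> \<le> integral {0..t} (\<lambda>s. L' * d)"
          using elim t L'(1) by (intro diff pc yc) (auto simp: dist_real_def intro!: less_imp_le mult_left_mono)
        also have "\<dots> = L' * d * t" using t by simp
        also have "\<dots> \<le> L' * d * T" using t L'(1) d(1) by (intro mult_left_mono) auto
        also have "\<dots> < e" by (rule d)
        finally show ?case by (simp add: dist_real_def)
      qed
    qed
  qed
  show ?thesis by (intro exI[of _ y] conjI ballI yc eq pw)
qed

definition clamp_nat :: "nat \<Rightarrow> real \<Rightarrow> real" where
  "clamp_nat N y = max (- real N) (min (real N) y)"

lemma clamp_nat: "\<bar>clamp_nat N y\<bar> \<le> N" "\<bar>clamp_nat N y - clamp_nat N z\<bar> \<le> \<bar>y - z\<bar>"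
  "\<bar>clamp_nat N y\<bar> \<le> \<bar>y\<bar>" "\<bar>y\<bar> \<le> N \<Longrightarrow> clamp_nat N y = y"
  by (auto simp: clamp_nat_def max_def min_def)

lemma clamp_nat_cont [continuous_intros]:
  "continuous_on S f \<Longrightarrow> continuous_on S (\<lambda>x. clamp_nat N (f x))"
  unfolding clamp_nat_def by (intro continuous_intros)

text \<open>The right-hand side is made globally Lipschitz by truncation; iterated pointwise limits keep
  the solution measurable in a parameter.\<close>

definition integral_equation_sol :: "(real \<Rightarrow> real \<Rightarrow> real) \<Rightarrow> real \<Rightarrow> real \<Rightarrow> real" where
  "integral_equation_sol h y0 t = lim (\<lambda>N. lim (\<lambda>n. picard (\<lambda>s y. h s (clamp_nat N y)) y0 n t))"

locale integral_equation =
  fixes h :: "real \<Rightarrow> real \<Rightarrow> real" and T K :: real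
  assumes T_pos: "0 < T" and cont: "continuous_on ({0..T} \<times> UNIV) (\<lambda>(s, y). h s y)"
    and lipschitz: "\<And>C. \<exists>L. \<forall>s y z. s \<in> {0..T} \<longrightarrow> \<bar>y\<bar> \<le> C \<longrightarrow> \<bar>z\<bar> \<le> C \<longrightarrow> \<bar>h s y - h s z\<bar> \<le> L * \<bar>y - z\<bar>"
    and growth: "s \<in> {0..T} \<Longrightarrow> \<bar>h s y\<bar> \<le> K * (1 + \<bar>y\<bar>)"
begin

definition solves :: "real \<Rightarrow> (real \<Rightarrow> real) \<Rightarrow> bool" where
  "solves y0 y \<longleftrightarrow> continuous_on {0..T} y \<and> (\<forall>t\<in>{0..T}. y t = y0 + integral {0..t} (\<lambda>s. h s (y s)))"

lemma K_nonneg: "0 \<le> K"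
  using growth[of 0 0] T_pos by auto

text \<open>Two continuous solutions stay in one ball, on which a single Lipschitz constant is
  valid, and Gronwall's inequality applies to their distance.\<close>

lemma solves_unique:
  assumes y: "solves y0 y" and z: "solves y0 z" and t: "t \<in> {0..T}"
  shows "y t = z t"
proof -
  have c: "continuous_on {0..T} y" "continuous_on {0..T} z" using y z by (auto simp: solves_def)
  obtain C1 where C1: "0 \<le> C1" "\<And>t. 0 \<le> t \<Longrightarrow> t \<le> T \<Longrightarrow> \<bar>y t\<bar> \<le> C1" using path_bounded[OF c(1)] by blast
  obtain C2 where C2: "0 \<le> C2" "\<And>t. 0 \<le> t \<Longrightarrow> t \<le> T \<Longrightarrow> \<bar>z t\<bar> \<le> C2" using path_bounded[OF c(2)] by blast
  obtain L0 where L0: "\<And>s y z. s \<in> {0..T} \<Longrightarrow> \<bar>y\<bar> \<le> max C1 C2 \<Longrightarrow> \<bar>z\<bar> \<le> max C1 C2 \<Longrightarrow> \<bar>h s y - h s z\<bar> \<le> L0 * \<bar>y - z\<bar>"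
    using lipschitz by blast
  define L where "L = max L0 0"
  have L: "0 \<le> L" "\<And>s y z. s \<in> {0..T} \<Longrightarrow> \<bar>y\<bar> \<le> max C1 C2 \<Longrightarrow> \<bar>z\<bar> \<le> max C1 C2 \<Longrightarrow> \<bar>h s y - h s z\<bar> \<le> L * \<bar>y - z\<bar>"
  proof -
    fix s y z assume "s \<in> {0..T}" "\<bar>y\<bar> \<le> max C1 C2" "\<bar>z\<bar> \<le> max C1 C2"
    then have "\<bar>h s y - h s z\<bar> \<le> L0 * \<bar>y - z\<bar>" by (rule L0)
    also have "\<dots> \<le> L * \<bar>y - z\<bar>" unfolding L_def by (intro mult_right_mono) auto
    finally show "\<bar>h s y - h s z\<bar> \<le> L * \<bar>y - z\<bar>" .
  qed (simp add: L_def)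
  define u where "u s = \<bar>y s - z s\<bar>" for s
  have u: "continuous_on {0..T} u" unfolding u_def by (intro continuous_intros c)
  have "u t \<le> 0 * exp (L * t)"
  proof (rule gronwall[OF u L(1) _ t])
    fix r assume r: "r \<in> {0..T}"
    have cr: "continuous_on {0..r} (\<lambda>s. h s (y s))" "continuous_on {0..r} (\<lambda>s. h s (z s))" "continuous_on {0..r} u"
      using r by (intro continuous_on_compose_time[OF cont] continuous_on_subset[OF c(1)]
          continuous_on_subset[OF c(2)] continuous_on_subset[OF u]; auto)+
    have "y r - z r = integral {0..r} (\<lambda>s. h s (y s)) - integral {0..r} (\<lambda>s. h s (z s))"
      using y z r by (simp add: solves_def)
    also have "\<dots> = integral {0..r} (\<lambda>s. h s (y s) - h s (z s))"
      by (intro Henstock_Kurzweil_Integration.integral_diff[symmetric] integrable_continuous_real cr)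
    finally have "u r = norm \<dots>" by (simp add: u_def)
    also have "\<dots> \<le> integral {0..r} (\<lambda>s. L * u s)"
    proof (rule integral_norm_bound_integral)
      show "norm (h s (y s) - h s (z s)) \<le> L * u s" if "s \<in> {0..r}" for s
        using that r C1(2)[of s] C2(2)[of s] L(2)[of s "y s" "z s"] by (auto simp: u_def)
    qed (intro integrable_continuous_real continuous_intros cr)+
    finally show "u r \<le> 0 + L * integral {0..r} u" by simp
  qed
  then show ?thesis by (simp add: u_def)
qed

text \<open>A general integrand \<open>g\<close> stands in place of \<open>h\<close>, so that the
  bound covers every truncated equation with a constant that does not depend on the truncation
  level.\<close>

lemma growth_bound:
  assumes y: "continuous_on {0..T} y" "\<And>t. t \<in> {0..T} \<Longrightarrow> y t = y0 + integral {0..t} (\<lambda>s. g s)"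
    and g: "continuous_on {0..T} g" "\<And>s. s \<in> {0..T} \<Longrightarrow> \<bar>g s\<bar> \<le> K * (1 + \<bar>y s\<bar>)" and t: "t \<in> {0..T}"
  shows "\<bar>y t\<bar> \<le> (1 + \<bar>y0\<bar>) * exp (K * T)"
proof -
  define u where "u s = 1 + \<bar>y s\<bar>" for s
  have u: "continuous_on {0..T} u" unfolding u_def by (intro continuous_intros y)
  have "u t \<le> (1 + \<bar>y0\<bar>) * exp (K * t)"
  proof (rule gronwall[OF u K_nonneg _ t])
    fix r assume r: "r \<in> {0..T}"
    have cr: "continuous_on {0..r} g" "continuous_on {0..r} u"
      using r by (auto intro: continuous_on_subset[OF g(1)] continuous_on_subset[OF u])
    have "norm (integral {0..r} g) \<le> integral {0..r} (\<lambda>s. K * u s)"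
    proof (rule integral_norm_bound_integral)
      show "norm (g s) \<le> K * u s" if "s \<in> {0..r}" for s
        using that r g(2)[of s] by (auto simp: u_def)
    qed (intro integrable_continuous_real continuous_intros cr)+
    then have "\<bar>integral {0..r} g\<bar> \<le> K * integral {0..r} u" by simp
    then show "u r \<le> 1 + \<bar>y0\<bar> + K * integral {0..r} u"
      using y(2)[OF r] abs_triangle_ineq[of y0 "integral {0..r} g"] by (simp add: u_def[of r])
  qed
  also have "\<dots> \<le> (1 + \<bar>y0\<bar>) * exp (K * T)"
    using t K_nonneg by (intro mult_left_mono) (auto intro: mult_left_mono)
  finally show ?thesis by (simp add: u_def)
qed

lemma solves_integral_equation_sol: "solves y0 (integral_equation_sol h y0)"
proof -
  let ?k = "\<lambda>N s y. h s (clamp_nat N y)"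
  have kc: "continuous_on ({0..T} \<times> UNIV) (\<lambda>(s, y). ?k N s y)" for N
    unfolding case_prod_unfold by (intro continuous_on_compose_strip[OF cont] continuous_intros) auto
  define R where "R N y \<longleftrightarrow> continuous_on {0..T} y \<and>
      (\<forall>t\<in>{0..T}. y t = y0 + integral {0..t} (\<lambda>s. ?k N s (y s))) \<and>
      (\<forall>t\<in>{0..T}. (\<lambda>n. picard (?k N) y0 n t) \<longlonglongrightarrow> y t)" for N y
  have "\<exists>y. R N y" for N
  proof -
    obtain L0 where L0: "\<And>s y z. s \<in> {0..T} \<Longrightarrow> \<bar>y\<bar> \<le> real N \<Longrightarrow> \<bar>z\<bar> \<le> real N \<Longrightarrow> \<bar>h s y - h s z\<bar> \<le> L0 * \<bar>y - z\<bar>"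
      using lipschitz by blast
    have "\<bar>?k N s y - ?k N s z\<bar> \<le> max L0 0 * \<bar>y - z\<bar>" if "s \<in> {0..T}" for s y z
    proof -
      have "\<bar>?k N s y - ?k N s z\<bar> \<le> L0 * \<bar>clamp_nat N y - clamp_nat N z\<bar>"
        using that by (intro L0 clamp_nat)
      also have "\<dots> \<le> max L0 0 * \<bar>y - z\<bar>" by (intro mult_mono clamp_nat) auto
      finally show ?thesis .
    qed
    then show ?thesis unfolding R_def by (rule picard_limit[of T _ _ y0, OF kc T_pos])
  qed
  then obtain Y where RY: "\<And>N. R N (Y N)" using choice[of R] by blast
  have Y: "continuous_on {0..T} (Y N)"
      "t \<in> {0..T} \<Longrightarrow> Y N t = y0 + integral {0..t} (\<lambda>s. ?k N s (Y N s))"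
      "t \<in> {0..T} \<Longrightarrow> (\<lambda>n. picard (?k N) y0 n t) \<longlonglongrightarrow> Y N t" for N t
    using RY[of N] unfolding R_def by blast+
  define B where "B = (1 + \<bar>y0\<bar>) * exp (K * T)"
  have bound: "\<bar>Y N t\<bar> \<le> B" if "t \<in> {0..T}" for N t
    unfolding B_def
  proof (rule growth_bound[OF Y(1) Y(2) _ _ that])
    show "continuous_on {0..T} (\<lambda>s. ?k N s (Y N s))"
      by (intro continuous_on_compose_time[OF kc] Y) simp
    fix s assume s: "s \<in> {0..T}"
    have "\<bar>?k N s (Y N s)\<bar> \<le> K * (1 + \<bar>clamp_nat N (Y N s)\<bar>)" by (rule growth[OF s])
    also have "\<dots> \<le> K * (1 + \<bar>Y N s\<bar>)" using K_nonneg clamp_nat(3) by (intro mult_left_mono) auto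
    finally show "\<bar>?k N s (Y N s)\<bar> \<le> K * (1 + \<bar>Y N s\<bar>)" .
  qed
  obtain N0 where N0: "B \<le> real N0" using real_arch_simple by blast
  \<comment> \<open>Above the a priori bound \<open>B\<close> the truncation is inactive along the
    solution.\<close>
  have sol: "solves y0 (Y N)" if "N \<ge> N0" for N
    unfolding solves_def
  proof (intro conjI ballI Y(1))
    fix t assume t: "t \<in> {0..T}"
    have "integral {0..t} (\<lambda>s. ?k N s (Y N s)) = integral {0..t} (\<lambda>s. h s (Y N s))"
    proof (rule integral_cong)
      fix s assume "s \<in> {0..t}"
      then have "\<bar>Y N s\<bar> \<le> N" using bound[of s N] t N0 that by simp
      then show "?k N s (Y N s) = h s (Y N s)" by (simp add: clamp_nat)
    qed
    then show "Y N t = y0 + integral {0..t} (\<lambda>s. h s (Y N s))" using Y(2)[OF t, of N] by simp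
  qed
  have "integral_equation_sol h y0 t = Y N0 t" if t: "t \<in> {0..T}" for t
  proof -
    have "(\<lambda>N. lim (\<lambda>n. picard (?k N) y0 n t)) = (\<lambda>N. Y N t)"
      using Y(3)[OF t] by (auto intro: limI)
    \<comment> \<open>By uniqueness the truncated solutions coincide from \<open>N0\<close> on, so
      the outer limit is that of an eventually constant sequence.\<close>
    moreover have "(\<lambda>N. Y N t) \<longlonglongrightarrow> Y N0 t"
      using solves_unique[OF sol sol t] by (intro tendsto_eventually) (auto simp: eventually_sequentially)
    ultimately show ?thesis unfolding integral_equation_sol_def by (simp add: limI)
  qed
  note eq = this
  show ?thesis
    unfolding solves_def
  proof (intro conjI ballI)
    show "continuous_on {0..T} (integral_equation_sol h y0)"
      by (rule continuous_on_eq[OF Y(1)[of N0]]) (simp add: eq)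
    fix t assume t: "t \<in> {0..T}"
    have "integral {0..t} (\<lambda>s. h s (Y N0 s)) = integral {0..t} (\<lambda>s. h s (integral_equation_sol h y0 s))"
      using t by (intro integral_cong) (simp add: eq)
    then show "integral_equation_sol h y0 t = y0 + integral {0..t} (\<lambda>s. h s (integral_equation_sol h y0 s))"
      using sol[of N0] t by (simp add: eq solves_def)
  qed
qed

end

text \<open>Measurability passes through the iterates and both limits. The hypothesis on
  \<open>h\<close> is stated for compositions with measurable functions, the form in which an
  iterate enters the next one.\<close>

lemma borel_measurable_integral_equation_sol:
  fixes h :: "'a \<Rightarrow> real \<Rightarrow> real \<Rightarrow> real"
  assumes cont: "\<And>\<omega>. \<omega> \<in> space M \<Longrightarrow> continuous_on ({0..T} \<times> UNIV) (\<lambda>(s, y). h \<omega> s y)"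
    and meas: "\<And>s f. s \<in> {0..T} \<Longrightarrow> f \<in> borel_measurable M \<Longrightarrow> (\<lambda>\<omega>. h \<omega> s (f \<omega>)) \<in> borel_measurable M"
    and y0: "y0 \<in> borel_measurable M" and t: "t \<in> {0..T}"
  shows "(\<lambda>\<omega>. integral_equation_sol (h \<omega>) (y0 \<omega>) t) \<in> borel_measurable M"
proof -
  have kc: "continuous_on ({0..T} \<times> UNIV) (\<lambda>(s, y). h \<omega> s (clamp_nat N y))" if "\<omega> \<in> space M" for N \<omega>
    unfolding case_prod_unfold by (intro continuous_on_compose_strip[OF cont[OF that]] continuous_intros) auto
  have "(\<lambda>\<omega>. picard (\<lambda>s y. h \<omega> s (clamp_nat N y)) (y0 \<omega>) n t) \<in> borel_measurable M" if "t \<in> {0..T}" for N n t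
    using that
  proof (induction n arbitrary: t)
    case 0
    then show ?case using y0 by simp
  next
    case (Suc n)
    have "(\<lambda>\<omega>. integral {0..t} (\<lambda>s. h \<omega> s (clamp_nat N (picard (\<lambda>s y. h \<omega> s (clamp_nat N y)) (y0 \<omega>) n s)))) \<in> borel_measurable M"
    proof (rule borel_measurable_path_integral)
      show "0 \<le> t" using Suc.prems by simp
      show "(\<lambda>\<omega>. h \<omega> s (clamp_nat N (picard (\<lambda>s y. h \<omega> s (clamp_nat N y)) (y0 \<omega>) n s))) \<in> borel_measurable M"
        if "s \<in> {0..t}" for s
      proof (rule meas)
        have "(\<lambda>\<omega>. picard (\<lambda>s y. h \<omega> s (clamp_nat N y)) (y0 \<omega>) n s) \<in> borel_measurable M"
          using that Suc.prems by (intro Suc.IH) auto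
        then show "(\<lambda>\<omega>. clamp_nat N (picard (\<lambda>s y. h \<omega> s (clamp_nat N y)) (y0 \<omega>) n s)) \<in> borel_measurable M"
          unfolding clamp_nat_def by measurable
      qed (use that Suc.prems in auto)
      show "continuous_on {0..t} (\<lambda>s. h \<omega> s (clamp_nat N (picard (\<lambda>s y. h \<omega> s (clamp_nat N y)) (y0 \<omega>) n s)))"
        if "\<omega> \<in> space M" for \<omega>
        using Suc.prems
        by (intro continuous_on_compose_time[OF kc[OF that]] continuous_on_subset[OF picard_continuous[OF kc[OF that]]]) auto
    qed
    then show ?case using y0 by simp
  qed
  then show ?thesis
    unfolding integral_equation_sol_def using t by (intro borel_measurable_lim_metric) blast
qed

section \<open>Sums along partitions\<close>

abbreviation quad_incr :: "(real \<Rightarrow> real) \<Rightarrow> nat \<Rightarrow> (nat \<Rightarrow> real) \<Rightarrow> real" where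
  "quad_incr x m p \<equiv> (\<Sum>k=1..m. (x (p k) - x (p (k - 1)))\<^sup>2)"

text \<open>A sum of squares is at most the largest increment times the variation. The variation is
  bounded over partitions of [0,T] only, so a partition of a shorter interval is first
  extended.\<close>

lemma bounded_variation_quad_incr:
  assumes "bounded_variation_on_interval T x"
  obtains V where "\<And>t m p. t \<le> T \<Longrightarrow> partition_of t m p \<Longrightarrow> quad_incr x m p \<le> V\<^sup>2"
proof -
  obtain V where V: "\<And>m p. partition_of T m p \<Longrightarrow> (\<Sum>k=1..m. \<bar>x (p k) - x (p (k - 1))\<bar>) \<le> V"
    using assms unfolding bounded_variation_on_interval_def by blast
  have "quad_incr x m p \<le> V\<^sup>2" if t: "t \<le> T" and p: "partition_of t m p" for t m p
  proof -
    let ?S = "\<Sum>k=1..m. \<bar>x (p k) - x (p (k - 1))\<bar>"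
    have "?S \<le> V"
    proof (cases "t = T")
      case False
      \<comment> \<open>\<open>T\<close> is appended as one more point, which adds a single
        nonnegative term to the variation.\<close>
      define q where "q k = (if k \<le> m then p k else T)" for k
      have "partition_of T (Suc m) q"
        unfolding partition_of_def
      proof (intro conjI ballI)
        fix k assume k: "k \<in> {1..Suc m}"
        show "q (k - 1) < q k"
        proof (cases "k = Suc m")
          case True
          then show ?thesis using p t False by (simp add: q_def partition_of_def)
        next
          case False
          then show ?thesis using p k by (auto simp: q_def partition_of_def)
        qed
      qed (use p in \<open>auto simp: q_def partition_of_def\<close>)
      from V[OF this] have "(\<Sum>k=1..Suc m. \<bar>x (q k) - x (q (k - 1))\<bar>) \<le> V" .
      moreover have "(\<Sum>k=1..Suc m. \<bar>x (q k) - x (q (k - 1))\<bar>) =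
          (\<Sum>k=1..m. \<bar>x (q k) - x (q (k - 1))\<bar>) + \<bar>x (q (Suc m)) - x (q m)\<bar>"
        by simp
      moreover have "(\<Sum>k=1..m. \<bar>x (q k) - x (q (k - 1))\<bar>) = ?S"
        by (intro sum.cong) (auto simp: q_def)
      ultimately show ?thesis by linarith
    qed (use V p in simp)
    moreover have "quad_incr x m p \<le> ?S\<^sup>2"
    proof -
      have "quad_incr x m p \<le> (\<Sum>k=1..m. \<bar>x (p k) - x (p (k - 1))\<bar> * ?S)"
      proof (rule sum_mono)
        fix k assume k: "k \<in> {1..m}"
        have "\<bar>x (p k) - x (p (k - 1))\<bar> \<le> ?S"
          using k by (intro member_le_sum[of k "{1..m}" "\<lambda>k. \<bar>x (p k) - x (p (k - 1))\<bar>"]) auto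
        from mult_left_mono[OF this abs_ge_zero[of "x (p k) - x (p (k - 1))"]]
        show "(x (p k) - x (p (k - 1)))\<^sup>2 \<le> \<bar>x (p k) - x (p (k - 1))\<bar> * ?S"
          by (simp add: power2_eq_square)
      qed
      then show ?thesis by (simp add: power2_eq_square sum_distrib_right)
    qed
    moreover have "?S\<^sup>2 \<le> V\<^sup>2"
      using \<open>?S \<le> V\<close> by (intro power_mono sum_nonneg) auto
    ultimately show ?thesis by linarith
  qed
  then show ?thesis by (rule that)
qed

lemma set_lebesgue_integral_Ioc_eq_integral:
  fixes g :: "real \<Rightarrow> real"
  assumes g: "continuous_on {0..t} g"
  shows "(LBINT s:{0<..t}. g s) = integral {0..t} g"
proof -
  have "set_integrable lborel {0..t} g" by (rule borel_integrable_atLeastAtMost'[OF g])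
  then have "set_integrable lborel {0<..t} g" by (rule set_integrable_subset) auto
  then have "(LBINT s:{0<..t}. g s) = integral {0<..t} g" by (rule set_borel_integral_eq_integral)
  also have "\<dots> = integral {0..t} g"
    by (rule integral_subset_negligible) (auto intro: negligible_subset[of "{0}"])
  finally show ?thesis .
qed

lemma set_lebesgue_integral_Icc_eq_integral:
  fixes g :: "real \<Rightarrow> real"
  assumes g: "continuous_on {0..t} g"
  shows "(LBINT s:{0..t}. g s) = integral {0..t} g"
  by (rule set_borel_integral_eq_integral(2)[OF borel_integrable_atLeastAtMost'[OF g]])

text \<open>The approximating rationals are taken to the right of \<open>t\<close>, so the endpoint
  \<open>T\<close> must be in the given set itself.\<close>

lemma continuous_zero_from_rationals:
  fixes u :: "real \<Rightarrow> real"
  assumes u: "continuous_on {0..T} u" and zero: "\<And>t. t \<in> insert T (\<rat> \<inter> {0..T}) \<Longrightarrow> u t = 0" and t: "t \<in> {0..T}"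
  shows "u t = 0"
proof (rule ccontr)
  assume nz: "u t \<noteq> 0"
  then have "t \<noteq> T" using zero by blast
  then have "t < T" using t by simp
  obtain d where d: "d > 0" "\<And>s. s \<in> {0..T} \<Longrightarrow> dist s t < d \<Longrightarrow> dist (u s) (u t) < \<bar>u t\<bar>"
    using u t nz unfolding continuous_on_iff by (metis zero_less_abs_iff)
  obtain r where r: "r \<in> \<rat>" "t < r" "r < min T (t + d)"
    using Rats_dense_in_real[of t "min T (t + d)"] \<open>t < T\<close> d(1) by auto
  then have "u r = 0" using t by (intro zero) auto
  then show False using d(2)[of r] r t by (auto simp: dist_real_def)
qed

locale continuous_stochastic_measure =
  stochastic_measure_on M "restrict_space borel {0..T}" \<mu> for M :: "'w measure" and T :: real and \<mu> +
  assumes T_pos: "0 < T"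
    and paths: "\<omega> \<in> space M \<Longrightarrow> continuous_on {0..T} (\<lambda>t. mu_process \<mu> t \<omega>)"
begin

abbreviation "m \<equiv> mu_process \<mu>"

lemma interval_measurable: "u \<in> {0..T} \<Longrightarrow> v \<in> {0..T} \<Longrightarrow> {u<..v} \<in> sets (restrict_space borel {0..T})"
  by (auto simp: sets_restrict_space intro!: image_eqI[of _ _ "{u<..v}"])

lemma m_measurable: "t \<in> {0..T} \<Longrightarrow> m t \<in> borel_measurable M"
  unfolding mu_process_def using interval_measurable[of 0 t] by (intro measurable_measure) auto

lemma m_0: "AE \<omega> in M. m 0 \<omega> = 0"
  using measure_empty by (simp add: mu_process_def)

lemma measure_interval:
  assumes "u \<in> {0..T}" "v \<in> {0..T}" "u \<le> v"
  shows "AE \<omega> in M. \<mu> {u<..v} \<omega> = m v \<omega> - m u \<omega>"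
proof -
  have "{0<..u} \<union> {u<..v} = {0<..v}" using assms by auto
  then show ?thesis
    using measure_Un[of "{0<..u}" "{u<..v}"] interval_measurable[of 0 u] interval_measurable[of u v] assms
    unfolding mu_process_def by (auto elim!: eventually_mono)
qed

text \<open>The cells are half-open intervals, the squared increments of \<open>m\<close> are the
  squares of their measures, and \<open>vanishing\<close> follows from the uniform continuity of the
  paths.\<close>

lemma quad_incr_bounded:
  assumes t: "t \<in> {0..T}" and p: "partition_sequence t j p" and \<delta>: "0 < \<delta>"
  shows "\<exists>K N. \<forall>n\<ge>N. prob {\<omega> \<in> space M. quad_incr (\<lambda>s. m s \<omega>) (j n) (p n) > K} \<le> \<delta>"
proof -
  define \<I> where "\<I> = {{u<..v} |u v. u \<in> {0..T} \<and> v \<in> {0..T}}"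
  define I where "I n k = {p n (k - 1)<..p n k}" for n k
  define D where "D n = I n ` {1..j n}" for n
  have P: "partition_of t (j n) (p n)" for n using p by (simp add: partition_sequence_def)
  have pts: "p n k \<in> {0..T}" if "k \<le> j n" for n k
    using partition_points[OF P that] t by auto
  have disj: "I n k \<inter> I n l = {}" if "k \<in> {1..j n}" "l \<in> {1..j n}" "k < l" for n k l
  proof -
    have "p n k \<le> p n (l - 1)" using that by (intro partition_mono[OF P]) auto
    then show ?thesis by (auto simp: I_def)
  qed
  have ne: "I n k \<noteq> {}" if "k \<in> {1..j n}" for n k
    using partition_bounds(2)[OF P that] by (auto simp: I_def)
  have inj: "inj_on (I n) {1..j n}" for n
  proof (rule inj_onI)
    fix k l assume kl: "k \<in> {1..j n}" "l \<in> {1..j n}" "I n k = I n l"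
    then show "k = l" using disj[of k n l] disj[of l n k] ne[of k n] by (cases k l rule: linorder_cases) auto
  qed
  have ID: "I n k \<in> \<I>" if "k \<in> {1..j n}" for n k
  proof -
    have "k - 1 \<le> j n" "k \<le> j n" using that by auto
    then have "p n (k - 1) \<in> {0..T}" "p n k \<in> {0..T}" by (blast intro: pts)+
    then show ?thesis unfolding \<I>_def I_def by blast
  qed
  interpret vanishing_partitions M "restrict_space borel {0..T}" \<mu> \<I> D "{0<..t}"
  proof
    show "\<I> \<subseteq> sets (restrict_space borel {0..T})" using interval_measurable by (auto simp: \<I>_def)
    show "A \<inter> C \<in> \<I>" if AC: "A \<in> \<I>" "C \<in> \<I>" for A C
    proof -
      obtain u v where "A = {u<..v}" and uv: "u \<in> {0..T}" "v \<in> {0..T}"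
        using AC(1) unfolding \<I>_def by blast
      moreover obtain u' v' where "C = {u'<..v'}" and uv': "u' \<in> {0..T}" "v' \<in> {0..T}"
        using AC(2) unfolding \<I>_def by blast
      ultimately have "A \<inter> C = {max u u'<..min v v'}" by auto
      moreover have "max u u' \<in> {0..T}" "min v v' \<in> {0..T}" using uv uv' by (auto simp: max_def min_def)
      ultimately show ?thesis unfolding \<I>_def by blast
    qed
    show "finite (D n)" for n by (simp add: D_def)
    show "D n \<subseteq> \<I>" for n using ID by (auto simp: D_def)
    show "disjoint (D n)" for n
      unfolding disjoint_def D_def
    proof (intro ballI impI)
      fix a b assume "a \<in> I n ` {1..j n}" "b \<in> I n ` {1..j n}" "a \<noteq> b"
      then obtain k l where kl: "a = I n k" "b = I n l" "k \<in> {1..j n}" "l \<in> {1..j n}" "k \<noteq> l" by blast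
      then show "a \<inter> b = {}" using disj[of k n l] disj[of l n k] by (cases k l rule: linorder_cases) auto
    qed
    show "\<Union>(D n) = {0<..t}" for n
    proof -
      have "\<Union>(I n ` {1..k}) = {0<..p n k}" if "k \<le> j n" for k
        using that
      proof (induction k)
        case 0
        then show ?case using P[of n] by (simp add: partition_of_def)
      next
        case (Suc k)
        have "{0<..p n k} \<union> {p n k<..p n (Suc k)} = {0<..p n (Suc k)}"
          using pts[of k n] partition_mono[OF P[of n], of k "Suc k"] Suc.prems by auto
        moreover have "I n ` {1..Suc k} = insert (I n (Suc k)) (I n ` {1..k})"
          by (simp add: atLeastAtMostSuc_conv)
        ultimately show ?case using Suc by (auto simp: I_def)
      qed
      from this[of "j n"] show ?thesis using P[of n] by (simp add: D_def partition_of_def)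
    qed
    show "{0<..t} \<in> \<I>" unfolding \<I>_def using t by force
    fix C assume "C \<in> \<I>"
    then obtain u v where C: "C = {u<..v}" and uv: "u \<in> {0..T}" "v \<in> {0..T}" by (auto simp: \<I>_def)
    \<comment> \<open>The trace of a cell on \<open>C\<close> is {a<..c}. If \<open>a\<close> is not
      below \<open>c\<close>, its measure is almost surely 0; otherwise it is an increment of
      \<open>m\<close> over an interval no longer than the cell.\<close>
    define a where "a n k = max (p n (k - 1)) u" for n k
    define c where "c n k = min (p n k) v" for n k
    have AC: "I n k \<inter> C = {a n k<..c n k}" for n k by (auto simp: I_def C a_def c_def)
    have ac: "a n k \<in> {0..T}" "c n k \<in> {0..T}" if "k \<in> {1..j n}" for n k
      using pts[of k n] pts[of "k - 1" n] that uv by (auto simp: a_def c_def max_def min_def)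
    have meas: "\<mu> (I n k \<inter> C) \<in> borel_measurable M" if "k \<in> {1..j n}" for n k
      unfolding AC by (intro measurable_measure interval_measurable ac that)
    show "(\<lambda>n. prob {\<omega> \<in> space M. \<exists>A\<in>D n. 1 < \<bar>\<mu> (A \<inter> C) \<omega>\<bar>}) \<longlonglongrightarrow> 0"
    proof (rule prob_tendsto_0_if_AE_eventually_notin)
      show "{\<omega> \<in> space M. \<exists>A\<in>D n. 1 < \<bar>\<mu> (A \<inter> C) \<omega>\<bar>} \<in> events" for n
      proof (rule sets.sets_Collect_finite_Ex)
        show "{\<omega> \<in> space M. 1 < \<bar>\<mu> (A \<inter> C) \<omega>\<bar>} \<in> events" if "A \<in> D n" for A
        proof -
          have [measurable]: "\<mu> (A \<inter> C) \<in> borel_measurable M" using that meas by (auto simp: D_def)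
          show ?thesis by measurable
        qed
      qed (simp add: D_def)
      have "AE \<omega> in M. \<mu> {a n k<..c n k} \<omega> = (if a n k \<le> c n k then m (c n k) \<omega> - m (a n k) \<omega> else 0)"
        if "k \<in> {1..j n}" for n k
        using measure_interval[OF ac[OF that]] measure_empty by (cases "a n k \<le> c n k") auto
      then have "AE \<omega> in M. \<forall>k\<in>{1..j n}. \<mu> {a n k<..c n k} \<omega> = (if a n k \<le> c n k then m (c n k) \<omega> - m (a n k) \<omega> else 0)" for n
        by (intro AE_finite_allI) auto
      \<comment> \<open>The exceptional null sets of all partitions are united here, before any path
        is fixed.\<close>
      then have "AE \<omega> in M. \<forall>n. \<forall>k\<in>{1..j n}. \<mu> {a n k<..c n k} \<omega> = (if a n k \<le> c n k then m (c n k) \<omega> - m (a n k) \<omega> else 0)"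
        by (subst AE_all_countable) blast
      with AE_space show "AE \<omega> in M. \<forall>\<^sub>F n in sequentially. \<omega> \<notin> {\<omega> \<in> space M. \<exists>A\<in>D n. 1 < \<bar>\<mu> (A \<inter> C) \<omega>\<bar>}"
      proof eventually_elim
        case (elim \<omega>)
        note val = elim(2)
        obtain d where d: "d > 0" "\<And>s t. 0 \<le> s \<Longrightarrow> s < t \<Longrightarrow> t \<le> T \<Longrightarrow> t - s < d \<Longrightarrow> \<bar>m t \<omega> - m s \<omega>\<bar> \<le> 1 * 1"
          using mesh_smallE[OF vanishing_increments[OF paths[OF elim(1)]] zero_less_one] by metis
        have "\<forall>\<^sub>F n in sequentially. \<forall>k\<in>{1..j n}. \<bar>p n k - p n (k - 1)\<bar> < d"
          using p d(1) unfolding partition_sequence_def by blast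
        then show ?case
        proof eventually_elim
          case (elim n)
          have "\<bar>\<mu> {a n k<..c n k} \<omega>\<bar> \<le> 1" if k: "k \<in> {1..j n}" for k
          proof (cases "a n k < c n k")
            case True
            have "c n k - a n k \<le> p n k - p n (k - 1)" by (auto simp: a_def c_def)
            also have "\<dots> < d" using bspec[OF elim k] by simp
            finally show ?thesis
              using d(2)[of "a n k" "c n k"] ac[OF k] True
                val[rule_format, OF k] by auto
          next
            case False
            then show ?thesis
              using val[rule_format, OF k] by (cases "a n k = c n k") auto
          qed
          then show ?case by (auto simp: D_def AC not_less)
        qed
      qed
    qed
  qed
  have eq: "AE \<omega> in M. quad_incr (\<lambda>s. m s \<omega>) (j n) (p n) = (\<Sum>A\<in>D n. (\<mu> A \<omega>)\<^sup>2)" for n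
  proof -
    have "AE \<omega> in M. \<mu> (I n k) \<omega> = m (p n k) \<omega> - m (p n (k - 1)) \<omega>" if "k \<in> {1..j n}" for k
      unfolding I_def using pts[of k n] pts[of "k - 1" n] partition_bounds(2)[OF P that] that
      by (intro measure_interval) auto
    then have "AE \<omega> in M. \<forall>k\<in>{1..j n}. \<mu> (I n k) \<omega> = m (p n k) \<omega> - m (p n (k - 1)) \<omega>"
      by (intro AE_finite_allI) auto
    then show ?thesis
    proof eventually_elim
      case (elim \<omega>)
      then show ?case unfolding D_def sum.reindex[OF inj] by simp
    qed
  qed
  have Dmeas: "(\<lambda>\<omega>. \<Sum>A\<in>D n. (\<mu> A \<omega>)\<^sup>2) \<in> borel_measurable M" for n
    using ID cells by (intro borel_measurable_sum borel_measurable_power measurable_measure) (auto simp: D_def)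
  have mmeas: "(\<lambda>\<omega>. quad_incr (\<lambda>s. m s \<omega>) (j n) (p n)) \<in> borel_measurable M" for n
    by (intro borel_measurable_sum borel_measurable_power borel_measurable_diff m_measurable pts) auto
  have "prob {\<omega> \<in> space M. quad_incr (\<lambda>s. m s \<omega>) (j n) (p n) > K} = prob {\<omega> \<in> space M. (\<Sum>A\<in>D n. (\<mu> A \<omega>)\<^sup>2) > K}" for n K
    using eq[of n] Dmeas[of n, measurable] mmeas[of n, measurable]
    by (intro finite_measure_eq_AE) (auto elim!: eventually_mono)
  then show ?thesis using quadratic_sums_bounded[OF \<delta>] by simp
qed

text \<open>The bridge from pathwise error estimates to limits of symmetric sums. The constant
  \<open>C\<close> between the weights and the quadratic sums may depend on the path, since
  \<open>\<eta>\<close> is rescaled path by path.\<close>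

lemma partition_sums_tendsto:
  assumes t: "t \<in> {0..T}" and p: "partition_sequence t j p"
    and S: "\<And>n. S n \<in> borel_measurable M" and J: "J \<in> borel_measurable M"
    and AE: "AE \<omega> in M. mesh_small T (w \<omega>) (e \<omega>) \<and>
      (\<exists>C. \<forall>n. (\<Sum>k=1..j n. w \<omega> (p n (k - 1)) (p n k)) \<le> C * (1 + quad_incr (\<lambda>s. m s \<omega>) (j n) (p n))) \<and>
      (\<forall>n. S n \<omega> - J \<omega> = (\<Sum>k=1..j n. e \<omega> (p n (k - 1)) (p n k)))"
  shows "tendsto_in_prob M S J"
proof -
  let ?Q = "\<lambda>n \<omega>. quad_incr (\<lambda>s. m s \<omega>) (j n) (p n)"
  have P: "partition_of t (j n) (p n)" for n using p by (simp add: partition_sequence_def)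
  have pts: "p n k \<in> {0..T}" if "k \<le> j n" for n k
    using partition_points[OF P that] t by auto
  have "tendsto_in_prob M (\<lambda>n \<omega>. S n \<omega> - J \<omega>) (\<lambda>_. 0)"
  proof (rule tendsto_in_prob_0I)
    show "(\<lambda>\<omega>. S n \<omega> - J \<omega>) \<in> borel_measurable M" for n using S J by simp
    show "?Q n \<in> borel_measurable M" for n
      by (intro borel_measurable_sum borel_measurable_power borel_measurable_diff m_measurable pts) auto
    show "\<exists>K N. \<forall>n\<ge>N. prob {\<omega> \<in> space M. ?Q n \<omega> > K} \<le> \<delta>" if "\<delta> > 0" for \<delta>
      by (rule quad_incr_bounded[OF t p that])
    show "AE \<omega> in M. \<forall>\<eta>>0. \<forall>\<^sub>F n in sequentially. \<bar>S n \<omega> - J \<omega>\<bar> \<le> \<eta> * (1 + ?Q n \<omega>)"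
      using AE
    proof eventually_elim
      case (elim \<omega>)
      then obtain C where C: "\<And>n. (\<Sum>k=1..j n. w \<omega> (p n (k - 1)) (p n k)) \<le> C * (1 + ?Q n \<omega>)" by blast
      have neg: "mesh_small T (w \<omega>) (e \<omega>)"
        and SJ: "\<And>n. S n \<omega> - J \<omega> = (\<Sum>k=1..j n. e \<omega> (p n (k - 1)) (p n k))" using elim by blast+
      show ?case
      proof (intro allI impI)
        fix \<eta> :: real assume \<eta>: "\<eta> > 0"
        define \<theta> where "\<theta> = \<eta> / (\<bar>C\<bar> + 1)"
        have \<theta>: "\<theta> > 0" "\<theta> * \<bar>C\<bar> \<le> \<eta>" using \<eta> by (auto simp: \<theta>_def field_simps)
        from mesh_small_partition_sum[OF neg p _ \<theta>(1)] t
        have "\<forall>\<^sub>F n in sequentially. \<bar>S n \<omega> - J \<omega>\<bar> \<le> \<theta> * (\<Sum>k=1..j n. w \<omega> (p n (k - 1)) (p n k))"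
          unfolding SJ by simp
        then show "\<forall>\<^sub>F n in sequentially. \<bar>S n \<omega> - J \<omega>\<bar> \<le> \<eta> * (1 + ?Q n \<omega>)"
        proof eventually_elim
          case (elim n)
          have Q: "0 \<le> 1 + ?Q n \<omega>" by (simp add: sum_nonneg add_nonneg_nonneg)
          have "\<bar>S n \<omega> - J \<omega>\<bar> \<le> \<theta> * (C * (1 + ?Q n \<omega>))"
            using elim C[of n] \<theta>(1) by (meson mult_left_mono less_imp_le order_trans)
          also have "\<dots> \<le> \<theta> * (\<bar>C\<bar> * (1 + ?Q n \<omega>))"
            using \<theta>(1) Q by (intro mult_left_mono mult_right_mono) auto
          also have "\<dots> \<le> \<eta> * (1 + ?Q n \<omega>)"
            using \<theta>(2) Q by (simp add: mult_right_mono flip: mult.assoc)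
          finally show ?case .
        qed
      qed
    qed
  qed
  from tendsto_in_prob_add[OF this tendsto_in_prob_const[OF J]] show ?thesis by simp
qed

end

section \<open>Symmetric sums along a path\<close>

text \<open>Existence of one partial derivative and continuity of the other yield the total
  derivative, to which the chain rule along the curve (a, b) applies.\<close>

lemma DERIV_compose_partials:
  fixes f f1 f2 :: "real \<Rightarrow> real \<Rightarrow> real"
  assumes d1: "\<And>x y. ((\<lambda>u. f u y) has_real_derivative f1 x y) (at x)"
    and d2: "\<And>x y. (f x has_real_derivative f2 x y) (at y)"
    and c: "continuous_on UNIV (\<lambda>(x, y). f2 x y)"
    and a: "(a has_real_derivative a') (at r)" and b: "(b has_real_derivative b') (at r)"
  shows "((\<lambda>r. f (a r) (b r)) has_real_derivative f1 (a r) (b r) * a' + f2 (a r) (b r) * b') (at r)"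
proof -
  have "continuous_on UNIV (\<lambda>(x, y). blinfun_mult_right (f2 x y))"
    using bounded_linear.continuous_on[OF bounded_linear_blinfun_mult_right c] by (simp add: case_prod_unfold)
  then have "continuous (at (a r, b r) within UNIV \<times> UNIV) (\<lambda>(x, y). blinfun_mult_right (f2 x y))"
    by (simp add: continuous_on_eq_continuous_within)
  then have "((\<lambda>(x, y). f x y) has_derivative (\<lambda>(tx, ty). f1 (a r) (b r) * tx + blinfun_mult_right (f2 (a r) (b r)) ty))
      (at (a r, b r) within UNIV \<times> UNIV)"
    using d1[of "b r" "a r"] d2 by (intro has_derivative_partialsI) (auto simp: has_field_derivative_def)
  then have total: "((\<lambda>(x, y). f x y) has_derivative (\<lambda>(tx, ty). f1 (a r) (b r) * tx + f2 (a r) (b r) * ty)) (at (a r, b r))"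
    by simp
  have "((\<lambda>r. (a r, b r)) has_derivative (\<lambda>t. (a' * t, b' * t))) (at r)"
    using a b unfolding has_field_derivative_def by (rule has_derivative_Pair)
  from has_derivative_compose[OF this total]
  have "((\<lambda>r. f (a r) (b r)) has_derivative (\<lambda>t. f1 (a r) (b r) * (a' * t) + f2 (a r) (b r) * (b' * t))) (at r)"
    by simp
  then show ?thesis
    unfolding has_field_derivative_def by (rule has_derivative_eq_rhs) (auto simp: algebra_simps)
qed

lemma integral_increment:
  fixes v y :: "real \<Rightarrow> real"
  assumes v: "continuous_on {0..T} v" and y: "\<And>t. t \<in> {0..T} \<Longrightarrow> y t = y0 + integral {0..t} v"
  shows "continuous_on {0..T} y"
    and "0 \<le> s \<Longrightarrow> s \<le> t \<Longrightarrow> t \<le> T \<Longrightarrow> y t - y s = integral {s..t} v"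
    and "\<exists>C\<ge>0. \<forall>s t. 0 \<le> s \<longrightarrow> s \<le> t \<longrightarrow> t \<le> T \<longrightarrow> \<bar>y t - y s\<bar> \<le> C * (t - s)"
proof -
  have int: "v integrable_on {0..T}" using v by (rule integrable_continuous_real)
  have "continuous_on {0..T} (\<lambda>t. y0 + integral {0..t} v)"
    by (intro continuous_intros indefinite_integral_continuous_1 int)
  then show "continuous_on {0..T} y" by (rule continuous_on_eq) (simp add: y)
  have eq: "y t - y s = integral {s..t} v" if "0 \<le> s" "s \<le> t" "t \<le> T" for s t
  proof -
    have "integral {0..s} v + integral {s..t} v = integral {0..t} v"
      using that by (intro Henstock_Kurzweil_Integration.integral_combine integrable_on_subinterval[OF int]) auto
    then show ?thesis using y[of s] y[of t] that by simp
  qed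
  then show "0 \<le> s \<Longrightarrow> s \<le> t \<Longrightarrow> t \<le> T \<Longrightarrow> y t - y s = integral {s..t} v" .
  obtain C where C: "0 \<le> C" "\<And>t. 0 \<le> t \<Longrightarrow> t \<le> T \<Longrightarrow> \<bar>v t\<bar> \<le> C" using path_bounded[OF v] by blast
  have "\<bar>y t - y s\<bar> \<le> C * (t - s)" if st: "0 \<le> s" "s \<le> t" "t \<le> T" for s t
  proof -
    have "norm (integral (cbox s t) v) \<le> C * measure lborel (cbox s t)"
      using st C integrable_on_subinterval[OF int, of s t] by (intro integrable_bound) auto
    then show ?thesis using eq[OF st] st by simp
  qed
  then show "\<exists>C\<ge>0. \<forall>s t. 0 \<le> s \<longrightarrow> s \<le> t \<longrightarrow> t \<le> T \<longrightarrow> \<bar>y t - y s\<bar> \<le> C * (t - s)"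
    using C(1) by blast
qed

text \<open>The chain rule d\<Phi>(m, y) = g dm + \<Psi> v dt, where \<Phi> is the antiderivative of
  \<open>g\<close> in the first variable and \<Psi> its derivative in the second. Summed over a
  partition it expresses the symmetric sums against \<open>m\<close> by endpoint values and a time
  integral.\<close>

lemma symmetric_sum_m_small:
  fixes g g1 g2 :: "real \<Rightarrow> real \<Rightarrow> real" and m v y :: "real \<Rightarrow> real"
  defines "\<Phi> \<equiv> \<lambda>r x. antideriv0 (\<lambda>u. g u x) r" and "\<Psi> \<equiv> \<lambda>r x. antideriv0 (\<lambda>u. g2 u x) r"
  assumes d1: "\<And>r x. ((\<lambda>u. g u x) has_real_derivative g1 r x) (at r)"
    and d2: "\<And>r x. (g r has_real_derivative g2 r x) (at x)"
    and c: "continuous_on UNIV (\<lambda>(r, x). g r x)" "continuous_on UNIV (\<lambda>(r, x). g1 r x)"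
      "continuous_on UNIV (\<lambda>(r, x). g2 r x)"
    and m: "continuous_on {0..T} m" and v: "continuous_on {0..T} v"
    and y: "\<And>t. t \<in> {0..T} \<Longrightarrow> y t = y0 + integral {0..t} v"
  shows "mesh_small T (\<lambda>s t. (m t - m s)\<^sup>2 + (t - s))
    (\<lambda>s t. (g (m s) (y s) + g (m t) (y t)) / 2 * (m t - m s) - (\<Phi> (m t) (y t) - \<Phi> (m s) (y s)) +
      integral {s..t} (\<lambda>u. \<Psi> (m u) (y u) * v u))"
proof -
  let ?W = "\<lambda>s t. (m t - m s)\<^sup>2 + (t - s)"
  note yc = integral_increment(1)[OF v y] and y_eq = integral_increment(2)[OF v y]
  obtain C where C: "0 \<le> C" "\<And>s t. 0 \<le> s \<Longrightarrow> s \<le> t \<Longrightarrow> t \<le> T \<Longrightarrow> \<bar>y t - y s\<bar> \<le> C * (t - s)"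
    using integral_increment(3)[OF v y] by metis
  have \<Phi>1: "((\<lambda>u. \<Phi> u x) has_real_derivative g r x) (at r)" for r x
    unfolding \<Phi>_def by (intro antideriv0_has_derivative continuous_on_compose_curried[OF c(1)] continuous_intros)
  have \<Phi>2: "(\<Phi> r has_real_derivative \<Psi> r x) (at x)" for r x
    unfolding \<Phi>_def \<Psi>_def by (rule antideriv0_has_derivative_param[OF d2 c(1,3)])
  have \<Psi>c: "continuous_on UNIV (\<lambda>(r, x). \<Psi> r x)"
    unfolding \<Psi>_def by (rule continuous_on_antideriv0[OF c(3)])
  have \<Psi>p: "continuous_on {0..T} (\<lambda>u. \<Psi> (m u) (y u))"
    by (rule continuous_on_compose_curried[OF \<Psi>c m yc])
  let ?e = "\<lambda>s t. \<Phi> (m t) (y t) - \<Phi> (m s) (y s) - (g (m s) (y s) + g (m t) (y t)) / 2 * (m t - m s)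
      - \<Psi> (m s) (y s) * (y t - y s)"
  have e: "mesh_small T ?W ?e"
  proof (rule mesh_small_mono[where C=1 and D="1 + C"])
    show "mesh_small T (\<lambda>s t. (m t - m s)\<^sup>2 + \<bar>y t - y s\<bar>) ?e"
      by (rule trapezoid_semi[OF \<Phi>1 \<Phi>2 d1 d2 c(2,3) \<Psi>c m yc])
    fix s t assume st: "0 \<le> s" "s < t" "t \<le> T"
    have "0 \<le> C * (m t - m s)\<^sup>2" using C(1) by simp
    then show "(m t - m s)\<^sup>2 + \<bar>y t - y s\<bar> \<le> (1 + C) * ?W s t"
      using C(2)[of s t] st unfolding distrib_left distrib_right by simp
  qed (use C(1) in auto)
  let ?f = "\<lambda>s t. \<Psi> (m s) (y s) * integral {s..t} v - integral {s..t} (\<lambda>u. \<Psi> (m u) (y u) * v u)"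
  have f: "mesh_small T ?W ?f"
    by (rule mesh_small_mono[OF mesh_small_integral[OF \<Psi>p v], where C=1 and D=1]) auto
  show ?thesis
  proof (rule mesh_small_mono[OF mesh_small_add[OF e f], where C=1 and D=1])
    fix s t assume st: "0 \<le> s" "s < t" "t \<le> T"
    have "(g (m s) (y s) + g (m t) (y t)) / 2 * (m t - m s) - (\<Phi> (m t) (y t) - \<Phi> (m s) (y s)) +
      integral {s..t} (\<lambda>u. \<Psi> (m u) (y u) * v u) = - (?e s t + ?f s t)"
      using y_eq[of s t] st by simp
    then show "\<bar>(g (m s) (y s) + g (m t) (y t)) / 2 * (m t - m s) - (\<Phi> (m t) (y t) - \<Phi> (m s) (y s)) +
      integral {s..t} (\<lambda>u. \<Psi> (m u) (y u) * v u)\<bar> \<le> 1 * \<bar>?e s t + ?f s t\<bar>"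
      by (simp only: abs_minus_cancel mult_1 order_refl)
  qed auto
qed

context flow
begin

text \<open>The increment of \<open>x = F(m, y)\<close> is the trapezoidal term for
  \<open>\<sigma>\<close> plus \<open>F_x\<close> times the increment of \<open>y\<close>, up to a
  small \<open>?E\<close>. After multiplication by the average of \<open>z\<close>, the errors come
  from averaging a product (\<open>T2\<close>) and from freezing factors at the left endpoint
  (\<open>T3\<close>, \<open>T4\<close>).\<close>

lemma symmetric_sum_X_small:
  fixes \<psi> \<psi>1 \<psi>2 :: "real \<Rightarrow> real \<Rightarrow> real" and m v y x z \<beta> :: "real \<Rightarrow> real"
  assumes d1: "\<And>r x. ((\<lambda>u. \<psi> u x) has_real_derivative \<psi>1 r x) (at r)"
    and d2: "\<And>r x. (\<psi> r has_real_derivative \<psi>2 r x) (at x)"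
    and c: "continuous_on UNIV (\<lambda>(r, x). \<psi> r x)" "continuous_on UNIV (\<lambda>(r, x). \<psi>1 r x)"
      "continuous_on UNIV (\<lambda>(r, x). \<psi>2 r x)"
    and m: "continuous_on {0..T} m" and v: "continuous_on {0..T} v"
    and y: "\<And>t. t \<in> {0..T} \<Longrightarrow> y t = y0 + integral {0..t} v"
    and x: "\<And>s. x s = F (m s) (y s)" and z: "\<And>s. z s = \<psi> (m s) (x s)"
    and \<beta>: "\<And>s. s \<in> {0..T} \<Longrightarrow> \<beta> s = F_x (m s) (y s) * v s"
  shows "mesh_small T (\<lambda>s t. (m t - m s)\<^sup>2 + (t - s))
    (\<lambda>s t. (z s + z t) / 2 * (x t - x s) - (z s * \<sigma> (x s) + z t * \<sigma> (x t)) / 2 * (m t - m s) -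
      integral {s..t} (\<lambda>u. z u * \<beta> u))"
proof -
  let ?W = "\<lambda>s t. (m t - m s)\<^sup>2 + (t - s)"
  have W: "0 \<le> ?W s t" if "0 \<le> s" "s < t" "t \<le> T" for s t using that by simp
  note yc = integral_increment(1)[OF v y] and y_eq = integral_increment(2)[OF v y]
  obtain C where C: "0 \<le> C" "\<And>s t. 0 \<le> s \<Longrightarrow> s \<le> t \<Longrightarrow> t \<le> T \<Longrightarrow> \<bar>y t - y s\<bar> \<le> C * (t - s)"
    using integral_increment(3)[OF v y] by metis
  have xc: "continuous_on {0..T} x" unfolding x by (intro continuous_intros m yc)
  have zc: "continuous_on {0..T} z" unfolding z by (rule continuous_on_compose_curried[OF c(1) m xc])
  have Fc: "continuous_on {0..T} (\<lambda>s. F_x (m s) (y s))" by (intro continuous_intros m yc)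
  obtain Cm where Cm: "0 \<le> Cm" "\<And>t. 0 \<le> t \<Longrightarrow> t \<le> T \<Longrightarrow> \<bar>m t\<bar> \<le> Cm" using path_bounded[OF m] by blast
  obtain Cy where Cy: "0 \<le> Cy" "\<And>t. 0 \<le> t \<Longrightarrow> t \<le> T \<Longrightarrow> \<bar>y t\<bar> \<le> Cy" using path_bounded[OF yc] by blast
  obtain Cx where Cx: "0 \<le> Cx" "\<And>t. 0 \<le> t \<Longrightarrow> t \<le> T \<Longrightarrow> \<bar>x t\<bar> \<le> Cx" using path_bounded[OF xc] by blast
  obtain Cz where Cz: "0 \<le> Cz" "\<And>t. 0 \<le> t \<Longrightarrow> t \<le> T \<Longrightarrow> \<bar>z t\<bar> \<le> Cz" using path_bounded[OF zc] by blast
  obtain CF where CF: "0 \<le> CF" "\<And>t. 0 \<le> t \<Longrightarrow> t \<le> T \<Longrightarrow> \<bar>F_x (m t) (y t)\<bar> \<le> CF" using path_bounded[OF Fc] by blast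
  define R where "R = Cm + Cy + Cx"
  have R: "\<bar>m t\<bar> \<le> R" "\<bar>y t\<bar> \<le> R" "\<bar>x t\<bar> \<le> R" if "0 \<le> t" "t \<le> T" for t
    using Cm(1) Cy(1) Cx(1) Cm(2)[OF that] Cy(2)[OF that] Cx(2)[OF that] by (auto simp: R_def)
  have F1c: "continuous_on UNIV (\<lambda>(r, x). \<sigma> (F r x))"
    unfolding case_prod_unfold by (intro continuous_intros)
  obtain D1 where D1: "0 \<le> D1" "\<And>a b a' b'. \<bar>a\<bar> \<le> R \<Longrightarrow> \<bar>b\<bar> \<le> R \<Longrightarrow> \<bar>a'\<bar> \<le> R \<Longrightarrow> \<bar>b'\<bar> \<le> R \<Longrightarrow>
      \<bar>\<psi> a' b' - \<psi> a b\<bar> \<le> D1 * (\<bar>a' - a\<bar> + \<bar>b' - b\<bar>)"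
    using partials_imp_lipschitz[OF d1 d2 c(2,3), where R=R] by metis
  obtain D2 where D2: "0 \<le> D2" "\<And>a b a' b'. \<bar>a\<bar> \<le> R \<Longrightarrow> \<bar>b\<bar> \<le> R \<Longrightarrow> \<bar>a'\<bar> \<le> R \<Longrightarrow> \<bar>b'\<bar> \<le> R \<Longrightarrow>
      \<bar>F a' b' - F a b\<bar> \<le> D2 * (\<bar>a' - a\<bar> + \<bar>b' - b\<bar>)"
    using partials_imp_lipschitz[OF flow_deriv F_x_deriv F1c F_x_cont, where R=R] by metis
  define D where "D = D1 * (1 + D2) * (1 + C)"
  have D: "0 \<le> D" using D1 D2 C by (simp add: D_def)
  have z_incr: "\<bar>z t - z s\<bar> \<le> D * (\<bar>m t - m s\<bar> + (t - s))" if st: "0 \<le> s" "s < t" "t \<le> T" for s t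
  proof -
    have "\<bar>x t - x s\<bar> \<le> D2 * (\<bar>m t - m s\<bar> + \<bar>y t - y s\<bar>)"
      unfolding x using R st by (intro D2(2)) auto
    then have "\<bar>m t - m s\<bar> + \<bar>x t - x s\<bar> \<le> (1 + D2) * (\<bar>m t - m s\<bar> + \<bar>y t - y s\<bar>)"
      by (simp add: distrib_right)
    moreover have "\<bar>m t - m s\<bar> + \<bar>y t - y s\<bar> \<le> (1 + C) * (\<bar>m t - m s\<bar> + (t - s))"
    proof -
      have "0 \<le> C * \<bar>m t - m s\<bar>" "0 \<le> t - s" using C(1) st by auto
      moreover have "a + b \<le> (1 + C) * (a + d)" if "0 \<le> C * a" "0 \<le> d" "b \<le> C * d" for a b d :: real
        using that by (simp add: distrib_left distrib_right)
      ultimately show ?thesis using C(2)[OF st(1) less_imp_le[OF st(2)] st(3)] by blast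
    qed
    ultimately have "\<bar>m t - m s\<bar> + \<bar>x t - x s\<bar> \<le> (1 + D2) * ((1 + C) * (\<bar>m t - m s\<bar> + (t - s)))"
      using D2(1) by (meson mult_left_mono order_trans add_nonneg_nonneg zero_le_one)
    then have "D1 * (\<bar>m t - m s\<bar> + \<bar>x t - x s\<bar>) \<le> D * (\<bar>m t - m s\<bar> + (t - s))"
      unfolding D_def mult.assoc by (rule mult_left_mono[OF _ D1(1)])
    moreover have "\<bar>z t - z s\<bar> \<le> D1 * (\<bar>m t - m s\<bar> + \<bar>x t - x s\<bar>)"
      unfolding z using R st by (intro D1(2)) auto
    ultimately show ?thesis by linarith
  qed
  let ?E = "\<lambda>s t. x t - x s - (\<sigma> (x s) + \<sigma> (x t)) / 2 * (m t - m s) - F_x (m s) (y s) * (y t - y s)"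
  have A1c: "continuous_on UNIV (\<lambda>(r, x). \<sigma>' (F r x) * \<sigma> (F r x))"
    and A2c: "continuous_on UNIV (\<lambda>(r, x). \<sigma>' (F r x) * F_x r x)"
    unfolding case_prod_unfold by (intro continuous_intros)+
  have T1: "mesh_small T ?W (\<lambda>s t. (z s + z t) / 2 * ?E s t)"
  proof (rule mesh_small_mono[where C=Cz and D="1 + C"])
    show "mesh_small T (\<lambda>s t. (m t - m s)\<^sup>2 + \<bar>y t - y s\<bar>) ?E"
      unfolding x by (rule trapezoid_semi[OF flow_deriv F_x_deriv F_rr_deriv F_rx_deriv A1c A2c F_x_cont m yc])
    fix s t assume st: "0 \<le> s" "s < t" "t \<le> T"
    have "0 \<le> C * (m t - m s)\<^sup>2" using C(1) by simp
    then show "(m t - m s)\<^sup>2 + \<bar>y t - y s\<bar> \<le> (1 + C) * ?W s t"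
      using C(2)[of s t] st unfolding distrib_left distrib_right by simp
    have "\<bar>(z s + z t) / 2\<bar> \<le> Cz" using Cz(2)[of s] Cz(2)[of t] st by auto
    then show "\<bar>(z s + z t) / 2 * ?E s t\<bar> \<le> Cz * \<bar>?E s t\<bar>"
      unfolding abs_mult by (rule mult_right_mono) simp
  qed (use C(1) Cz(1) in auto)
  \<comment> \<open>A product of averages is the average of the products minus a quarter of the
    product of the increments of \<open>z\<close> and \<open>\<sigma> (x)\<close>. With the factor
    \<open>m t - m s\<close> this is of third order.\<close>
  have T2: "mesh_small T ?W (\<lambda>s t. (\<sigma> (x t) - \<sigma> (x s)) * ((z t - z s) * (m t - m s) / 4))"
  proof (rule mesh_small_mult_vanishing[where C="D * (1 + 2 * Cm)"])
    show "mesh_small T (\<lambda>s t. 1) (\<lambda>s t. \<sigma> (x t) - \<sigma> (x s))"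
      by (intro vanishing_increments continuous_intros xc)
    fix s t assume st: "0 \<le> s" "s < t" "t \<le> T"
    let ?d = "\<bar>m t - m s\<bar>"
    have d: "?d \<le> 2 * Cm" using Cm(2)[of s] Cm(2)[of t] st by auto
    have "\<bar>(z t - z s) * (m t - m s) / 4\<bar> \<le> \<bar>z t - z s\<bar> * ?d" by (simp add: abs_mult)
    also have "\<dots> \<le> D * (?d + (t - s)) * ?d" by (intro mult_right_mono z_incr st) simp
    also have "\<dots> = D * (?d * ?d + (t - s) * ?d)" by (simp add: algebra_simps)
    \<comment> \<open>The mixed term is absorbed into \<open>t - s\<close>, since \<open>?d\<close>
      is bounded along the path.\<close>
    also have "\<dots> \<le> D * ((1 + 2 * Cm) * (?d * ?d) + (1 + 2 * Cm) * (t - s))"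
    proof (intro mult_left_mono add_mono D)
      show "?d * ?d \<le> (1 + 2 * Cm) * (?d * ?d)" using Cm(1) by (simp add: distrib_right)
      have "(t - s) * ?d \<le> (t - s) * (1 + 2 * Cm)" using d st by (intro mult_left_mono) auto
      then show "(t - s) * ?d \<le> (1 + 2 * Cm) * (t - s)" by (simp add: mult.commute)
    qed
    also have "\<dots> = D * (1 + 2 * Cm) * ?W s t" by (simp add: power2_eq_square algebra_simps)
    finally show "\<bar>(z t - z s) * (m t - m s) / 4\<bar> \<le> D * (1 + 2 * Cm) * ?W s t" .
  qed (use D Cm(1) in auto)
  have T3: "mesh_small T ?W (\<lambda>s t. (z t - z s) * (F_x (m s) (y s) * (y t - y s) / 2))"
  proof (rule mesh_small_mult_vanishing[where C="CF * C"])
    show "mesh_small T (\<lambda>s t. 1) (\<lambda>s t. z t - z s)" by (intro vanishing_increments zc)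
    fix s t assume st: "0 \<le> s" "s < t" "t \<le> T"
    have "\<bar>F_x (m s) (y s) * (y t - y s) / 2\<bar> \<le> \<bar>F_x (m s) (y s)\<bar> * \<bar>y t - y s\<bar>" by (simp add: abs_mult)
    also have "\<dots> \<le> CF * (C * (t - s))"
      using CF(2)[of s] C(2)[of s t] CF(1) st by (intro mult_mono) auto
    also have "\<dots> \<le> CF * C * ?W s t" using C(1) CF(1) by (simp add: distrib_left)
    finally show "\<bar>F_x (m s) (y s) * (y t - y s) / 2\<bar> \<le> CF * C * ?W s t" .
  qed (use C(1) CF(1) in auto)
  let ?f = "\<lambda>s t. z s * F_x (m s) (y s) * integral {s..t} v - integral {s..t} (\<lambda>u. z u * F_x (m u) (y u) * v u)"
  have T4: "mesh_small T ?W ?f"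
    by (rule mesh_small_mono[OF mesh_small_integral[OF continuous_on_mult[OF zc Fc] v], where C=1 and D=1]) auto
  show ?thesis
  proof (rule mesh_small_mono[OF mesh_small_add[OF mesh_small_diff[OF T1 T2] mesh_small_add[OF T3 T4]], where C=1 and D=1])
    fix s t assume st: "0 \<le> s" "s < t" "t \<le> T"
    have "integral {s..t} (\<lambda>u. z u * \<beta> u) = integral {s..t} (\<lambda>u. z u * F_x (m u) (y u) * v u)"
      using st by (intro integral_cong) (simp add: \<beta>)
    then have "(z s + z t) / 2 * (x t - x s) - (z s * \<sigma> (x s) + z t * \<sigma> (x t)) / 2 * (m t - m s) -
        integral {s..t} (\<lambda>u. z u * \<beta> u) =
      (z s + z t) / 2 * ?E s t - (\<sigma> (x t) - \<sigma> (x s)) * ((z t - z s) * (m t - m s) / 4) +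
        ((z t - z s) * (F_x (m s) (y s) * (y t - y s) / 2) + ?f s t)"
      using y_eq[of s t] st by (simp add: field_simps)
    then show "\<bar>(z s + z t) / 2 * (x t - x s) - (z s * \<sigma> (x s) + z t * \<sigma> (x t)) / 2 * (m t - m s) -
        integral {s..t} (\<lambda>u. z u * \<beta> u)\<bar> \<le>
      1 * \<bar>(z s + z t) / 2 * ?E s t - (\<sigma> (x t) - \<sigma> (x s)) * ((z t - z s) * (m t - m s) / 4) +
        ((z t - z s) * (F_x (m s) (y s) * (y t - y s) / 2) + ?f s t)\<bar>" by simp
  qed auto
qed

text \<open>\<open>trapezoid_symmetric\<close> for the function F(-r, x). By
  \<open>sigma_flow\<close> its derivative in \<open>r\<close> is minus \<sigma>(x) times its
  derivative in \<open>x\<close>, so the two trapezoidal terms are exactly the symmetric sums of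
  \<open>z\<close> against \<open>x\<close> and of \<open>z * \<sigma> (x)\<close> against
  \<open>m\<close>.\<close>

lemma inverse_flow_trapezoid:
  fixes m x :: "real \<Rightarrow> real"
  assumes m: "continuous_on {0..T} m" and x: "continuous_on {0..T} x"
  defines "z \<equiv> \<lambda>s. F_x (- m s) (x s)"
  shows "mesh_small T (\<lambda>s t. (m t - m s)\<^sup>2 + (x t - x s)\<^sup>2)
    (\<lambda>s t. (z s + z t) / 2 * (x t - x s) - (z s * \<sigma> (x s) + z t * \<sigma> (x t)) / 2 * (m t - m s) -
      (F (- m t) (x t) - F (- m s) (x s)))"
proof -
  have G1: "((\<lambda>u. F (- u) x) has_real_derivative - \<sigma> (F (- r) x)) (at r)" for r x
    by (rule DERIV_mirror[THEN iffD1, OF flow_deriv])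
  have A1: "((\<lambda>u. - \<sigma> (F (- u) x)) has_real_derivative \<sigma>' (F (- r) x) * \<sigma> (F (- r) x)) (at r)" for r x
    using DERIV_minus[OF DERIV_mirror[THEN iffD1, OF F_rr_deriv[of x "- r"]]] by simp
  have A2: "((\<lambda>x. - \<sigma> (F (- r) x)) has_real_derivative - (\<sigma>' (F (- r) x) * F_x (- r) x)) (at x)" for r x
    by (rule DERIV_minus[OF F_rx_deriv])
  have B1: "((\<lambda>u. F_x (- u) x) has_real_derivative - (\<sigma>' (F (- r) x) * F_x (- r) x)) (at r)" for r x
    by (rule DERIV_mirror[THEN iffD1, OF F_x_deriv_r])
  have c: "continuous_on UNIV (\<lambda>(r, x). \<sigma>' (F (- r) x) * \<sigma> (F (- r) x))"
    "continuous_on UNIV (\<lambda>(r, x). - (\<sigma>' (F (- r) x) * F_x (- r) x))"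
    "continuous_on UNIV (\<lambda>(r, x). F_xx (- r) x)"
    unfolding case_prod_unfold by (intro continuous_intros continuous_on_compose_curried[OF F_xx_cont])+
  have "mesh_small T (\<lambda>s t. (m t - m s)\<^sup>2 + (x t - x s)\<^sup>2)
    (\<lambda>s t. F (- m t) (x t) - F (- m s) (x s) - (- \<sigma> (F (- m s) (x s)) + - \<sigma> (F (- m t) (x t))) / 2 * (m t - m s)
      - (F_x (- m s) (x s) + F_x (- m t) (x t)) / 2 * (x t - x s))"
    by (rule trapezoid_symmetric[OF G1 F_x_deriv A1 A2 B1 F_xx_deriv c m x])
  note small = this
  have "- (F (- m t) (x t) - F (- m s) (x s) - (- \<sigma> (F (- m s) (x s)) + - \<sigma> (F (- m t) (x t))) / 2 * (m t - m s)
      - (F_x (- m s) (x s) + F_x (- m t) (x t)) / 2 * (x t - x s)) =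
    (z s + z t) / 2 * (x t - x s) - (z s * \<sigma> (x s) + z t * \<sigma> (x t)) / 2 * (m t - m s) -
      (F (- m t) (x t) - F (- m s) (x s))" for s t
    by (simp add: z_def sigma_flow field_simps)
  note e = this
  from mesh_small_uminus[OF small] show ?thesis unfolding e .
qed

end

section \<open>The symmetric equation\<close>

lemma borel_measurable_compose_curried:
  fixes f :: "real \<Rightarrow> real \<Rightarrow> real"
  assumes "continuous_on UNIV (\<lambda>(x, y). f x y)" "u \<in> borel_measurable M" "v \<in> borel_measurable M"
  shows "(\<lambda>\<omega>. f (u \<omega>) (v \<omega>)) \<in> borel_measurable M"
  using borel_measurable_continuous_Pair[OF assms(2,3), of f] assms(1) by (simp only: case_prod_unfold)

locale symmetric_sde = flow \<sigma> F L + continuous_stochastic_measure M T \<mu>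
  for \<sigma> :: "real \<Rightarrow> real" and F :: "real \<Rightarrow> real \<Rightarrow> real" and L :: real
    and M :: "'w measure" and T :: real and \<mu> :: "real set \<Rightarrow> 'w \<Rightarrow> real" +
  fixes b :: "real \<Rightarrow> real \<Rightarrow> real" and K :: real and X0 :: "'w \<Rightarrow> real"
  assumes b_cont: "continuous_on (UNIV \<times> {0..T}) (\<lambda>(x, t). b x t)"
    and b_lipschitz: "\<And>C. C > 0 \<Longrightarrow> \<exists>L. \<forall>x y. \<forall>t\<in>{0..T}. \<bar>x\<bar> \<le> C \<longrightarrow> \<bar>y\<bar> \<le> C \<longrightarrow> \<bar>b x t - b y t\<bar> \<le> L * \<bar>x - y\<bar>"
    and b_growth: "\<And>x t. t \<in> {0..T} \<Longrightarrow> \<bar>b x t\<bar> \<le> K * (1 + \<bar>x\<bar>)"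
    and X0: "X0 \<in> borel_measurable M"
begin

section \<open>The random equation on a single path\<close>

lemma K_nonneg: "0 \<le> K"
  using b_growth[of 0 0] T_pos by auto

lemma b_cont_comp:
  assumes "continuous_on S g" "continuous_on S h" "h ` S \<subseteq> {0..T}"
  shows "continuous_on S (\<lambda>z. b (g z) (h z))"
proof -
  have "(\<lambda>z. (g z, h z)) ` S \<subseteq> UNIV \<times> {0..T}" using assms(3) by auto
  from continuous_on_compose2[OF b_cont continuous_on_Pair[OF assms(1,2)] this] show ?thesis by simp
qed

text \<open>The integrand of the random equation, with the derivative of the inverse flow written as
  \<open>F_x (- r)\<close>; see \<open>deriv_inv_flow\<close>.\<close>

definition rhs :: "'w \<Rightarrow> real \<Rightarrow> real \<Rightarrow> real" where
  "rhs \<omega> s y = F_x (- m s \<omega>) (F (m s \<omega>) y) * b (F (m s \<omega>) y) s"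

lemma rhs_cont:
  assumes "\<omega> \<in> space M"
  shows "continuous_on ({0..T} \<times> UNIV) (\<lambda>(s, y). rhs \<omega> s y)"
proof -
  have mc: "continuous_on ({0..T} \<times> (UNIV :: real set)) (\<lambda>z. m (fst z) \<omega>)"
    by (rule continuous_on_compose2[OF paths[OF assms] continuous_on_fst[OF continuous_on_id]]) auto
  show ?thesis
    unfolding rhs_def case_prod_unfold by (intro continuous_intros b_cont_comp mc) auto
qed

text \<open>The driving path is bounded, so for bounded \<open>y\<close> all arguments of
  \<open>F\<close>, \<open>F_x\<close> and \<open>b\<close> stay in fixed squares where these
  functions are bounded and Lipschitz; the product rule for increments does the rest.\<close>

lemma rhs_lipschitz:
  assumes "\<omega> \<in> space M"
  shows "\<exists>L. \<forall>s y z. s \<in> {0..T} \<longrightarrow> \<bar>y\<bar> \<le> C \<longrightarrow> \<bar>z\<bar> \<le> C \<longrightarrow> \<bar>rhs \<omega> s y - rhs \<omega> s z\<bar> \<le> L * \<bar>y - z\<bar>"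
proof -
  obtain Cm where Cm: "0 \<le> Cm" "\<And>t. 0 \<le> t \<Longrightarrow> t \<le> T \<Longrightarrow> \<bar>m t \<omega>\<bar> \<le> Cm"
    using path_bounded[OF paths[OF assms]] by blast
  define R where "R = max Cm C"
  obtain CB where CB: "0 \<le> CB" "\<And>r y. \<bar>r\<bar> \<le> R \<Longrightarrow> \<bar>y\<bar> \<le> R \<Longrightarrow> \<bar>F r y\<bar> \<le> CB"
    using continuous_on_bounded_square[OF flow_cont] by blast
  define R' where "R' = max Cm (CB + 1)"
  obtain CE where CE: "0 \<le> CE" "\<And>r y. \<bar>r\<bar> \<le> R' \<Longrightarrow> \<bar>y\<bar> \<le> R' \<Longrightarrow> \<bar>F_x r y\<bar> \<le> CE"
    using continuous_on_bounded_square[OF F_x_cont] by blast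
  have c: "continuous_on UNIV (\<lambda>(r, x). \<sigma>' (F r x) * F_x r x)" "continuous_on UNIV (\<lambda>(r, x). \<sigma> (F r x))"
    unfolding case_prod_unfold by (intro continuous_intros)+
  obtain D1 where D1: "0 \<le> D1" "\<And>a b a' b'. \<bar>a\<bar> \<le> R' \<Longrightarrow> \<bar>b\<bar> \<le> R' \<Longrightarrow> \<bar>a'\<bar> \<le> R' \<Longrightarrow> \<bar>b'\<bar> \<le> R' \<Longrightarrow>
      \<bar>F_x a' b' - F_x a b\<bar> \<le> D1 * (\<bar>a' - a\<bar> + \<bar>b' - b\<bar>)"
    using partials_imp_lipschitz[OF F_x_deriv_r F_xx_deriv c(1) F_xx_cont, where R=R'] by metis
  obtain D2 where D2: "0 \<le> D2" "\<And>a b a' b'. \<bar>a\<bar> \<le> R \<Longrightarrow> \<bar>b\<bar> \<le> R \<Longrightarrow> \<bar>a'\<bar> \<le> R \<Longrightarrow> \<bar>b'\<bar> \<le> R \<Longrightarrow>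
      \<bar>F a' b' - F a b\<bar> \<le> D2 * (\<bar>a' - a\<bar> + \<bar>b' - b\<bar>)"
    using partials_imp_lipschitz[OF flow_deriv F_x_deriv c(2) F_x_cont, where R=R] by metis
  \<comment> \<open>\<open>CB\<close> may be 0, while the Lipschitz condition on \<open>b\<close> is
    given for positive radii.\<close>
  have "CB + 1 > 0" using CB(1) by linarith
  from b_lipschitz[OF this] obtain Lb0 where Lb0: "\<And>x y t. t \<in> {0..T} \<Longrightarrow> \<bar>x\<bar> \<le> CB + 1 \<Longrightarrow> \<bar>y\<bar> \<le> CB + 1 \<Longrightarrow>
      \<bar>b x t - b y t\<bar> \<le> Lb0 * \<bar>x - y\<bar>" by blast
  define Lb where "Lb = max Lb0 0"
  have Lb: "0 \<le> Lb" "\<bar>b x t - b y t\<bar> \<le> Lb * \<bar>x - y\<bar>"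
    if "t \<in> {0..T}" "\<bar>x\<bar> \<le> CB" "\<bar>y\<bar> \<le> CB" for x y t
  proof -
    have "\<bar>b x t - b y t\<bar> \<le> Lb0 * \<bar>x - y\<bar>" using that by (intro Lb0) auto
    also have "\<dots> \<le> Lb * \<bar>x - y\<bar>" unfolding Lb_def by (intro mult_right_mono) auto
    finally show "\<bar>b x t - b y t\<bar> \<le> Lb * \<bar>x - y\<bar>" .
  qed (simp add: Lb_def)
  define Cb where "Cb = K * (1 + CB)"
  have Cb: "0 \<le> Cb" using K_nonneg CB(1) by (simp add: Cb_def)
  have "\<bar>rhs \<omega> s y - rhs \<omega> s z\<bar> \<le> ((D1 * Cb + CE * Lb) * D2) * \<bar>y - z\<bar>"
    if s: "s \<in> {0..T}" and y: "\<bar>y\<bar> \<le> C" and z: "\<bar>z\<bar> \<le> C" for s y z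
  proof -
    let ?r = "m s \<omega>"
    let ?y = "F ?r y" and ?z = "F ?r z"
    have r: "\<bar>?r\<bar> \<le> Cm" using Cm(2)[of s] s by simp
    have yz: "\<bar>?y\<bar> \<le> CB" "\<bar>?z\<bar> \<le> CB" using r y z by (auto intro!: CB(2) simp: R_def)
    have d: "\<bar>?y - ?z\<bar> \<le> D2 * \<bar>y - z\<bar>"
      using D2(2)[of ?r z ?r y] r y z by (auto simp: R_def)
    have 1: "\<bar>F_x (- ?r) ?y - F_x (- ?r) ?z\<bar> \<le> D1 * \<bar>?y - ?z\<bar>"
      using D1(2)[of "- ?r" ?z "- ?r" ?y] r yz by (auto simp: R'_def)
    have 2: "\<bar>b ?y s\<bar> \<le> Cb"
      using b_growth[OF s, of ?y] yz K_nonneg unfolding Cb_def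
      by (meson add_left_mono mult_left_mono order_trans)
    have 3: "\<bar>F_x (- ?r) ?z\<bar> \<le> CE" using r yz by (intro CE(2)) (auto simp: R'_def)
    have 4: "\<bar>b ?y s - b ?z s\<bar> \<le> Lb * \<bar>?y - ?z\<bar>" by (rule Lb(2)[OF s yz])
    have "rhs \<omega> s y - rhs \<omega> s z = (F_x (- ?r) ?y - F_x (- ?r) ?z) * b ?y s + F_x (- ?r) ?z * (b ?y s - b ?z s)"
      by (simp add: rhs_def algebra_simps)
    then have "\<bar>rhs \<omega> s y - rhs \<omega> s z\<bar> \<le>
        \<bar>F_x (- ?r) ?y - F_x (- ?r) ?z\<bar> * \<bar>b ?y s\<bar> + \<bar>F_x (- ?r) ?z\<bar> * \<bar>b ?y s - b ?z s\<bar>"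
      by (simp only: abs_mult[symmetric] abs_triangle_ineq)
    moreover have "\<bar>F_x (- ?r) ?y - F_x (- ?r) ?z\<bar> * \<bar>b ?y s\<bar> \<le> (D1 * \<bar>?y - ?z\<bar>) * Cb"
      by (rule mult_mono[OF 1 2]) (use D1(1) in simp_all)
    moreover have "\<bar>F_x (- ?r) ?z\<bar> * \<bar>b ?y s - b ?z s\<bar> \<le> CE * (Lb * \<bar>?y - ?z\<bar>)"
      by (rule mult_mono[OF 3 4]) (use CE(1) in simp_all)
    moreover have "(D1 * \<bar>?y - ?z\<bar>) * Cb + CE * (Lb * \<bar>?y - ?z\<bar>) = (D1 * Cb + CE * Lb) * \<bar>?y - ?z\<bar>"
      by (simp only: distrib_right mult_ac)
    moreover have "(D1 * Cb + CE * Lb) * \<bar>?y - ?z\<bar> \<le> (D1 * Cb + CE * Lb) * (D2 * \<bar>y - z\<bar>)"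
      by (rule mult_left_mono[OF d]) (simp add: D1(1) Cb CE(1) Lb_def)
    ultimately show ?thesis by (simp only: mult.assoc)
  qed
  then show ?thesis by blast
qed

text \<open>On a bounded range of times \<open>F\<close> is globally Lipschitz in the starting point
  and \<open>F_x\<close> is bounded, both by \<open>exp (L * Cm)\<close>. The linear growth of
  \<open>b\<close> therefore survives the change of variables, with a constant that depends on the
  path.\<close>

lemma rhs_growth:
  assumes "\<omega> \<in> space M"
  shows "\<exists>K'. \<forall>s\<in>{0..T}. \<forall>y. \<bar>rhs \<omega> s y\<bar> \<le> K' * (1 + \<bar>y\<bar>)"
proof -
  obtain Cm where Cm: "0 \<le> Cm" "\<And>t. 0 \<le> t \<Longrightarrow> t \<le> T \<Longrightarrow> \<bar>m t \<omega>\<bar> \<le> Cm"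
    using path_bounded[OF paths[OF assms]] by blast
  obtain C0 where C0: "0 \<le> C0" "\<And>r y. \<bar>r\<bar> \<le> Cm \<Longrightarrow> \<bar>y\<bar> \<le> Cm \<Longrightarrow> \<bar>F r y\<bar> \<le> C0"
    using continuous_on_bounded_square[OF flow_cont] by blast
  define E where "E = exp (L * Cm)"
  have E: "0 < E" by (simp add: E_def)
  have exp_le: "exp (L * \<bar>r\<bar>) \<le> E" if "\<bar>r\<bar> \<le> Cm" for r
    using that bound_nonneg by (simp add: E_def mult_left_mono)
  have "\<bar>rhs \<omega> s y\<bar> \<le> (E * K * (1 + C0 + E)) * (1 + \<bar>y\<bar>)" if s: "s \<in> {0..T}" for s y
  proof -
    let ?r = "m s \<omega>"
    have r: "\<bar>?r\<bar> \<le> Cm" using Cm(2)[of s] s by simp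
    have "\<bar>F ?r y - F ?r 0\<bar> \<le> E * \<bar>y\<bar>"
      using flow_lipschitz[of ?r y 0] mult_right_mono[OF exp_le[OF r], of "\<bar>y\<bar>"] by simp
    moreover have "\<bar>F ?r y\<bar> \<le> \<bar>F ?r y - F ?r 0\<bar> + \<bar>F ?r 0\<bar>" by linarith
    moreover have "\<bar>F ?r 0\<bar> \<le> C0" using C0(2)[of ?r 0] r Cm(1) by simp
    moreover have "0 \<le> C0 * \<bar>y\<bar>" using C0(1) by simp
    moreover have "1 + a \<le> (1 + c + e) * (1 + d)" if "a \<le> a0 + a1" "a0 \<le> e * d" "a1 \<le> c" "0 \<le> c * d" "0 \<le> d" "0 < e"
      for a a0 a1 c d e :: real
      using that by (simp add: algebra_simps)
    ultimately have F: "1 + \<bar>F ?r y\<bar> \<le> (1 + C0 + E) * (1 + \<bar>y\<bar>)"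
      using E abs_ge_zero[of y] by blast
    have "F_x (- ?r) (F ?r y) \<le> E" using F_x_bound[of "- ?r" "F ?r y"] exp_le[OF r] by simp
    then have "\<bar>rhs \<omega> s y\<bar> \<le> E * (K * (1 + \<bar>F ?r y\<bar>))"
      unfolding rhs_def abs_mult using b_growth[OF s] F_x_pos[of "- ?r" "F ?r y"] E
      by (intro mult_mono) auto
    also have "\<dots> \<le> E * (K * ((1 + C0 + E) * (1 + \<bar>y\<bar>)))"
      using F E K_nonneg by (intro mult_left_mono) auto
    finally show ?thesis by (simp add: mult.assoc)
  qed
  then show ?thesis by blast
qed

lemma integral_equation_rhs:
  assumes "\<omega> \<in> space M"
  obtains K' where "integral_equation (rhs \<omega>) T K'"
proof -
  obtain K' where "\<And>s y. s \<in> {0..T} \<Longrightarrow> \<bar>rhs \<omega> s y\<bar> \<le> K' * (1 + \<bar>y\<bar>)"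
    using rhs_growth[OF assms] by blast
  then have "integral_equation (rhs \<omega>) T K'"
    by (intro integral_equation.intro T_pos rhs_cont rhs_lipschitz assms)
  then show ?thesis by (rule that)
qed

definition solves_path :: "'w \<Rightarrow> (real \<Rightarrow> real) \<Rightarrow> bool" where
  "solves_path \<omega> y \<longleftrightarrow> continuous_on {0..T} y \<and>
    (\<forall>t\<in>{0..T}. y t = X0 \<omega> + integral {0..t} (\<lambda>s. rhs \<omega> s (y s)))"

lemma solves_path_unique:
  assumes "\<omega> \<in> space M" "solves_path \<omega> y" "solves_path \<omega> z" "t \<in> {0..T}"
  shows "y t = z t"
proof -
  obtain K' where "integral_equation (rhs \<omega>) T K'" using integral_equation_rhs[OF assms(1)] .
  then interpret integral_equation "rhs \<omega>" T K' .
  show ?thesis using solves_unique[of "X0 \<omega>" y z t] assms by (simp add: solves_path_def solves_def)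
qed

definition Y :: "real \<Rightarrow> 'w \<Rightarrow> real" where
  "Y t \<omega> = integral_equation_sol (rhs \<omega>) (X0 \<omega>) t"

lemma solves_path_Y:
  assumes "\<omega> \<in> space M"
  shows "solves_path \<omega> (\<lambda>t. Y t \<omega>)"
proof -
  obtain K' where "integral_equation (rhs \<omega>) T K'" using integral_equation_rhs[OF assms] .
  then interpret integral_equation "rhs \<omega>" T K' .
  have "(\<lambda>t. Y t \<omega>) = integral_equation_sol (rhs \<omega>) (X0 \<omega>)" by (simp add: Y_def)
  then show ?thesis using solves_integral_equation_sol[of "X0 \<omega>"] by (simp add: solves_path_def solves_def)
qed

lemma Y_measurable:
  assumes "t \<in> {0..T}"
  shows "Y t \<in> borel_measurable M"
proof -
  have r: "(\<lambda>\<omega>. rhs \<omega> s (f \<omega>)) \<in> borel_measurable M" if s: "s \<in> {0..T}" and f: "f \<in> borel_measurable M" for s f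
  proof -
    have "continuous_on UNIV (\<lambda>(r, y). F_x (- r) (F r y) * b (F r y) s)"
      unfolding case_prod_unfold using s by (intro continuous_intros b_cont_comp) auto
    from borel_measurable_compose_curried[OF this m_measurable[OF s] f] show ?thesis
      by (simp add: rhs_def)
  qed
  show ?thesis
    unfolding Y_def[abs_def]
    by (rule borel_measurable_integral_equation_sol[of M T rhs X0 t, OF rhs_cont r X0 assms])
qed

lemma deriv_inv_flow: "deriv (inv (F r)) x = F_x (- r) x"
  unfolding inv_flow by (rule DERIV_imp_deriv[OF F_x_deriv])

text \<open>On continuous paths the Lebesgue integral agrees with the gauge integral used in the
  construction, and the inverse of \<open>F 0\<close> is the identity.\<close>

lemma solves_random_equation_iff:
  "solves_random_equation M T \<mu> b F (\<lambda>r. inv (F r)) X0 Y' \<longleftrightarrow> (\<forall>\<omega>\<in>space M. solves_path \<omega> (\<lambda>t. Y' t \<omega>))"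
  unfolding solves_random_equation_def solves_path_def deriv_inv_flow rhs_def[symmetric]
proof (intro ball_cong refl conj_cong)
  fix \<omega> t assume \<omega>: "\<omega> \<in> space M" and Y': "continuous_on {0..T} (\<lambda>t. Y' t \<omega>)" and t: "t \<in> {0..T}"
  have "(LBINT s:{0..t}. rhs \<omega> s (Y' s \<omega>)) = integral {0..t} (\<lambda>s. rhs \<omega> s (Y' s \<omega>))"
    using t by (intro set_lebesgue_integral_Icc_eq_integral continuous_on_compose_time[OF rhs_cont[OF \<omega>]]
        continuous_on_subset[OF Y']) auto
  moreover have "inv (F 0) (X0 \<omega>) = X0 \<omega>" by (simp add: inv_flow flow_0)
  ultimately show "(Y' t \<omega> = inv (F 0) (X0 \<omega>) + (LBINT s:{0..t}. rhs \<omega> s (Y' s \<omega>))) =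
      (Y' t \<omega> = X0 \<omega> + integral {0..t} (\<lambda>s. rhs \<omega> s (Y' s \<omega>)))" by simp
qed

subsection \<open>Existence\<close>

definition X :: "real \<Rightarrow> 'w \<Rightarrow> real" where
  "X t \<omega> = F (m t \<omega>) (Y t \<omega>)"

lemma X_measurable: "t \<in> {0..T} \<Longrightarrow> X t \<in> borel_measurable M"
  unfolding X_def[abs_def] by (intro borel_measurable_compose_curried[OF flow_cont] m_measurable Y_measurable)

lemma Y_path:
  assumes "\<omega> \<in> space M"
  shows "continuous_on {0..T} (\<lambda>t. Y t \<omega>)" "continuous_on {0..T} (\<lambda>s. rhs \<omega> s (Y s \<omega>))"
    "\<And>t. t \<in> {0..T} \<Longrightarrow> Y t \<omega> = X0 \<omega> + integral {0..t} (\<lambda>s. rhs \<omega> s (Y s \<omega>))"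
    "continuous_on {0..T} (\<lambda>t. X t \<omega>)"
    "F_x (m s \<omega>) (Y s \<omega>) * rhs \<omega> s (Y s \<omega>) = b (X s \<omega>) s"
proof -
  show Y: "continuous_on {0..T} (\<lambda>t. Y t \<omega>)"
    and "\<And>t. t \<in> {0..T} \<Longrightarrow> Y t \<omega> = X0 \<omega> + integral {0..t} (\<lambda>s. rhs \<omega> s (Y s \<omega>))"
    using solves_path_Y[OF assms] by (simp_all only: solves_path_def)
  then show "continuous_on {0..T} (\<lambda>s. rhs \<omega> s (Y s \<omega>))"
    by (intro continuous_on_compose_time[OF rhs_cont[OF assms]]) auto
  show "continuous_on {0..T} (\<lambda>t. X t \<omega>)"
    unfolding X_def by (intro continuous_intros paths[OF assms] Y)
  show "F_x (m s \<omega>) (Y s \<omega>) * rhs \<omega> s (Y s \<omega>) = b (X s \<omega>) s"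
    using F_x_inverse[of "m s \<omega>" "Y s \<omega>"] by (simp add: rhs_def X_def mult.commute mult.left_commute)
qed

lemma Y_bounded_variation:
  assumes "\<omega> \<in> space M"
  shows "bounded_variation_on_interval T (\<lambda>t. Y t \<omega>)"
proof -
  obtain C where C: "0 \<le> C" "\<And>s t. 0 \<le> s \<Longrightarrow> s \<le> t \<Longrightarrow> t \<le> T \<Longrightarrow> \<bar>Y t \<omega> - Y s \<omega>\<bar> \<le> C * (t - s)"
    using integral_increment(3)[OF Y_path(2,3)[OF assms]] by metis
  have "(\<Sum>k=1..n. \<bar>Y (p k) \<omega> - Y (p (k - 1)) \<omega>\<bar>) \<le> C * T" if p: "partition_of T n p" for n p
  proof -
    have "(\<Sum>k=1..n. \<bar>Y (p k) \<omega> - Y (p (k - 1)) \<omega>\<bar>) \<le> (\<Sum>k=1..n. C * (p k - p (k - 1)))"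
      using partition_bounds[OF p] by (intro sum_mono C(2)) (auto intro: less_imp_le)
    also have "\<dots> = C * T"
      using partition_telescope[OF p, of "\<lambda>x. x"] by (simp add: sum_distrib_left[symmetric])
    finally show ?thesis .
  qed
  then show ?thesis unfolding bounded_variation_on_interval_def by blast
qed

lemma sum_measurable:
  fixes \<xi> \<eta> :: "real \<Rightarrow> 'w \<Rightarrow> real"
  assumes t: "t \<in> {0..T}" and p: "partition_of t n p"
    and \<xi>: "\<And>s. s \<in> {0..T} \<Longrightarrow> \<xi> s \<in> borel_measurable M" and \<eta>: "\<And>s. s \<in> {0..T} \<Longrightarrow> \<eta> s \<in> borel_measurable M"
  shows "(\<lambda>\<omega>. \<Sum>k=1..n. (\<xi> (p (k - 1)) \<omega> + \<xi> (p k) \<omega>) / 2 * (\<eta> (p k) \<omega> - \<eta> (p (k - 1)) \<omega>)) \<in> borel_measurable M"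
proof (rule borel_measurable_sum)
  fix k assume "k \<in> {1..n}"
  then have "k \<le> n" "k - 1 \<le> n" by auto
  then have "p k \<in> {0..T}" "p (k - 1) \<in> {0..T}"
    using partition_points[OF p] t by (metis atLeastAtMost_iff order_trans)+
  then have [measurable]: "\<xi> (p k) \<in> borel_measurable M" "\<xi> (p (k - 1)) \<in> borel_measurable M"
    "\<eta> (p k) \<in> borel_measurable M" "\<eta> (p (k - 1)) \<in> borel_measurable M"
    using \<xi> \<eta> by blast+
  show "(\<lambda>\<omega>. (\<xi> (p (k - 1)) \<omega> + \<xi> (p k) \<omega>) / 2 * (\<eta> (p k) \<omega> - \<eta> (p (k - 1)) \<omega>)) \<in> borel_measurable M"
    by measurable
qed

lemma time_weight_bound:
  assumes t: "t \<in> {0..T}" and p: "partition_of t n p"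
  shows "(\<Sum>k=1..n. (m (p k) \<omega> - m (p (k - 1)) \<omega>)\<^sup>2 + (p k - p (k - 1))) \<le> (1 + t) * (1 + quad_incr (\<lambda>s. m s \<omega>) n p)"
proof -
  have "(\<Sum>k=1..n. (m (p k) \<omega> - m (p (k - 1)) \<omega>)\<^sup>2 + (p k - p (k - 1))) = quad_incr (\<lambda>s. m s \<omega>) n p + t"
    using partition_telescope[OF p, of "\<lambda>x. x"] by (simp add: sum.distrib)
  moreover have "0 \<le> quad_incr (\<lambda>s. m s \<omega>) n p" by (simp add: sum_nonneg)
  moreover have "a + t \<le> (1 + t) * (1 + a)" if "0 \<le> a" for a :: real
    using t that by (simp add: algebra_simps)
  ultimately show ?thesis by simp
qed

text \<open>With X = F(\<mu>, Y) the integrand against \<mu> is a function \<open>g\<close> of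
  (\<mu>, Y), and Y is differentiable in time, so its integral has an explicit form. The integral
  against X is reached through the difference of the two symmetric sums, whose limit is the drift
  integral.\<close>

lemma X_integrals:
  assumes \<psi>: "C_kl 1 1 \<psi>" and t: "t \<in> {0..T}"
  defines "Z \<equiv> \<lambda>s \<omega>. \<psi> (m s \<omega>) (X s \<omega>)"
  shows "\<exists>I J. has_symmetric_integral M Z X t I \<and>
    has_symmetric_integral M (\<lambda>s \<omega>. Z s \<omega> * \<sigma> (X s \<omega>)) m t J \<and>
    (AE \<omega> in M. I \<omega> = J \<omega> + (LBINT s:{0<..t}. Z s \<omega> * b (X s \<omega>) s))"
proof -
  obtain \<psi>1 \<psi>2 where \<psi>d: "\<And>x y. ((\<lambda>u. \<psi> u y) has_real_derivative \<psi>1 x y) (at x)"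
    "\<And>x y. (\<psi> x has_real_derivative \<psi>2 x y) (at y)"
    and \<psi>c: "continuous_on UNIV (\<lambda>(x, y). \<psi> x y)" "continuous_on UNIV (\<lambda>(x, y). \<psi>1 x y)"
    "continuous_on UNIV (\<lambda>(x, y). \<psi>2 x y)"
    by (rule C_kl_1_1E[OF \<psi>]) auto
  define g where "g r y = \<psi> r (F r y) * \<sigma> (F r y)" for r y
  define g1 where "g1 r y = (\<psi>1 r (F r y) * 1 + \<psi>2 r (F r y) * \<sigma> (F r y)) * \<sigma> (F r y) + (\<sigma>' (F r y) * \<sigma> (F r y)) * \<psi> r (F r y)" for r y
  define g2 where "g2 r y = (\<psi>2 r (F r y) * F_x r y) * \<sigma> (F r y) + (\<sigma>' (F r y) * F_x r y) * \<psi> r (F r y)" for r y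
  have gd1: "((\<lambda>u. g u y) has_real_derivative g1 r y) (at r)" for r y
    unfolding g_def g1_def
    by (rule DERIV_mult[OF DERIV_compose_partials[OF \<psi>d \<psi>c(3) DERIV_ident flow_deriv] F_rr_deriv])
  have gd2: "(g r has_real_derivative g2 r y) (at y)" for r y
    unfolding g_def g2_def by (rule DERIV_mult[OF DERIV_chain2[OF \<psi>d(2) F_x_deriv] F_rx_deriv])
  have gc: "continuous_on UNIV (\<lambda>(r, y). g r y)" "continuous_on UNIV (\<lambda>(r, y). g1 r y)" "continuous_on UNIV (\<lambda>(r, y). g2 r y)"
    unfolding g_def g1_def g2_def case_prod_unfold
    by (intro continuous_intros continuous_on_compose_curried[OF \<psi>c(1)] continuous_on_compose_curried[OF \<psi>c(2)]
        continuous_on_compose_curried[OF \<psi>c(3)])+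
  define \<Phi> where "\<Phi> r x = antideriv0 (\<lambda>u. g u x) r" for r x
  define \<Psi> where "\<Psi> r x = antideriv0 (\<lambda>u. g2 u x) r" for r x
  have \<Phi>c: "continuous_on UNIV (\<lambda>(r, x). \<Phi> r x)" and \<Psi>c: "continuous_on UNIV (\<lambda>(r, x). \<Psi> r x)"
    unfolding \<Phi>_def \<Psi>_def by (rule continuous_on_antideriv0 gc)+
  let ?v = "\<lambda>s \<omega>. rhs \<omega> s (Y s \<omega>)"
  \<comment> \<open>The value predicted by the chain rule for \<open>\<Phi>\<close>. The term at
    time 0 is kept because \<open>m 0\<close> vanishes only almost surely, while the sums are
    telescoped on every path. With \<open>I\<close> defined next, the identity between the integrals
    holds by construction and only the convergence remains.\<close>
  define J where "J \<omega> = \<Phi> (m t \<omega>) (Y t \<omega>) - \<Phi> (m 0 \<omega>) (Y 0 \<omega>) - integral {0..t} (\<lambda>s. \<Psi> (m s \<omega>) (Y s \<omega>) * ?v s \<omega>)" for \<omega>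
  define I where "I \<omega> = J \<omega> + integral {0..t} (\<lambda>s. Z s \<omega> * b (X s \<omega>) s)" for \<omega>
  have Zmeas: "Z s \<in> borel_measurable M" if "s \<in> {0..T}" for s
    unfolding Z_def using that by (intro borel_measurable_compose_curried[OF \<psi>c(1)] m_measurable X_measurable)
  have \<sigma>meas: "(\<lambda>\<omega>. \<sigma> (X s \<omega>)) \<in> borel_measurable M" if "s \<in> {0..T}" for s
    using sigma_cont(1) X_measurable[OF that] by (rule borel_measurable_continuous_on)
  have vmeas: "?v s \<in> borel_measurable M" if s: "s \<in> {0..T}" for s
  proof -
    have "continuous_on UNIV (\<lambda>(r, y). F_x (- r) (F r y) * b (F r y) s)"
      unfolding case_prod_unfold using s by (intro continuous_intros b_cont_comp) auto
    from borel_measurable_compose_curried[OF this m_measurable[OF s] Y_measurable[OF s]] show ?thesis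
      by (simp add: rhs_def)
  qed
  have bmeas: "(\<lambda>\<omega>. b (X s \<omega>) s) \<in> borel_measurable M" if s: "s \<in> {0..T}" for s
  proof -
    have "continuous_on UNIV (\<lambda>x. b x s)" using s by (intro b_cont_comp continuous_intros) auto
    then show ?thesis using X_measurable[OF s] by (rule borel_measurable_continuous_on)
  qed
  have Zc: "continuous_on {0..T} (\<lambda>s. Z s \<omega>)" if "\<omega> \<in> space M" for \<omega>
    unfolding Z_def by (intro continuous_on_compose_curried[OF \<psi>c(1)] paths Y_path that)
  have bc: "continuous_on {0..T} (\<lambda>s. b (X s \<omega>) s)" if "\<omega> \<in> space M" for \<omega>
    using Y_path(4)[OF that] by (intro b_cont_comp continuous_on_id) auto
  have \<Psi>p: "continuous_on {0..T} (\<lambda>s. \<Psi> (m s \<omega>) (Y s \<omega>) * ?v s \<omega>)" if "\<omega> \<in> space M" for \<omega>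
    by (intro continuous_on_mult continuous_on_compose_curried[OF \<Psi>c] paths Y_path that)
  have J: "J \<in> borel_measurable M"
  proof -
    have "0 \<in> {0..T}" using T_pos by simp
    then have [measurable]: "(\<lambda>\<omega>. \<Phi> (m t \<omega>) (Y t \<omega>)) \<in> borel_measurable M" "(\<lambda>\<omega>. \<Phi> (m 0 \<omega>) (Y 0 \<omega>)) \<in> borel_measurable M"
      using t by (intro borel_measurable_compose_curried[OF \<Phi>c] m_measurable Y_measurable; simp)+
    have [measurable]: "(\<lambda>\<omega>. integral {0..t} (\<lambda>s. \<Psi> (m s \<omega>) (Y s \<omega>) * ?v s \<omega>)) \<in> borel_measurable M"
    proof (rule borel_measurable_path_integral)
      show "(\<lambda>\<omega>. \<Psi> (m s \<omega>) (Y s \<omega>) * ?v s \<omega>) \<in> borel_measurable M" if "s \<in> {0..t}" for s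
        using that t
        by (intro borel_measurable_times borel_measurable_compose_curried[OF \<Psi>c] m_measurable Y_measurable vmeas) auto
      show "continuous_on {0..t} (\<lambda>s. \<Psi> (m s \<omega>) (Y s \<omega>) * ?v s \<omega>)" if "\<omega> \<in> space M" for \<omega>
        by (rule continuous_on_subset[OF \<Psi>p[OF that]]) (use t in auto)
    qed (use t in simp)
    show ?thesis unfolding J_def[abs_def] by measurable
  qed
  have I: "I \<in> borel_measurable M"
  proof -
    have [measurable]: "(\<lambda>\<omega>. integral {0..t} (\<lambda>s. Z s \<omega> * b (X s \<omega>) s)) \<in> borel_measurable M"
    proof (rule borel_measurable_path_integral)
      show "(\<lambda>\<omega>. Z s \<omega> * b (X s \<omega>) s) \<in> borel_measurable M" if "s \<in> {0..t}" for s
        using that t by (intro borel_measurable_times Zmeas bmeas) auto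
      show "continuous_on {0..t} (\<lambda>s. Z s \<omega> * b (X s \<omega>) s)" if "\<omega> \<in> space M" for \<omega>
        by (rule continuous_on_subset[OF continuous_on_mult[OF Zc[OF that] bc[OF that]]]) (use t in auto)
    qed (use t in simp)
    show ?thesis unfolding I_def[abs_def] using J by measurable
  qed
  have intJ: "tendsto_in_prob M (\<lambda>n \<omega>. \<Sum>k=1..j n. (Z (p n (k - 1)) \<omega> * \<sigma> (X (p n (k - 1)) \<omega>) + Z (p n k) \<omega> * \<sigma> (X (p n k) \<omega>)) / 2
      * (m (p n k) \<omega> - m (p n (k - 1)) \<omega>)) J"
    and intI: "tendsto_in_prob M (\<lambda>n \<omega>. \<Sum>k=1..j n. (Z (p n (k - 1)) \<omega> + Z (p n k) \<omega>) / 2 * (X (p n k) \<omega> - X (p n (k - 1)) \<omega>)) I"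
    if p: "partition_sequence t j p" for j p
  proof -
    have P: "partition_of t (j n) (p n)" for n using p by (simp add: partition_sequence_def)
    have tint: "{0..t} \<subseteq> {0..T}" using t by auto
    define SJ where "SJ n \<omega> = (\<Sum>k=1..j n. (Z (p n (k - 1)) \<omega> * \<sigma> (X (p n (k - 1)) \<omega>) + Z (p n k) \<omega> * \<sigma> (X (p n k) \<omega>)) / 2
      * (m (p n k) \<omega> - m (p n (k - 1)) \<omega>))" for n \<omega>
    define SI where "SI n \<omega> = (\<Sum>k=1..j n. (Z (p n (k - 1)) \<omega> + Z (p n k) \<omega>) / 2 * (X (p n k) \<omega> - X (p n (k - 1)) \<omega>))" for n \<omega>
    have SJm: "SJ n \<in> borel_measurable M" for n
      unfolding SJ_def[abs_def]
      by (rule sum_measurable[OF t P, of "\<lambda>s \<omega>. Z s \<omega> * \<sigma> (X s \<omega>)" m]) (intro borel_measurable_times Zmeas \<sigma>meas m_measurable; assumption)+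
    have SIm: "SI n \<in> borel_measurable M" for n
      unfolding SI_def[abs_def] by (rule sum_measurable[OF t P Zmeas X_measurable])
    define eJ where "eJ \<omega> s t = (g (m s \<omega>) (Y s \<omega>) + g (m t \<omega>) (Y t \<omega>)) / 2 * (m t \<omega> - m s \<omega>) -
      (\<Phi> (m t \<omega>) (Y t \<omega>) - \<Phi> (m s \<omega>) (Y s \<omega>)) + integral {s..t} (\<lambda>u. \<Psi> (m u \<omega>) (Y u \<omega>) * ?v u \<omega>)" for \<omega> s t
    define eX where "eX \<omega> s t = (Z s \<omega> + Z t \<omega>) / 2 * (X t \<omega> - X s \<omega>) -
      (Z s \<omega> * \<sigma> (X s \<omega>) + Z t \<omega> * \<sigma> (X t \<omega>)) / 2 * (m t \<omega> - m s \<omega>) -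
      integral {s..t} (\<lambda>u. Z u \<omega> * b (X u \<omega>) u)" for \<omega> s t
    define W where "W \<omega> s t = (m t \<omega> - m s \<omega>)\<^sup>2 + (t - s)" for \<omega> and s t :: real
    have eJ: "mesh_small T (W \<omega>) (eJ \<omega>)" and eX: "mesh_small T (W \<omega>) (eX \<omega>)" if \<omega>: "\<omega> \<in> space M" for \<omega>
    proof -
      show "mesh_small T (W \<omega>) (eJ \<omega>)"
        unfolding W_def eJ_def \<Phi>_def \<Psi>_def
        by (rule symmetric_sum_m_small[OF gd1 gd2 gc paths[OF \<omega>] Y_path(2,3)[OF \<omega>]])
      show "mesh_small T (W \<omega>) (eX \<omega>)"
        unfolding W_def eX_def Z_def
        by (rule symmetric_sum_X_small[OF \<psi>d \<psi>c paths[OF \<omega>] Y_path(2,3)[OF \<omega>] X_def refl Y_path(5)[OF \<omega>, symmetric]])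
    qed
    have W: "\<exists>C. \<forall>n. (\<Sum>k=1..j n. W \<omega> (p n (k - 1)) (p n k)) \<le> C * (1 + quad_incr (\<lambda>s. m s \<omega>) (j n) (p n))" for \<omega>
      unfolding W_def using time_weight_bound[OF t P] by blast
    have sumJ: "SJ n \<omega> - J \<omega> = (\<Sum>k=1..j n. eJ \<omega> (p n (k - 1)) (p n k))" if \<omega>: "\<omega> \<in> space M" for n \<omega>
    proof -
      have "(\<Sum>k=1..j n. integral {p n (k - 1)..p n k} (\<lambda>u. \<Psi> (m u \<omega>) (Y u \<omega>) * ?v u \<omega>)) =
          integral {0..t} (\<lambda>u. \<Psi> (m u \<omega>) (Y u \<omega>) * ?v u \<omega>)"
        by (intro partition_integral[OF P] integrable_continuous_real continuous_on_subset[OF \<Psi>p[OF \<omega>] tint])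
      then show ?thesis
        using partition_telescope[OF P[of n], of "\<lambda>s. \<Phi> (m s \<omega>) (Y s \<omega>)"]
        unfolding SJ_def J_def eJ_def sum.distrib sum_subtractf by (simp add: g_def Z_def X_def)
    qed
    have sumX: "(SI n \<omega> - SJ n \<omega>) - (I \<omega> - J \<omega>) = (\<Sum>k=1..j n. eX \<omega> (p n (k - 1)) (p n k))" if \<omega>: "\<omega> \<in> space M" for n \<omega>
    proof -
      have "(\<Sum>k=1..j n. integral {p n (k - 1)..p n k} (\<lambda>u. Z u \<omega> * b (X u \<omega>) u)) = integral {0..t} (\<lambda>u. Z u \<omega> * b (X u \<omega>) u)"
        by (intro partition_integral[OF P] integrable_continuous_real
            continuous_on_subset[OF continuous_on_mult[OF Zc[OF \<omega>] bc[OF \<omega>]] tint])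
      then show ?thesis
        unfolding SI_def SJ_def I_def eX_def sum.distrib sum_subtractf by simp
    qed
    have TJ: "tendsto_in_prob M SJ J"
    proof (rule partition_sums_tendsto[OF t p SJm J, where w=W and e=eJ])
      show "AE \<omega> in M. mesh_small T (W \<omega>) (eJ \<omega>) \<and>
          (\<exists>C. \<forall>n. (\<Sum>k=1..j n. W \<omega> (p n (k - 1)) (p n k)) \<le> C * (1 + quad_incr (\<lambda>s. m s \<omega>) (j n) (p n))) \<and>
          (\<forall>n. SJ n \<omega> - J \<omega> = (\<Sum>k=1..j n. eJ \<omega> (p n (k - 1)) (p n k)))"
        by (rule AE_I2) (intro conjI allI eJ W sumJ; assumption)
    qed
    have "tendsto_in_prob M (\<lambda>n \<omega>. SI n \<omega> - SJ n \<omega>) (\<lambda>\<omega>. I \<omega> - J \<omega>)"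
    proof (rule partition_sums_tendsto[OF t p, where w=W and e=eX])
      show "(\<lambda>\<omega>. SI n \<omega> - SJ n \<omega>) \<in> borel_measurable M" for n using SIm SJm by (intro borel_measurable_diff)
      show "(\<lambda>\<omega>. I \<omega> - J \<omega>) \<in> borel_measurable M" using I J by (intro borel_measurable_diff)
      show "AE \<omega> in M. mesh_small T (W \<omega>) (eX \<omega>) \<and>
          (\<exists>C. \<forall>n. (\<Sum>k=1..j n. W \<omega> (p n (k - 1)) (p n k)) \<le> C * (1 + quad_incr (\<lambda>s. m s \<omega>) (j n) (p n))) \<and>
          (\<forall>n. (SI n \<omega> - SJ n \<omega>) - (I \<omega> - J \<omega>) = (\<Sum>k=1..j n. eX \<omega> (p n (k - 1)) (p n k)))"
        by (rule AE_I2) (intro conjI allI eX W sumX; assumption)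
    qed
    from tendsto_in_prob_add[OF this TJ] have "tendsto_in_prob M SI I" by simp
    then show "tendsto_in_prob M (\<lambda>n \<omega>. \<Sum>k=1..j n. (Z (p n (k - 1)) \<omega> + Z (p n k) \<omega>) / 2 * (X (p n k) \<omega> - X (p n (k - 1)) \<omega>)) I"
      unfolding SI_def[abs_def] .
    show "tendsto_in_prob M (\<lambda>n \<omega>. \<Sum>k=1..j n. (Z (p n (k - 1)) \<omega> * \<sigma> (X (p n (k - 1)) \<omega>) + Z (p n k) \<omega> * \<sigma> (X (p n k) \<omega>)) / 2
      * (m (p n k) \<omega> - m (p n (k - 1)) \<omega>)) J"
      using TJ unfolding SJ_def[abs_def] .
  qed
  have "AE \<omega> in M. I \<omega> = J \<omega> + (LBINT s:{0<..t}. Z s \<omega> * b (X s \<omega>) s)"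
  proof (rule AE_I2)
    fix \<omega> assume \<omega>: "\<omega> \<in> space M"
    have "continuous_on {0..t} (\<lambda>s. Z s \<omega> * b (X s \<omega>) s)"
      by (rule continuous_on_subset[OF continuous_on_mult[OF Zc[OF \<omega>] bc[OF \<omega>]]]) (use t in auto)
    then show "I \<omega> = J \<omega> + (LBINT s:{0<..t}. Z s \<omega> * b (X s \<omega>) s)"
      by (simp add: I_def set_lebesgue_integral_Ioc_eq_integral)
  qed
  then show ?thesis
    unfolding has_symmetric_integral_def using intI intJ by blast
qed

lemma is_solution_X: "is_solution M T \<mu> \<sigma> b X"
  unfolding is_solution_def Let_def
proof (intro conjI allI impI ballI)
  show "random_process M T X" unfolding random_process_def using X_measurable by blast
  show "\<exists>f Y. C_kl 2 1 f \<and> random_process M T Y \<and>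
      (\<forall>\<omega>\<in>space M. continuous_on {0..T} (\<lambda>t. Y t \<omega>) \<and> bounded_variation_on_interval T (\<lambda>t. Y t \<omega>)) \<and>
      (AE \<omega> in M. \<forall>t\<in>{0..T}. X t \<omega> = f (m t \<omega>) (Y t \<omega>))"
    using C_kl_flow Y_measurable Y_path(1) Y_bounded_variation
    by (intro exI[of _ F] exI[of _ Y]) (auto simp: random_process_def X_def)
qed (rule X_integrals)

subsection \<open>Uniqueness\<close>

text \<open>The limit of the difference of the two symmetric sums is computed twice: as the drift
  integral, since X' is a solution, and as an increment of \<open>U\<close>, the inverse flow
  applied to X', by the trapezoidal rule. Thus \<open>U\<close> solves the random equation, and X'
  is recovered by the flow.\<close>

lemma solution_unique:
  assumes sol: "is_solution M T \<mu> \<sigma> b X'" and init: "AE \<omega> in M. X' 0 \<omega> = X0 \<omega>"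
  shows "AE \<omega> in M. \<forall>t\<in>{0..T}. X' t \<omega> = F (m t \<omega>) (Y t \<omega>)"
proof -
  have X'm: "X' t \<in> borel_measurable M" if "t \<in> {0..T}" for t
    using sol that by (simp add: is_solution_def random_process_def)
  obtain f V where f: "C_kl 2 1 f" and V: "\<And>\<omega>. \<omega> \<in> space M \<Longrightarrow> continuous_on {0..T} (\<lambda>t. V t \<omega>)"
      "\<And>\<omega>. \<omega> \<in> space M \<Longrightarrow> bounded_variation_on_interval T (\<lambda>t. V t \<omega>)"
    and X'f: "AE \<omega> in M. \<forall>t\<in>{0..T}. X' t \<omega> = f (m t \<omega>) (V t \<omega>)"
    using sol unfolding is_solution_def by blast
  obtain f1 f2 where fd: "\<And>x y. ((\<lambda>u. f u y) has_real_derivative f1 x y) (at x)"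
    "\<And>x y. (f x has_real_derivative f2 x y) (at y)"
    and fc: "continuous_on UNIV (\<lambda>(x, y). f x y)" "continuous_on UNIV (\<lambda>(x, y). f1 x y)"
    "continuous_on UNIV (\<lambda>(x, y). f2 x y)"
    by (rule C_kl_1_1E[OF f]) auto
  define Z where "Z s \<omega> = F_x (- m s \<omega>) (X' s \<omega>)" for s \<omega>
  define U where "U s \<omega> = F (- m s \<omega>) (X' s \<omega>)" for s \<omega>
  have Um: "U s \<in> borel_measurable M" if "s \<in> {0..T}" for s
    unfolding U_def[abs_def] using that
    by (intro borel_measurable_compose_curried[OF flow_cont] borel_measurable_uminus m_measurable X'm)
  have X'c: "continuous_on {0..T} (\<lambda>t. X' t \<omega>)"
    if \<omega>: "\<omega> \<in> space M" "\<forall>t\<in>{0..T}. X' t \<omega> = f (m t \<omega>) (V t \<omega>)" for \<omega>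
    by (rule continuous_on_eq[OF continuous_on_compose_curried[OF fc(1) paths[OF \<omega>(1)] V(1)[OF \<omega>(1)]]]) (simp add: \<omega>(2))
  have at_t: "AE \<omega> in M. U t \<omega> = U 0 \<omega> + (LBINT s:{0<..t}. Z s \<omega> * b (X' s \<omega>) s)" if t: "t \<in> {0..T}" for t
  proof -
    obtain I J where I: "has_symmetric_integral M Z X' t I"
      and J: "has_symmetric_integral M (\<lambda>s \<omega>. Z s \<omega> * \<sigma> (X' s \<omega>)) m t J"
      and IJ: "AE \<omega> in M. I \<omega> = J \<omega> + (LBINT s:{0<..t}. Z s \<omega> * b (X' s \<omega>) s)"
      using sol C_kl_deriv_inverse t unfolding is_solution_def Let_def Z_def[abs_def] by blast
    \<comment> \<open>The integrals are limits along every sequence of partitions, so a single one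
      suffices to identify \<open>I - J\<close>.\<close>
    obtain j p where p: "partition_sequence t j p" using uniform_partition_sequence[of t] t by auto
    have P: "partition_of t (j n) (p n)" for n using p by (simp add: partition_sequence_def)
    define SI where "SI n \<omega> = (\<Sum>k=1..j n. (Z (p n (k - 1)) \<omega> + Z (p n k) \<omega>) / 2 * (X' (p n k) \<omega> - X' (p n (k - 1)) \<omega>))" for n \<omega>
    define SJ where "SJ n \<omega> = (\<Sum>k=1..j n. (Z (p n (k - 1)) \<omega> * \<sigma> (X' (p n (k - 1)) \<omega>) + Z (p n k) \<omega> * \<sigma> (X' (p n k) \<omega>)) / 2
      * (m (p n k) \<omega> - m (p n (k - 1)) \<omega>))" for n \<omega>
    have SI: "tendsto_in_prob M SI I" and SJ: "tendsto_in_prob M SJ J"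
      using I J p unfolding has_symmetric_integral_def SI_def[abs_def] SJ_def[abs_def] by blast+
    define W where "W \<omega> s t = (m t \<omega> - m s \<omega>)\<^sup>2 + (X' t \<omega> - X' s \<omega>)\<^sup>2" for \<omega> and s t :: real
    define e where "e \<omega> s t = (Z s \<omega> + Z t \<omega>) / 2 * (X' t \<omega> - X' s \<omega>) -
      (Z s \<omega> * \<sigma> (X' s \<omega>) + Z t \<omega> * \<sigma> (X' t \<omega>)) / 2 * (m t \<omega> - m s \<omega>) - (U t \<omega> - U s \<omega>)" for \<omega> s t
    have "tendsto_in_prob M (\<lambda>n \<omega>. SI n \<omega> - SJ n \<omega>) (\<lambda>\<omega>. U t \<omega> - U 0 \<omega>)"
    proof (rule partition_sums_tendsto[OF t p, where w=W and e=e])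
      show "(\<lambda>\<omega>. SI n \<omega> - SJ n \<omega>) \<in> borel_measurable M" for n
        using SI SJ unfolding tendsto_in_prob_def by (intro borel_measurable_diff) auto
      show "(\<lambda>\<omega>. U t \<omega> - U 0 \<omega>) \<in> borel_measurable M"
        using Um[OF t] Um[of 0] T_pos by simp
      show "AE \<omega> in M. mesh_small T (W \<omega>) (e \<omega>) \<and>
          (\<exists>C. \<forall>n. (\<Sum>k=1..j n. W \<omega> (p n (k - 1)) (p n k)) \<le> C * (1 + quad_incr (\<lambda>s. m s \<omega>) (j n) (p n))) \<and>
          (\<forall>n. (SI n \<omega> - SJ n \<omega>) - (U t \<omega> - U 0 \<omega>) = (\<Sum>k=1..j n. e \<omega> (p n (k - 1)) (p n k)))"
        using AE_space X'f
      proof eventually_elim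
        case (elim \<omega>)
        have small: "mesh_small T (W \<omega>) (e \<omega>)"
          unfolding W_def e_def Z_def U_def by (rule inverse_flow_trapezoid[OF paths[OF elim(1)] X'c[OF elim]])
        obtain Cm where Cm: "0 \<le> Cm" "\<And>t. 0 \<le> t \<Longrightarrow> t \<le> T \<Longrightarrow> \<bar>m t \<omega>\<bar> \<le> Cm"
          using path_bounded[OF paths[OF elim(1)]] by blast
        obtain CV where CV: "0 \<le> CV" "\<And>t. 0 \<le> t \<Longrightarrow> t \<le> T \<Longrightarrow> \<bar>V t \<omega>\<bar> \<le> CV"
          using path_bounded[OF V(1)[OF elim(1)]] by blast
        define R where "R = max Cm CV"
        obtain D where D: "0 \<le> D" "\<And>a b a' b'. \<bar>a\<bar> \<le> R \<Longrightarrow> \<bar>b\<bar> \<le> R \<Longrightarrow> \<bar>a'\<bar> \<le> R \<Longrightarrow> \<bar>b'\<bar> \<le> R \<Longrightarrow>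
            \<bar>f a' b' - f a b\<bar> \<le> D * (\<bar>a' - a\<bar> + \<bar>b' - b\<bar>)"
          using partials_imp_lipschitz[OF fd fc(2,3), where R=R] by metis
        obtain B where B: "\<And>t n p. t \<le> T \<Longrightarrow> partition_of t n p \<Longrightarrow> quad_incr (\<lambda>s. V s \<omega>) n p \<le> B\<^sup>2"
          using bounded_variation_quad_incr[OF V(2)[OF elim(1)]] by metis
        \<comment> \<open>Increments of X' are at most \<open>D\<close> times those of
          \<open>m\<close> and \<open>V\<close> together. Squaring gives the factor
          \<open>2 * D\<^sup>2\<close>, and \<open>B\<^sup>2\<close> bounds the squared increments
          of \<open>V\<close>.\<close>
        define C where "C = 1 + 2 * D\<^sup>2 * (1 + B\<^sup>2)"
        have "(\<Sum>k=1..j n. W \<omega> (p n (k - 1)) (p n k)) \<le> C * (1 + quad_incr (\<lambda>s. m s \<omega>) (j n) (p n))" for n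
        proof -
          let ?Q = "quad_incr (\<lambda>s. m s \<omega>) (j n) (p n)" and ?QV = "quad_incr (\<lambda>s. V s \<omega>) (j n) (p n)"
          have "(X' (p n k) \<omega> - X' (p n (k - 1)) \<omega>)\<^sup>2 \<le>
              2 * D\<^sup>2 * ((m (p n k) \<omega> - m (p n (k - 1)) \<omega>)\<^sup>2 + (V (p n k) \<omega> - V (p n (k - 1)) \<omega>)\<^sup>2)"
            if k: "k \<in> {1..j n}" for k
          proof -
            have pts: "p n k \<in> {0..T}" "p n (k - 1) \<in> {0..T}"
              using partition_bounds[OF P k] t by auto
            let ?a = "\<bar>m (p n k) \<omega> - m (p n (k - 1)) \<omega>\<bar>" and ?b = "\<bar>V (p n k) \<omega> - V (p n (k - 1)) \<omega>\<bar>"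
            have R: "\<bar>m s \<omega>\<bar> \<le> R" "\<bar>V s \<omega>\<bar> \<le> R" if "s \<in> {0..T}" for s
              using Cm(2)[of s] CV(2)[of s] that by (auto simp: R_def)
            have "\<bar>X' (p n k) \<omega> - X' (p n (k - 1)) \<omega>\<bar> \<le> D * (?a + ?b)"
              unfolding bspec[OF elim(2) pts(1)] bspec[OF elim(2) pts(2)] by (intro D(2) R pts)
            then have "\<bar>X' (p n k) \<omega> - X' (p n (k - 1)) \<omega>\<bar>\<^sup>2 \<le> (D * (?a + ?b))\<^sup>2"
              by (rule power_mono) simp
            also have "\<dots> = D\<^sup>2 * (?a + ?b)\<^sup>2" by (rule power_mult_distrib)
            also have "\<dots> \<le> D\<^sup>2 * (2 * (?a\<^sup>2 + ?b\<^sup>2))"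
            proof (rule mult_left_mono)
              have "(a + b)\<^sup>2 \<le> 2 * (a\<^sup>2 + b\<^sup>2)" for a b :: real
                using zero_le_power2[of "a - b"] by (simp add: power2_eq_square algebra_simps)
              then show "(?a + ?b)\<^sup>2 \<le> 2 * (?a\<^sup>2 + ?b\<^sup>2)" .
            qed simp
            finally show ?thesis by (simp only: power2_abs mult_ac)
          qed
          then have "(\<Sum>k=1..j n. W \<omega> (p n (k - 1)) (p n k)) \<le>
              (\<Sum>k=1..j n. (m (p n k) \<omega> - m (p n (k - 1)) \<omega>)\<^sup>2 +
                2 * D\<^sup>2 * ((m (p n k) \<omega> - m (p n (k - 1)) \<omega>)\<^sup>2 + (V (p n k) \<omega> - V (p n (k - 1)) \<omega>)\<^sup>2))"
            unfolding W_def by (intro sum_mono add_left_mono)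
          also have "\<dots> = ?Q + 2 * D\<^sup>2 * (?Q + ?QV)"
            by (simp add: sum.distrib sum_distrib_left[symmetric])
          also have "\<dots> \<le> ?Q + 2 * D\<^sup>2 * (?Q + B\<^sup>2)"
            using B[OF _ P[of n]] t by (intro add_left_mono mult_left_mono) auto
          also have "\<dots> \<le> C * (1 + ?Q)"
          proof -
            have "0 \<le> ?Q" by (simp add: sum_nonneg)
            moreover have "q + 2 * d * (q + c) \<le> (1 + 2 * d * (1 + c)) * (1 + q)" if "0 \<le> q" "0 \<le> d" "0 \<le> c" for q d c :: real
            proof -
              have "0 \<le> d * c * q" "0 \<le> d" using that by auto
              then show ?thesis by (simp add: algebra_simps)
            qed
            ultimately show ?thesis unfolding C_def by simp
          qed
          finally show ?thesis .
        qed
        moreover have "(SI n \<omega> - SJ n \<omega>) - (U t \<omega> - U 0 \<omega>) = (\<Sum>k=1..j n. e \<omega> (p n (k - 1)) (p n k))" for n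
          using partition_telescope[OF P[of n], of "\<lambda>s. U s \<omega>"]
          unfolding SI_def SJ_def e_def sum_subtractf by simp
        ultimately show ?case using small by blast
      qed
    qed
    from tendsto_in_prob_unique[OF tendsto_in_prob_diff[OF SI SJ] this] IJ show ?thesis
      by eventually_elim simp
  qed
  \<comment> \<open>The null set in \<open>at_t\<close> depends on the time, so the identities are
    first collected over a countable dense set and then extended by continuity.\<close>
  let ?D = "insert T (\<rat> \<inter> {0..T})"
  have "countable ?D" using countable_rat by (auto intro: countable_subset)
  then have "AE \<omega> in M. \<forall>t\<in>?D. U t \<omega> = U 0 \<omega> + (LBINT s:{0<..t}. Z s \<omega> * b (X' s \<omega>) s)"
    using at_t T_pos by (subst AE_ball_countable) auto
  with AE_space X'f init m_0 show ?thesis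
  proof eventually_elim
    case (elim \<omega>)
    note X'c = X'c[OF elim(1,2)]
    have FU: "F (m s \<omega>) (U s \<omega>) = X' s \<omega>" for s by (simp add: U_def flow_inverse)
    have rhsU: "Z s \<omega> * b (X' s \<omega>) s = rhs \<omega> s (U s \<omega>)" for s by (simp add: rhs_def FU Z_def)
    have Uc: "continuous_on {0..T} (\<lambda>s. U s \<omega>)"
      unfolding U_def by (intro continuous_intros paths[OF elim(1)] X'c)
    have rc: "continuous_on {0..T} (\<lambda>s. rhs \<omega> s (U s \<omega>))"
      by (intro continuous_on_compose_time[OF rhs_cont[OF elim(1)]] Uc order.refl)
    \<comment> \<open>Combines the initial condition with \<open>m 0 = 0\<close>, both of which hold
      only almost surely.\<close>
    have U0: "U 0 \<omega> = X0 \<omega>" using elim(3,4) by (simp add: U_def flow_0)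
    have "solves_path \<omega> (\<lambda>t. U t \<omega>)"
      unfolding solves_path_def
    proof (intro conjI ballI Uc)
      fix t assume t: "t \<in> {0..T}"
      have "U t \<omega> - (X0 \<omega> + integral {0..t} (\<lambda>s. rhs \<omega> s (U s \<omega>))) = 0"
      proof (rule continuous_zero_from_rationals[OF _ _ t])
        show "continuous_on {0..T} (\<lambda>t. U t \<omega> - (X0 \<omega> + integral {0..t} (\<lambda>s. rhs \<omega> s (U s \<omega>))))"
          by (intro continuous_intros Uc indefinite_integral_continuous_1 integrable_continuous_real rc)
        fix r assume r: "r \<in> ?D"
        then have "r \<in> {0..T}" using T_pos by auto
        then have "(LBINT s:{0<..r}. rhs \<omega> s (U s \<omega>)) = integral {0..r} (\<lambda>s. rhs \<omega> s (U s \<omega>))"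
          by (intro set_lebesgue_integral_Ioc_eq_integral continuous_on_subset[OF rc]) auto
        then show "U r \<omega> - (X0 \<omega> + integral {0..r} (\<lambda>s. rhs \<omega> s (U s \<omega>))) = 0"
          using bspec[OF elim(5) r] U0 by (simp add: rhsU)
      qed
      then show "U t \<omega> = X0 \<omega> + integral {0..t} (\<lambda>s. rhs \<omega> s (U s \<omega>))" by simp
    qed
    from solves_path_unique[OF elim(1) this solves_path_Y[OF elim(1)]]
    have "U t \<omega> = Y t \<omega>" if "t \<in> {0..T}" for t using that by blast
    then show ?case using FU by metis
  qed
qed

end

theorem theorem5p1:
  fixes P :: "'w measure"
    and T :: real
    and \<mu> :: "real set \<Rightarrow> 'w \<Rightarrow> real"
    and \<sigma> :: "real \<Rightarrow> real"
    and b :: "real \<Rightarrow> real \<Rightarrow> real"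
    and X0 :: "'w \<Rightarrow> real"
    and F H :: "real \<Rightarrow> real \<Rightarrow> real"
  assumes "prob_space P" and "complete_measure P"
    and "T > 0"
    and "stochastic_measure P (restrict_space borel {0..T}) \<mu>"
    and "\<forall>\<omega>\<in>space P. continuous_on {0..T} (\<lambda>t. mu_process \<mu> t \<omega>)"
    and "C_k 2 \<sigma>" and "bounded (range (deriv \<sigma>))" and "bounded (range (deriv (deriv \<sigma>)))"
    and "continuous_on (UNIV \<times> {0..T}) (\<lambda>(x, t). b x t)"
    and "\<forall>C>0. \<exists>L. \<forall>x y. \<forall>t\<in>{0..T}. \<bar>x\<bar> \<le> C \<longrightarrow> \<bar>y\<bar> \<le> C \<longrightarrow>
           \<bar>b x t - b y t\<bar> \<le> L * \<bar>x - y\<bar>"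
    and "\<exists>K. \<forall>x. \<forall>t\<in>{0..T}. \<bar>b x t\<bar> \<le> K * (1 + \<bar>x\<bar>)"
    and "X0 \<in> borel_measurable P"
    and "\<forall>r x. ((\<lambda>u. F u x) has_real_derivative \<sigma> (F r x)) (at r)"
    and "\<forall>x. F 0 x = x"
    and "\<forall>r. H r = inv (F r)"
  shows "\<exists>Y. random_process P T Y \<and>
           solves_random_equation P T \<mu> b F H X0 Y \<and>
           (\<forall>Y'. solves_random_equation P T \<mu> b F H X0 Y' \<longrightarrow>
              (\<forall>\<omega>\<in>space P. \<forall>t\<in>{0..T}. Y' t \<omega> = Y t \<omega>)) \<and>
           is_solution P T \<mu> \<sigma> b (\<lambda>t \<omega>. F (mu_process \<mu> t \<omega>) (Y t \<omega>)) \<and>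
           (AE \<omega> in P. F (mu_process \<mu> 0 \<omega>) (Y 0 \<omega>) = X0 \<omega>) \<and>
           (\<forall>X. is_solution P T \<mu> \<sigma> b X \<longrightarrow> (AE \<omega> in P. X 0 \<omega> = X0 \<omega>) \<longrightarrow>
              (AE \<omega> in P. \<forall>t\<in>{0..T}. X t \<omega> = F (mu_process \<mu> t \<omega>) (Y t \<omega>)))"
proof -
  obtain L where L: "\<And>x. \<bar>deriv \<sigma> x\<bar> \<le> L"
    using assms(7) by (auto simp: bounded_iff)
  obtain K where K: "\<And>x t. t \<in> {0..T} \<Longrightarrow> \<bar>b x t\<bar> \<le> K * (1 + \<bar>x\<bar>)"
    using assms(11) by blast
  have flow: "flow \<sigma> F L"
    using assms(6,13,14) L by (intro flow.intro) auto
  have csm: "continuous_stochastic_measure P T \<mu>"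
    using assms(1,3,4,5)
    by (intro continuous_stochastic_measure.intro stochastic_measure_on.intro stochastic_measure_on_axioms.intro
        continuous_stochastic_measure_axioms.intro) auto
  interpret symmetric_sde \<sigma> F L P T \<mu> b K X0
    using flow csm assms(9,10,12) K by (intro symmetric_sde.intro symmetric_sde_axioms.intro) blast+
  have H: "H = (\<lambda>r. inv (F r))" using assms(15) by auto
  have "AE \<omega> in P. F (m 0 \<omega>) (Y 0 \<omega>) = X0 \<omega>"
    using AE_space m_0
  proof eventually_elim
    case (elim \<omega>)
    have "Y 0 \<omega> = X0 \<omega>" using Y_path(3)[OF elim(1), of 0] T_pos by simp
    then show ?case using elim(2) by (simp add: flow_0)
  qed
  moreover have "random_process P T Y" using Y_measurable by (auto simp: random_process_def)
  moreover have "solves_random_equation P T \<mu> b F H X0 Y"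
    unfolding H solves_random_equation_iff using solves_path_Y by blast
  moreover have "Y' t \<omega> = Y t \<omega>" if "solves_random_equation P T \<mu> b F H X0 Y'" "\<omega> \<in> space P" "t \<in> {0..T}" for Y' t \<omega>
    using that solves_path_unique[OF that(2) _ solves_path_Y[OF that(2)] that(3)]
    unfolding H solves_random_equation_iff by blast
  moreover have "is_solution P T \<mu> \<sigma> b (\<lambda>t \<omega>. F (m t \<omega>) (Y t \<omega>))"
    using is_solution_X unfolding X_def[abs_def] .
  ultimately show ?thesis using solution_unique by blast
qed

end
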